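(* Let $\mathbb{B}$ be a bicategory and $\eta_f,\varepsilon_f:f\dashv f^*:\mathcal{B}\to\mathcal{A}$ an adjunction in $\mathbb{B}$ (so $f:\mathcal{A}\to\mathcal{B}$) with $f$ a separable 1-cell, i.e. $\eta_f:1_{\mathcal{A}}\to f^*\otimes f$ is a split monomorphism in $\mathbb{B}(\mathcal{A},\mathcal{A})$. If idempotents split in the category $\mathbb{B}(\mathcal{A},\mathcal{A})$, then each of the maps $$\Gamma_f:\mathbf{I}^l_{\mathbb{B}(\mathcal{A},\mathcal{A})}(S_f)\to\mathrm{End}_{\mathcal{B}}(\mathfrak{C}_f,\mathfrak{C}_f)\quad\text{and}\quad\Gamma_{f^*}:(\mathbf{I}^r_{\mathbb{B}(\mathcal{A},\mathcal{A})}(S_f))^{\mathrm{op}}\to\mathrm{End}_{\mathcal{B}}(\mathfrak{C}_f,\mathfrak{C}_f)$$ is an isomorphism of monoids.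
   Context: In a bicategory, the horizontal composite of $f:\mathcal{A}\to\mathcal{B}$ and $g:\mathcal{B}\to\mathcal{C}$ is written $g\otimes f$; a 1-cell also denotes its identity 2-cell; associativity and unit constraints are suppressed below. An adjunction $\eta_f,\varepsilon_f:f\dashv f^*$ consists of 2-cells $\eta_f:1_{\mathcal{A}}\to f^*\otimes f$, $\varepsilon_f:f\otimes f^*\to 1_{\mathcal{B}}$ satisfying the triangle identities. $S_f=(f^*\otimes f,\ f^*\otimes\varepsilon_f\otimes f,\ \eta_f)$ is a monoid in the monoidal category $\mathbb{B}(\mathcal{A},\mathcal{A})$; $\mathfrak{C}_f=(f\otimes f^*,\ f\otimes\eta_f\otimes f^*,\ \varepsilon_f)$ is a comonoid in $\mathbb{B}(\mathcal{B},\mathcal{B})$; $\mathrm{End}_{\mathcal{B}}(\mathfrak{C}_f,\mathfrak{C}_f)$ is the monoid, under composition, of its comonoid endomorphisms. For a monoid $\mathbb{S}=(S,e_S,m_S)$ in a monoidal category $\mathcal{V}$, $\mathbf{I}^l_{\mathcal{V}}(\mathbb{S})$ (resp. $\mathbf{I}^r_{\mathcal{V}}(\mathbb{S})$) is the class of subobjects $[(J,i_J:J\to S)]$ of $S$ such that $m_S\cdot(S\otimes i_J):S\otimes J\to S$ (resp. $m_S\cdot(i_J\otimes S):J\otimes S\to S$) is an isomorphism. When $e_S\otimes X$ (resp. $X\otimes e_S$) is a monomorphism for all $X$, it is a monoid with product $[(J_1,i_{J_1})]\cdot[(J_2,i_{J_2})]=[(J_1\otimes J_2,\,m_S\cdot(i_{J_1}\otimes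 i_{J_2}))]$ and unit $[(I,e_S)]$. $\Gamma_f$ sends $[(h,i_h)]$ to $(f\otimes f^*\otimes\varepsilon_f)\cdot(f\otimes i_h\otimes f^* )\cdot(\xi_{i_h}^{-1}\otimes f^* )$, where $\xi_{i_h}=(\varepsilon_f\otimes f)\cdot(f\otimes i_h):f\otimes h\to f$ (invertible). $\Gamma_{f^*}$ sends $[(h,i_h)]$ to $(\varepsilon_f\otimes f\otimes f^* )\cdot(f\otimes i_h\otimes f^* )\cdot(f\otimes\xi_{i_h}^{-1})$, where $\xi_{i_h}=(f^*\otimes\varepsilon_f)\cdot(i_h\otimes f^* ):h\otimes f^*\to f^*$ (invertible). *)

theory Defs
  imports "HOL-Algebra.Group"
begin

section \<open>Categories\<close>

text \<open>
  Hom-sets are families indexed by the objects and are not required to be disjoint; an arrow is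
  therefore always accompanied by its domain and codomain.
\<close>

record ('m, 'c) cat_data =
  Ob :: "'m set"
  Hom :: "'m \<Rightarrow> 'm \<Rightarrow> 'c set"
  Id :: "'m \<Rightarrow> 'c"
  Comp :: "'c \<Rightarrow> 'c \<Rightarrow> 'c"  (infixr "\<cdot>\<index>" 60)

locale category =
  fixes C :: "('m, 'c, 'z) cat_data_scheme" (structure)
  assumes Id_Hom: "X \<in> Ob C \<Longrightarrow> Id C X \<in> Hom C X X"
    and Comp_Hom: "\<lbrakk>X \<in> Ob C; Y \<in> Ob C; Z \<in> Ob C; u \<in> Hom C X Y; v \<in> Hom C Y Z\<rbrakk>
          \<Longrightarrow> v \<cdot> u \<in> Hom C X Z"
    and Comp_Id: "\<lbrakk>X \<in> Ob C; Y \<in> Ob C; u \<in> Hom C X Y\<rbrakk> \<Longrightarrow> u \<cdot> Id C X = u"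
    and Id_Comp: "\<lbrakk>X \<in> Ob C; Y \<in> Ob C; u \<in> Hom C X Y\<rbrakk> \<Longrightarrow> Id C Y \<cdot> u = u"
    and Comp_assoc: "\<lbrakk>W \<in> Ob C; X \<in> Ob C; Y \<in> Ob C; Z \<in> Ob C;
            u \<in> Hom C W X; v \<in> Hom C X Y; w \<in> Hom C Y Z\<rbrakk>
          \<Longrightarrow> (w \<cdot> v) \<cdot> u = w \<cdot> (v \<cdot> u)"

context
  fixes C :: "('m, 'c, 'z) cat_data_scheme" (structure)
begin

definition inverse_arrows :: "'m \<Rightarrow> 'm \<Rightarrow> 'c \<Rightarrow> 'c \<Rightarrow> bool" where
  "inverse_arrows X Y u v \<longleftrightarrow>
     u \<in> Hom C X Y \<and> v \<in> Hom C Y X \<and> v \<cdot> u = Id C X \<and> u \<cdot> v = Id C Y"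

definition iso_arrow :: "'m \<Rightarrow> 'm \<Rightarrow> 'c \<Rightarrow> bool" where
  "iso_arrow X Y u \<longleftrightarrow> (\<exists>v. inverse_arrows X Y u v)"

definition mono_arrow :: "'m \<Rightarrow> 'm \<Rightarrow> 'c \<Rightarrow> bool" where
  "mono_arrow X Y i \<longleftrightarrow> X \<in> Ob C \<and> Y \<in> Ob C \<and> i \<in> Hom C X Y \<and>
     (\<forall>W \<in> Ob C. \<forall>u \<in> Hom C W X. \<forall>v \<in> Hom C W X. i \<cdot> u = i \<cdot> v \<longrightarrow> u = v)"

definition split_mono_arrow :: "'m \<Rightarrow> 'm \<Rightarrow> 'c \<Rightarrow> bool" where
  "split_mono_arrow X Y i \<longleftrightarrow> X \<in> Ob C \<and> Y \<in> Ob C \<and> i \<in> Hom C X Y \<and>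
     (\<exists>r \<in> Hom C Y X. r \<cdot> i = Id C X)"

definition idempotents_split :: bool where
  "idempotents_split \<longleftrightarrow>
     (\<forall>X \<in> Ob C. \<forall>p \<in> Hom C X X. p \<cdot> p = p \<longrightarrow>
        (\<exists>Y \<in> Ob C. \<exists>r \<in> Hom C X Y. \<exists>s \<in> Hom C Y X. s \<cdot> r = p \<and> r \<cdot> s = Id C Y))"

text \<open>The isomorphism class over \<open>S\<close> of a pair \<open>(J, i)\<close>, for \<open>i\<close> an arrow from \<open>J\<close> to \<open>S\<close>.\<close>

definition subobject_class :: "'m \<Rightarrow> 'm \<times> 'c \<Rightarrow> ('m \<times> 'c) set" where
  "subobject_class S = (\<lambda>(J, i).
     {(J', i'). J' \<in> Ob C \<and> i' \<in> Hom C J' S \<and> (\<exists>\<phi>. iso_arrow J' J \<phi> \<and> i' = i \<cdot> \<phi>)})"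

end

section \<open>Monoidal categories\<close>

record ('m, 'c) moncat_data = "('m, 'c) cat_data" +
  Tensor :: "'m \<Rightarrow> 'm \<Rightarrow> 'm"  (infixr "\<otimes>\<^sub>o\<index>" 70)
  Tensor_arr :: "'c \<Rightarrow> 'c \<Rightarrow> 'c"  (infixr "\<otimes>\<^sub>a\<index>" 70)
  Unit :: "'m"
  Assoc :: "'m \<Rightarrow> 'm \<Rightarrow> 'm \<Rightarrow> 'c"
  Lunit :: "'m \<Rightarrow> 'c"
  Runit :: "'m \<Rightarrow> 'c"

locale monoidal_category = category V
  for V :: "('m, 'c, 'z) moncat_data_scheme" (structure) +
  assumes Tensor_Ob: "\<lbrakk>X \<in> Ob V; Y \<in> Ob V\<rbrakk> \<Longrightarrow> X \<otimes>\<^sub>o Y \<in> Ob V"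
    and Unit_Ob: "Unit V \<in> Ob V"
    and Tensor_Hom: "\<lbrakk>X \<in> Ob V; X' \<in> Ob V; Y \<in> Ob V; Y' \<in> Ob V; u \<in> Hom V X X'; v \<in> Hom V Y Y'\<rbrakk>
          \<Longrightarrow> u \<otimes>\<^sub>a v \<in> Hom V (X \<otimes>\<^sub>o Y) (X' \<otimes>\<^sub>o Y')"
    and Tensor_Id: "\<lbrakk>X \<in> Ob V; Y \<in> Ob V\<rbrakk> \<Longrightarrow> Id V X \<otimes>\<^sub>a Id V Y = Id V (X \<otimes>\<^sub>o Y)"
    and Tensor_Comp: "\<lbrakk>X \<in> Ob V; X' \<in> Ob V; X'' \<in> Ob V; Y \<in> Ob V; Y' \<in> Ob V; Y'' \<in> Ob V;
            u \<in> Hom V X X'; u' \<in> Hom V X' X''; v \<in> Hom V Y Y'; v' \<in> Hom V Y' Y''\<rbrakk>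
          \<Longrightarrow> (u' \<cdot> u) \<otimes>\<^sub>a (v' \<cdot> v) = (u' \<otimes>\<^sub>a v') \<cdot> (u \<otimes>\<^sub>a v)"
    and Assoc_iso: "\<lbrakk>X \<in> Ob V; Y \<in> Ob V; Z \<in> Ob V\<rbrakk>
          \<Longrightarrow> iso_arrow V ((X \<otimes>\<^sub>o Y) \<otimes>\<^sub>o Z) (X \<otimes>\<^sub>o (Y \<otimes>\<^sub>o Z)) (Assoc V X Y Z)"
    and Assoc_natural: "\<lbrakk>X \<in> Ob V; X' \<in> Ob V; Y \<in> Ob V; Y' \<in> Ob V; Z \<in> Ob V; Z' \<in> Ob V;
            u \<in> Hom V X X'; v \<in> Hom V Y Y'; w \<in> Hom V Z Z'\<rbrakk>
          \<Longrightarrow> Assoc V X' Y' Z' \<cdot> ((u \<otimes>\<^sub>a v) \<otimes>\<^sub>a w) = (u \<otimes>\<^sub>a (v \<otimes>\<^sub>a w)) \<cdot> Assoc V X Y Z"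
    and Lunit_iso: "X \<in> Ob V \<Longrightarrow> iso_arrow V (Unit V \<otimes>\<^sub>o X) X (Lunit V X)"
    and Lunit_natural: "\<lbrakk>X \<in> Ob V; X' \<in> Ob V; u \<in> Hom V X X'\<rbrakk>
          \<Longrightarrow> Lunit V X' \<cdot> (Id V (Unit V) \<otimes>\<^sub>a u) = u \<cdot> Lunit V X"
    and Runit_iso: "X \<in> Ob V \<Longrightarrow> iso_arrow V (X \<otimes>\<^sub>o Unit V) X (Runit V X)"
    and Runit_natural: "\<lbrakk>X \<in> Ob V; X' \<in> Ob V; u \<in> Hom V X X'\<rbrakk>
          \<Longrightarrow> Runit V X' \<cdot> (u \<otimes>\<^sub>a Id V (Unit V)) = u \<cdot> Runit V X"
    and pentagon: "\<lbrakk>W \<in> Ob V; X \<in> Ob V; Y \<in> Ob V; Z \<in> Ob V\<rbrakk>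
          \<Longrightarrow> (Id V W \<otimes>\<^sub>a Assoc V X Y Z) \<cdot> Assoc V W (X \<otimes>\<^sub>o Y) Z \<cdot> (Assoc V W X Y \<otimes>\<^sub>a Id V Z)
            = Assoc V W X (Y \<otimes>\<^sub>o Z) \<cdot> Assoc V (W \<otimes>\<^sub>o X) Y Z"
    and triangle: "\<lbrakk>X \<in> Ob V; Y \<in> Ob V\<rbrakk>
          \<Longrightarrow> (Id V X \<otimes>\<^sub>a Lunit V Y) \<cdot> Assoc V X (Unit V) Y = Runit V X \<otimes>\<^sub>a Id V Y"

record ('m, 'c) monoid_data =
  mon_obj :: 'm
  mon_unit :: 'c
  mon_mult :: 'c

record ('m, 'c) comonoid_data =
  comon_obj :: 'm
  comon_comult :: 'c
  comon_counit :: 'c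

context
  fixes V :: "('m, 'c, 'z) moncat_data_scheme" (structure)
begin

definition comonoid_endos :: "('m, 'c) comonoid_data \<Rightarrow> 'c set" where
  "comonoid_endos K = {c \<in> Hom V (comon_obj K) (comon_obj K).
     comon_comult K \<cdot> c = (c \<otimes>\<^sub>a c) \<cdot> comon_comult K \<and>
     comon_counit K \<cdot> c = comon_counit K}"

definition End_monoid :: "('m, 'c) comonoid_data \<Rightarrow> 'c monoid" where
  "End_monoid K = \<lparr>carrier = comonoid_endos K, mult = (\<lambda>c d. c \<cdot> d), one = Id V (comon_obj K)\<rparr>"

definition Il_rep :: "('m, 'c) monoid_data \<Rightarrow> 'm \<Rightarrow> 'c \<Rightarrow> bool" where
  "Il_rep M J i \<longleftrightarrow> mono_arrow V J (mon_obj M) i \<and>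
     iso_arrow V (mon_obj M \<otimes>\<^sub>o J) (mon_obj M) (mon_mult M \<cdot> (Id V (mon_obj M) \<otimes>\<^sub>a i))"

definition Ir_rep :: "('m, 'c) monoid_data \<Rightarrow> 'm \<Rightarrow> 'c \<Rightarrow> bool" where
  "Ir_rep M J i \<longleftrightarrow> mono_arrow V J (mon_obj M) i \<and>
     iso_arrow V (J \<otimes>\<^sub>o mon_obj M) (mon_obj M) (mon_mult M \<cdot> (i \<otimes>\<^sub>a Id V (mon_obj M)))"

text \<open>
  Products are defined without choosing representatives: one takes the union of the classes of
  the products of all pairs of representatives, and this union is a single class exactly when the
  product of classes is well defined.
\<close>

definition subobject_mult ::
    "('m, 'c) monoid_data \<Rightarrow> ('m \<times> 'c) set \<Rightarrow> ('m \<times> 'c) set \<Rightarrow> ('m \<times> 'c) set" where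
  "subobject_mult M X Y = (\<Union>(J\<^sub>1, i\<^sub>1) \<in> X. \<Union>(J\<^sub>2, i\<^sub>2) \<in> Y.
     subobject_class V (mon_obj M) (J\<^sub>1 \<otimes>\<^sub>o J\<^sub>2, mon_mult M \<cdot> (i\<^sub>1 \<otimes>\<^sub>a i\<^sub>2)))"

definition Il_monoid :: "('m, 'c) monoid_data \<Rightarrow> ('m \<times> 'c) set monoid" where
  "Il_monoid M = \<lparr>carrier = {subobject_class V (mon_obj M) (J, i) | J i. Il_rep M J i},
     mult = subobject_mult M,
     one = subobject_class V (mon_obj M) (Unit V, mon_unit M)\<rparr>"

definition Ir_monoid :: "('m, 'c) monoid_data \<Rightarrow> ('m \<times> 'c) set monoid" where
  "Ir_monoid M = \<lparr>carrier = {subobject_class V (mon_obj M) (J, i) | J i. Ir_rep M J i},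
     mult = subobject_mult M,
     one = subobject_class V (mon_obj M) (Unit V, mon_unit M)\<rparr>"

end

definition opposite_monoid :: "('a, 'z) monoid_scheme \<Rightarrow> 'a monoid" where
  "opposite_monoid G = \<lparr>carrier = carrier G, mult = (\<lambda>x y. y \<otimes>\<^bsub>G\<^esub> x), one = \<one>\<^bsub>G\<^esub>\<rparr>"

definition monoid_isomorphism ::
    "('a, 'y) monoid_scheme \<Rightarrow> ('b, 'z) monoid_scheme \<Rightarrow> ('a \<Rightarrow> 'b) \<Rightarrow> bool" where
  "monoid_isomorphism G H h \<longleftrightarrow> monoid G \<and> monoid H \<and> h \<in> iso G H \<and> h \<one>\<^bsub>G\<^esub> = \<one>\<^bsub>H\<^esub>"

section \<open>Bicategories\<close>

text \<open>
  \<open>one_cells B a b\<close> are the 1-cells from \<open>a\<close> to \<open>b\<close> and \<open>two_cells B f g\<close> the 2-cells from \<open>f\<close>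
  to \<open>g\<close>. Horizontal composition is written in applicative order: \<open>g \<otimes>\<^sub>1 f\<close> runs
  from \<open>a\<close> to \<open>c\<close> for \<open>f\<close> from \<open>a\<close> to \<open>b\<close> and \<open>g\<close> from \<open>b\<close> to \<open>c\<close>. The associator
  \<open>assoc B h g f\<close> goes from \<open>(h \<otimes>\<^sub>1 g) \<otimes>\<^sub>1 f\<close> to \<open>h \<otimes>\<^sub>1 (g \<otimes>\<^sub>1 f)\<close>.
\<close>

record ('o, 'm, 'c) bicat_data =
  zero_cells :: "'o set"
  one_cells :: "'o \<Rightarrow> 'o \<Rightarrow> 'm set"
  two_cells :: "'m \<Rightarrow> 'm \<Rightarrow> 'c set"
  id2 :: "'m \<Rightarrow> 'c"  ("\<iota>\<index> _" [91] 90)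
  vcomp :: "'c \<Rightarrow> 'c \<Rightarrow> 'c"  (infixr "\<bullet>\<index>" 60)
  id1 :: "'o \<Rightarrow> 'm"
  hcomp1 :: "'m \<Rightarrow> 'm \<Rightarrow> 'm"  (infixr "\<otimes>\<^sub>1\<index>" 70)
  hcomp2 :: "'c \<Rightarrow> 'c \<Rightarrow> 'c"  (infixr "\<otimes>\<^sub>2\<index>" 70)
  assoc :: "'m \<Rightarrow> 'm \<Rightarrow> 'm \<Rightarrow> 'c"
  lunit :: "'m \<Rightarrow> 'c"
  runit :: "'m \<Rightarrow> 'c"

definition hom_cat :: "('o, 'm, 'c, 'z) bicat_data_scheme \<Rightarrow> 'o \<Rightarrow> 'o \<Rightarrow> ('m, 'c) cat_data" where
  "hom_cat B a b = \<lparr>Ob = one_cells B a b, Hom = two_cells B, Id = id2 B, Comp = vcomp B\<rparr>"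

definition endo_cat :: "('o, 'm, 'c, 'z) bicat_data_scheme \<Rightarrow> 'o \<Rightarrow> ('m, 'c) moncat_data" where
  "endo_cat B a = \<lparr>Ob = one_cells B a a, Hom = two_cells B, Id = id2 B, Comp = vcomp B,
     Tensor = hcomp1 B, Tensor_arr = hcomp2 B, Unit = id1 B a,
     Assoc = assoc B, Lunit = lunit B, Runit = runit B\<rparr>"

locale bicategory =
  fixes B :: "('o, 'm, 'c, 'z) bicat_data_scheme" (structure)
  assumes hom_category: "\<lbrakk>a \<in> zero_cells B; b \<in> zero_cells B\<rbrakk> \<Longrightarrow> category (hom_cat B a b)"
    and id1_cell: "a \<in> zero_cells B \<Longrightarrow> id1 B a \<in> one_cells B a a"
    and hcomp1_cell: "\<lbrakk>a \<in> zero_cells B; b \<in> zero_cells B; c \<in> zero_cells B;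
            f \<in> one_cells B a b; g \<in> one_cells B b c\<rbrakk> \<Longrightarrow> g \<otimes>\<^sub>1 f \<in> one_cells B a c"
    and hcomp2_cell: "\<lbrakk>a \<in> zero_cells B; b \<in> zero_cells B; c \<in> zero_cells B;
            f \<in> one_cells B a b; f' \<in> one_cells B a b; g \<in> one_cells B b c; g' \<in> one_cells B b c;
            \<alpha> \<in> two_cells B f f'; \<beta> \<in> two_cells B g g'\<rbrakk>
          \<Longrightarrow> \<beta> \<otimes>\<^sub>2 \<alpha> \<in> two_cells B (g \<otimes>\<^sub>1 f) (g' \<otimes>\<^sub>1 f')"
    and hcomp2_id: "\<lbrakk>a \<in> zero_cells B; b \<in> zero_cells B; c \<in> zero_cells B;
            f \<in> one_cells B a b; g \<in> one_cells B b c\<rbrakk> \<Longrightarrow> \<iota> g \<otimes>\<^sub>2 \<iota> f = \<iota> (g \<otimes>\<^sub>1 f)"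
    and interchange: "\<lbrakk>a \<in> zero_cells B; b \<in> zero_cells B; c \<in> zero_cells B;
            f \<in> one_cells B a b; f' \<in> one_cells B a b; f'' \<in> one_cells B a b;
            g \<in> one_cells B b c; g' \<in> one_cells B b c; g'' \<in> one_cells B b c;
            \<alpha> \<in> two_cells B f f'; \<alpha>' \<in> two_cells B f' f'';
            \<beta> \<in> two_cells B g g'; \<beta>' \<in> two_cells B g' g''\<rbrakk>
          \<Longrightarrow> (\<beta>' \<bullet> \<beta>) \<otimes>\<^sub>2 (\<alpha>' \<bullet> \<alpha>) = (\<beta>' \<otimes>\<^sub>2 \<alpha>') \<bullet> (\<beta> \<otimes>\<^sub>2 \<alpha>)"
    and assoc_iso: "\<lbrakk>a \<in> zero_cells B; b \<in> zero_cells B; c \<in> zero_cells B; d \<in> zero_cells B;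
            f \<in> one_cells B a b; g \<in> one_cells B b c; h \<in> one_cells B c d\<rbrakk>
          \<Longrightarrow> iso_arrow (hom_cat B a d) ((h \<otimes>\<^sub>1 g) \<otimes>\<^sub>1 f) (h \<otimes>\<^sub>1 (g \<otimes>\<^sub>1 f)) (assoc B h g f)"
    and assoc_natural: "\<lbrakk>a \<in> zero_cells B; b \<in> zero_cells B; c \<in> zero_cells B; d \<in> zero_cells B;
            f \<in> one_cells B a b; f' \<in> one_cells B a b; g \<in> one_cells B b c; g' \<in> one_cells B b c;
            h \<in> one_cells B c d; h' \<in> one_cells B c d;
            \<alpha> \<in> two_cells B f f'; \<beta> \<in> two_cells B g g'; \<gamma> \<in> two_cells B h h'\<rbrakk>
          \<Longrightarrow> assoc B h' g' f' \<bullet> ((\<gamma> \<otimes>\<^sub>2 \<beta>) \<otimes>\<^sub>2 \<alpha>) = (\<gamma> \<otimes>\<^sub>2 (\<beta> \<otimes>\<^sub>2 \<alpha>)) \<bullet> assoc B h g f"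
    and lunit_iso: "\<lbrakk>a \<in> zero_cells B; b \<in> zero_cells B; f \<in> one_cells B a b\<rbrakk>
          \<Longrightarrow> iso_arrow (hom_cat B a b) (id1 B b \<otimes>\<^sub>1 f) f (lunit B f)"
    and lunit_natural: "\<lbrakk>a \<in> zero_cells B; b \<in> zero_cells B; f \<in> one_cells B a b;
            f' \<in> one_cells B a b; \<alpha> \<in> two_cells B f f'\<rbrakk>
          \<Longrightarrow> lunit B f' \<bullet> (\<iota> (id1 B b) \<otimes>\<^sub>2 \<alpha>) = \<alpha> \<bullet> lunit B f"
    and runit_iso: "\<lbrakk>a \<in> zero_cells B; b \<in> zero_cells B; f \<in> one_cells B a b\<rbrakk>
          \<Longrightarrow> iso_arrow (hom_cat B a b) (f \<otimes>\<^sub>1 id1 B a) f (runit B f)"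
    and runit_natural: "\<lbrakk>a \<in> zero_cells B; b \<in> zero_cells B; f \<in> one_cells B a b;
            f' \<in> one_cells B a b; \<alpha> \<in> two_cells B f f'\<rbrakk>
          \<Longrightarrow> runit B f' \<bullet> (\<alpha> \<otimes>\<^sub>2 \<iota> (id1 B a)) = \<alpha> \<bullet> runit B f"
    and pentagon: "\<lbrakk>a \<in> zero_cells B; b \<in> zero_cells B; c \<in> zero_cells B; d \<in> zero_cells B;
            e \<in> zero_cells B; f \<in> one_cells B a b; g \<in> one_cells B b c; h \<in> one_cells B c d;
            k \<in> one_cells B d e\<rbrakk>
          \<Longrightarrow> (\<iota> k \<otimes>\<^sub>2 assoc B h g f) \<bullet> assoc B k (h \<otimes>\<^sub>1 g) f \<bullet> (assoc B k h g \<otimes>\<^sub>2 \<iota> f)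
            = assoc B k h (g \<otimes>\<^sub>1 f) \<bullet> assoc B (k \<otimes>\<^sub>1 h) g f"
    and triangle: "\<lbrakk>a \<in> zero_cells B; b \<in> zero_cells B; c \<in> zero_cells B;
            f \<in> one_cells B a b; g \<in> one_cells B b c\<rbrakk>
          \<Longrightarrow> (\<iota> g \<otimes>\<^sub>2 lunit B f) \<bullet> assoc B g (id1 B b) f = runit B g \<otimes>\<^sub>2 \<iota> f"

lemma endo_cat_iso_arrow: "iso_arrow (endo_cat B a) = iso_arrow (hom_cat B a a)"
  by (simp add: fun_eq_iff iso_arrow_def inverse_arrows_def endo_cat_def hom_cat_def)

lemma (in bicategory) monoidal_category_endo_cat:
  assumes a: "a \<in> zero_cells B"
  shows "monoidal_category (endo_cat B a)"
proof -
  interpret H: category "hom_cat B a a"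
    using hom_category[OF a a] .
  show ?thesis
    apply unfold_locales
    subgoal using H.Id_Hom by (simp add: endo_cat_def hom_cat_def)
    subgoal using H.Comp_Hom by (simp add: endo_cat_def hom_cat_def)
    subgoal using H.Comp_Id by (simp add: endo_cat_def hom_cat_def)
    subgoal using H.Id_Comp by (simp add: endo_cat_def hom_cat_def)
    subgoal using H.Comp_assoc by (simp add: endo_cat_def hom_cat_def)
    subgoal using hcomp1_cell[OF a a a] by (simp add: endo_cat_def)
    subgoal using id1_cell[OF a] by (simp add: endo_cat_def)
    subgoal using hcomp2_cell[OF a a a] by (simp add: endo_cat_def)
    subgoal using hcomp2_id[OF a a a] by (simp add: endo_cat_def)
    subgoal using interchange[OF a a a] by (simp add: endo_cat_def)
    subgoal using assoc_iso[OF a a a a] unfolding endo_cat_iso_arrow by (simp add: endo_cat_def)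
    subgoal using assoc_natural[OF a a a a] by (simp add: endo_cat_def)
    subgoal using lunit_iso[OF a a] unfolding endo_cat_iso_arrow by (simp add: endo_cat_def)
    subgoal using lunit_natural[OF a a] by (simp add: endo_cat_def)
    subgoal using runit_iso[OF a a] unfolding endo_cat_iso_arrow by (simp add: endo_cat_def)
    subgoal using runit_natural[OF a a] by (simp add: endo_cat_def)
    subgoal using pentagon[OF a a a a a] by (simp add: endo_cat_def)
    subgoal using triangle[OF a a a] by (simp add: endo_cat_def)
    done
qed

context
  fixes B :: "('o, 'm, 'c, 'z) bicat_data_scheme" (structure)
begin

definition inv2 :: "'m \<Rightarrow> 'm \<Rightarrow> 'c \<Rightarrow> 'c" where
  "inv2 f g \<alpha> = (THE \<beta>. \<beta> \<in> two_cells B g f \<and> \<beta> \<bullet> \<alpha> = \<iota> f \<and> \<alpha> \<bullet> \<beta> = \<iota> g)"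

definition assoc_inv :: "'m \<Rightarrow> 'm \<Rightarrow> 'm \<Rightarrow> 'c" where
  "assoc_inv h g f = inv2 ((h \<otimes>\<^sub>1 g) \<otimes>\<^sub>1 f) (h \<otimes>\<^sub>1 (g \<otimes>\<^sub>1 f)) (assoc B h g f)"

definition adjunction :: "'o \<Rightarrow> 'o \<Rightarrow> 'm \<Rightarrow> 'm \<Rightarrow> 'c \<Rightarrow> 'c \<Rightarrow> bool" where
  "adjunction a b f fs \<eta> \<epsilon> \<longleftrightarrow>
     a \<in> zero_cells B \<and> b \<in> zero_cells B \<and> f \<in> one_cells B a b \<and> fs \<in> one_cells B b a \<and>
     \<eta> \<in> two_cells B (id1 B a) (fs \<otimes>\<^sub>1 f) \<and> \<epsilon> \<in> two_cells B (f \<otimes>\<^sub>1 fs) (id1 B b) \<and>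
     lunit B f \<bullet> (\<epsilon> \<otimes>\<^sub>2 \<iota> f) \<bullet> assoc_inv f fs f \<bullet> (\<iota> f \<otimes>\<^sub>2 \<eta>) \<bullet> inv2 (f \<otimes>\<^sub>1 id1 B a) f (runit B f)
       = \<iota> f \<and>
     runit B fs \<bullet> (\<iota> fs \<otimes>\<^sub>2 \<epsilon>) \<bullet> assoc B fs f fs \<bullet> (\<eta> \<otimes>\<^sub>2 \<iota> fs) \<bullet> inv2 (id1 B a \<otimes>\<^sub>1 fs) fs (lunit B fs)
       = \<iota> fs"

definition separable_cell :: "'o \<Rightarrow> 'm \<Rightarrow> 'm \<Rightarrow> 'c \<Rightarrow> bool" where
  "separable_cell a f fs \<eta> \<longleftrightarrow> split_mono_arrow (hom_cat B a a) (id1 B a) (fs \<otimes>\<^sub>1 f) \<eta>"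

text \<open>
  The multiplication of \<open>S\<^sub>f\<close> is \<open>fs \<otimes> \<epsilon> \<otimes> f\<close>, preceded and followed by the constraints
  \<open>(fs \<otimes> f) \<otimes> (fs \<otimes> f) \<rightarrow> fs \<otimes> ((f \<otimes> fs) \<otimes> f)\<close> and \<open>fs \<otimes> (1 \<otimes> f) \<rightarrow> fs \<otimes> f\<close>. The constraint
  2-cells are inserted in the same way in the definitions that follow.
\<close>

definition adj_monoid :: "'m \<Rightarrow> 'm \<Rightarrow> 'c \<Rightarrow> 'c \<Rightarrow> ('m, 'c) monoid_data" where
  "adj_monoid f fs \<eta> \<epsilon> = \<lparr>mon_obj = fs \<otimes>\<^sub>1 f, mon_unit = \<eta>,
     mon_mult = (\<iota> fs \<otimes>\<^sub>2 lunit B f) \<bullet> (\<iota> fs \<otimes>\<^sub>2 (\<epsilon> \<otimes>\<^sub>2 \<iota> f)) \<bullet>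
       (\<iota> fs \<otimes>\<^sub>2 assoc_inv f fs f) \<bullet> assoc B fs f (fs \<otimes>\<^sub>1 f)\<rparr>"

definition adj_comonoid :: "'o \<Rightarrow> 'm \<Rightarrow> 'm \<Rightarrow> 'c \<Rightarrow> 'c \<Rightarrow> ('m, 'c) comonoid_data" where
  "adj_comonoid a f fs \<eta> \<epsilon> = \<lparr>comon_obj = f \<otimes>\<^sub>1 fs,
     comon_comult = assoc B (f \<otimes>\<^sub>1 fs) f fs \<bullet> (assoc_inv f fs f \<otimes>\<^sub>2 \<iota> fs) \<bullet>
       ((\<iota> f \<otimes>\<^sub>2 \<eta>) \<otimes>\<^sub>2 \<iota> fs) \<bullet> (inv2 (f \<otimes>\<^sub>1 id1 B a) f (runit B f) \<otimes>\<^sub>2 \<iota> fs),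
     comon_counit = \<epsilon>\<rparr>"

definition xi_l :: "'m \<Rightarrow> 'm \<Rightarrow> 'c \<Rightarrow> 'c \<Rightarrow> 'c" where
  "xi_l f fs \<epsilon> i = lunit B f \<bullet> (\<epsilon> \<otimes>\<^sub>2 \<iota> f) \<bullet> assoc_inv f fs f \<bullet> (\<iota> f \<otimes>\<^sub>2 i)"

definition xi_r :: "'m \<Rightarrow> 'm \<Rightarrow> 'c \<Rightarrow> 'c \<Rightarrow> 'c" where
  "xi_r f fs \<epsilon> i = runit B fs \<bullet> (\<iota> fs \<otimes>\<^sub>2 \<epsilon>) \<bullet> assoc B fs f fs \<bullet> (i \<otimes>\<^sub>2 \<iota> fs)"

definition Gamma_l_rep :: "'m \<Rightarrow> 'm \<Rightarrow> 'c \<Rightarrow> 'm \<times> 'c \<Rightarrow> 'c" where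
  "Gamma_l_rep f fs \<epsilon> = (\<lambda>(h, i).
     runit B (f \<otimes>\<^sub>1 fs) \<bullet> (\<iota> (f \<otimes>\<^sub>1 fs) \<otimes>\<^sub>2 \<epsilon>) \<bullet>
     assoc B (f \<otimes>\<^sub>1 fs) f fs \<bullet> (assoc_inv f fs f \<otimes>\<^sub>2 \<iota> fs) \<bullet>
     ((\<iota> f \<otimes>\<^sub>2 i) \<otimes>\<^sub>2 \<iota> fs) \<bullet> (inv2 (f \<otimes>\<^sub>1 h) f (xi_l f fs \<epsilon> i) \<otimes>\<^sub>2 \<iota> fs))"

definition Gamma_r_rep :: "'m \<Rightarrow> 'm \<Rightarrow> 'c \<Rightarrow> 'm \<times> 'c \<Rightarrow> 'c" where
  "Gamma_r_rep f fs \<epsilon> = (\<lambda>(h, i).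
     lunit B (f \<otimes>\<^sub>1 fs) \<bullet> (\<epsilon> \<otimes>\<^sub>2 \<iota> (f \<otimes>\<^sub>1 fs)) \<bullet>
     assoc_inv f fs (f \<otimes>\<^sub>1 fs) \<bullet> (\<iota> f \<otimes>\<^sub>2 assoc B fs f fs) \<bullet>
     (\<iota> f \<otimes>\<^sub>2 (i \<otimes>\<^sub>2 \<iota> fs)) \<bullet> (\<iota> f \<otimes>\<^sub>2 inv2 (h \<otimes>\<^sub>1 fs) fs (xi_r f fs \<epsilon> i)))"

text \<open>The common value of the formula on the representatives of a class of subobjects.\<close>

definition Gamma_l :: "'m \<Rightarrow> 'm \<Rightarrow> 'c \<Rightarrow> ('m \<times> 'c) set \<Rightarrow> 'c" where
  "Gamma_l f fs \<epsilon> X = the_elem (Gamma_l_rep f fs \<epsilon> ` X)"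

definition Gamma_r :: "'m \<Rightarrow> 'm \<Rightarrow> 'c \<Rightarrow> ('m \<times> 'c) set \<Rightarrow> 'c" where
  "Gamma_r f fs \<epsilon> X = the_elem (Gamma_r_rep f fs \<epsilon> ` X)"

end

end

theory Submission
  imports Defs
begin

text \<open>
Write \<open>S = f\<^sup>* \<otimes> f\<close> and \<open>C = f \<otimes> f\<^sup>*\<close>. Composition with \<open>f\<close> and \<open>f\<^sup>*\<close> on the left gives adjoint functors
\<open>L = f \<otimes> -\<close> and \<open>R = f\<^sup>* \<otimes> -\<close>, and up to associators the comonad \<open>L R\<close> is \<open>C \<otimes> -\<close>. The theorem compares
two descriptions of the coalgebra structures on \<open>f\<close> for this comonad.

On one side, an arrow \<open>i : h \<rightarrow> S\<close> is determined by its transpose \<open>\<xi>\<^sub>i : f \<otimes> h \<rightarrow> f\<close>, and the map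
\<open>m \<cdot> (S \<otimes> i)\<close> is \<open>R \<xi>\<^sub>i\<close> up to an associator. Its invertibility is equivalent to that of \<open>\<xi>\<^sub>i\<close>
(\<open>mult_cell_iso_iff\<close>). Thus an element of \<open>I\<^sup>l\<close> amounts to a 1-cell \<open>h\<close> with an isomorphism \<open>f \<otimes> h \<cong> f\<close>,
and the canonical coaction on \<open>L h\<close> is carried along it to the coaction \<open>\<theta>\<^sub>i = (f \<otimes> i) \<cdot> \<xi>\<^sub>i\<inverse>\<close> on \<open>f\<close>
(\<open>coalgebra_theta\<close>). On the other side, the adjunction between \<open>- \<otimes> f\<^sup>*\<close> and \<open>- \<otimes> f\<close> turns 2-cells
\<open>g : C \<rightarrow> C\<close> into 2-cells \<open>f \<rightarrow> C \<otimes> f\<close>, and \<open>g\<close> is an endomorphism of the comonoid exactly when the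
corresponding 2-cell is a coaction (\<open>comonoid_endo_iff\<close>). The formula for \<open>\<Gamma>\<^sub>f\<close> describes the endomorphism that
corresponds to \<open>\<theta>\<^sub>i\<close>.

A retraction of \<open>\<eta>\<close> yields a natural retraction of the unit \<open>1 \<rightarrow> R L\<close>. With it, \<open>\<theta>\<^sub>i\<close> determines \<open>(h, i)\<close>
up to isomorphism over \<open>S\<close> (\<open>theta_eq_iso\<close>), and the equaliser that recovers \<open>h\<close> from a coaction becomes
the splitting of an idempotent of \<open>S\<close> (\<open>split_idem\<close>). So \<open>\<Gamma>\<^sub>f\<close> is bijective on isomorphism classes. It takes
products to composites because the coaction of a product is the coaction of the second factor twisted by
the endomorphism that belongs to the first (\<open>theta_product\<close>). As the classes of subobjects are the fibres of
\<open>\<Gamma>\<^sub>f\<close> on representatives, the monoid laws for \<open>I\<^sup>l\<close> come from those of the endomorphism monoid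
(\<open>monoid_isomorphism_fibres\<close>).

The assertion about \<open>\<Gamma>\<close> at \<open>f\<^sup>*\<close> is the one about \<open>\<Gamma>\<close> at \<open>f\<close> in the bicategory with reversed 1-cells. There
\<open>f\<^sup>*\<close> is the left adjoint, the monoid and the comonoid have the same underlying data by coherence
(\<open>adj_monoid_op\<close>, \<open>adj_comonoid_op\<close>), and products of subobjects are taken in the opposite order, which
accounts for the opposite monoid.
\<close>

section \<open>Cells with boundaries\<close>

text \<open>The sets of 1-cells and of 2-cells with different boundaries may overlap, so a bare element does not
determine its boundary. The calculations below use cells that carry their boundaries, for which
composability is an equation between terms that the simplifier decides. The value \<open>Null\<close> stands for
every ill-formed composite; thanks to it the associative law \<open>vc_assoc\<close> holds without side conditions and
pasting diagrams can be rebracketed freely.\<close>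

datatype ('o, 'm) cell1 = One (src: 'o) (trg: 'o) (val1: 'm)

datatype ('o, 'm, 'c) cell2 =
  Null | Two (dom: "('o, 'm) cell1") (cod: "('o, 'm) cell1") (val2: 'c)

context bicategory
begin

text \<open>The operations on cells with boundaries: \<open>\<bowtie>\<close> composes 1-cells, \<open>\<odot>\<close> and \<open>\<star>\<close> are the vertical and the
horizontal composition of 2-cells, \<open>asc\<close>, \<open>lu\<close> and \<open>ru\<close> are the constraints, and \<open>asci\<close>, \<open>lui\<close> and \<open>rui\<close>
are their inverses. Since \<open>\<star>\<close> binds more tightly than \<open>\<odot>\<close>, composites of whiskered cells need no
parentheses.\<close>

definition ok1 :: "('o, 'm) cell1 \<Rightarrow> bool" where
  "ok1 F \<longleftrightarrow> src F \<in> zero_cells B \<and> trg F \<in> zero_cells B \<and> val1 F \<in> one_cells B (src F) (trg F)"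

definition ok2 :: "('o, 'm, 'c) cell2 \<Rightarrow> bool" where
  "ok2 A \<longleftrightarrow> A \<noteq> Null \<and> ok1 (dom A) \<and> ok1 (cod A) \<and> src (cod A) = src (dom A) \<and>
     trg (cod A) = trg (dom A) \<and> val2 A \<in> two_cells B (val1 (dom A)) (val1 (cod A))"

definition hc1 (infixr "\<bowtie>" 75) where
  "F \<bowtie> G = One (src G) (trg F) (val1 F \<otimes>\<^sub>1 val1 G)"

definition unit1 :: "'o \<Rightarrow> ('o, 'm) cell1" where
  "unit1 x = One x x (id1 B x)"

definition vc (infixr "\<odot>" 60) where
  "A \<odot> A' = (if ok2 A \<and> ok2 A' \<and> dom A = cod A'
     then Two (dom A') (cod A) (val2 A \<bullet> val2 A') else Null)"

definition hc2 (infixr "\<star>" 70) where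
  "A \<star> A' = (if ok2 A \<and> ok2 A' \<and> src (dom A) = trg (dom A')
     then Two (dom A \<bowtie> dom A') (cod A \<bowtie> cod A') (val2 A \<otimes>\<^sub>2 val2 A') else Null)"

definition idt :: "('o, 'm) cell1 \<Rightarrow> ('o, 'm, 'c) cell2" where
  "idt F = (if ok1 F then Two F F (id2 B (val1 F)) else Null)"

definition asc :: "('o, 'm) cell1 \<Rightarrow> ('o, 'm) cell1 \<Rightarrow> ('o, 'm) cell1 \<Rightarrow> ('o, 'm, 'c) cell2" where
  "asc H G F = (if ok1 F \<and> ok1 G \<and> ok1 H \<and> src H = trg G \<and> src G = trg F
     then Two ((H \<bowtie> G) \<bowtie> F) (H \<bowtie> G \<bowtie> F) (assoc B (val1 H) (val1 G) (val1 F)) else Null)"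

definition asci :: "('o, 'm) cell1 \<Rightarrow> ('o, 'm) cell1 \<Rightarrow> ('o, 'm) cell1 \<Rightarrow> ('o, 'm, 'c) cell2" where
  "asci H G F = (if ok1 F \<and> ok1 G \<and> ok1 H \<and> src H = trg G \<and> src G = trg F
     then Two (H \<bowtie> G \<bowtie> F) ((H \<bowtie> G) \<bowtie> F) (assoc_inv B (val1 H) (val1 G) (val1 F)) else Null)"

definition lu :: "('o, 'm) cell1 \<Rightarrow> ('o, 'm, 'c) cell2" where
  "lu F = (if ok1 F then Two (unit1 (trg F) \<bowtie> F) F (lunit B (val1 F)) else Null)"

definition lui :: "('o, 'm) cell1 \<Rightarrow> ('o, 'm, 'c) cell2" where
  "lui F = (if ok1 F then Two F (unit1 (trg F) \<bowtie> F)
     (inv2 B (id1 B (trg F) \<otimes>\<^sub>1 val1 F) (val1 F) (lunit B (val1 F))) else Null)"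

definition ru :: "('o, 'm) cell1 \<Rightarrow> ('o, 'm, 'c) cell2" where
  "ru F = (if ok1 F then Two (F \<bowtie> unit1 (src F)) F (runit B (val1 F)) else Null)"

definition rui :: "('o, 'm) cell1 \<Rightarrow> ('o, 'm, 'c) cell2" where
  "rui F = (if ok1 F then Two F (F \<bowtie> unit1 (src F))
     (inv2 B (val1 F \<otimes>\<^sub>1 id1 B (src F)) (val1 F) (runit B (val1 F))) else Null)"

lemma ok1_One [simp]:
  "ok1 (One x y m) \<longleftrightarrow> x \<in> zero_cells B \<and> y \<in> zero_cells B \<and> m \<in> one_cells B x y"
  by (simp add: ok1_def)

lemma ok2_Two:
  "ok2 (Two F G \<alpha>) \<longleftrightarrow> ok1 F \<and> ok1 G \<and> src G = src F \<and> trg G = trg F \<and>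
     \<alpha> \<in> two_cells B (val1 F) (val1 G)"
  by (simp add: ok2_def)

lemma ok1_dom [simp]: "ok2 A \<Longrightarrow> ok1 (dom A)"
  and ok1_cod [simp]: "ok2 A \<Longrightarrow> ok1 (cod A)"
  and src_cod [simp]: "ok2 A \<Longrightarrow> src (cod A) = src (dom A)"
  and trg_cod [simp]: "ok2 A \<Longrightarrow> trg (cod A) = trg (dom A)"
  and not_ok2_Null [simp]: "\<not> ok2 Null"
  by (auto simp: ok2_def)

lemma hc1_simps [simp]: "src (F \<bowtie> G) = src G" "trg (F \<bowtie> G) = trg F"
  by (auto simp: hc1_def)

lemma unit1_simps [simp]: "src (unit1 x) = x" "trg (unit1 x) = x" "ok1 (unit1 x) \<longleftrightarrow> x \<in> zero_cells B"
  by (auto simp: unit1_def id1_cell)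

lemma ok1_src_trg [simp]: "ok1 F \<Longrightarrow> src F \<in> zero_cells B" "ok1 F \<Longrightarrow> trg F \<in> zero_cells B"
  by (simp_all only: ok1_def)

lemma val1_in [simp]: "\<lbrakk>ok1 F; x = src F; y = trg F\<rbrakk> \<Longrightarrow> val1 F \<in> one_cells B x y"
  by (simp only: ok1_def)

lemma val2_in [simp]:
  "\<lbrakk>ok2 A; f = val1 (dom A); g = val1 (cod A)\<rbrakk> \<Longrightarrow> val2 A \<in> two_cells B f g"
  by (simp only: ok2_def)

lemma ok1_hc1 [simp]: "\<lbrakk>ok1 F; ok1 G; src F = trg G\<rbrakk> \<Longrightarrow> ok1 (F \<bowtie> G)"
  using hcomp1_cell[of "src G" "trg G" "trg F" "val1 G" "val1 F"]
  by (auto simp: hc1_def)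

lemma hom_cat_simps [simp]:
  "Ob (hom_cat B x y) = one_cells B x y" "Hom (hom_cat B x y) = two_cells B"
  "Id (hom_cat B x y) = id2 B" "Comp (hom_cat B x y) = vcomp B"
  by (simp_all add: hom_cat_def)

lemma vcomp_closed:
  assumes "x \<in> zero_cells B" "y \<in> zero_cells B" "f \<in> one_cells B x y" "g \<in> one_cells B x y"
    "h \<in> one_cells B x y" "\<alpha> \<in> two_cells B f g" "\<beta> \<in> two_cells B g h"
  shows "\<beta> \<bullet> \<alpha> \<in> two_cells B f h"
  using category.Comp_Hom[OF hom_category[OF assms(1,2)], of f g h \<alpha> \<beta>] assms by simp

lemma ok2_vc [simp]: "ok2 (A \<odot> A') \<longleftrightarrow> ok2 A \<and> ok2 A' \<and> dom A = cod A'"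
proof
  assume "ok2 (A \<odot> A')"
  then show "ok2 A \<and> ok2 A' \<and> dom A = cod A'"
    unfolding vc_def by (simp only: not_ok2_Null split: if_split_asm)
next
  assume A: "ok2 A \<and> ok2 A' \<and> dom A = cod A'"
  then have "val2 A \<bullet> val2 A' \<in> two_cells B (val1 (dom A')) (val1 (cod A))"
    using vcomp_closed[of "src (dom A')" "trg (dom A')" "val1 (dom A')" "val1 (cod A')" "val1 (cod A)"]
    by simp
  with A show "ok2 (A \<odot> A')"
    by (auto simp: vc_def ok2_Two)
qed

lemma dom_cod_vc [simp]:
  assumes "ok2 A" "ok2 A'" "dom A = cod A'"
  shows "dom (A \<odot> A') = dom A'" "cod (A \<odot> A') = cod A"
  using assms by (auto simp: vc_def)

lemma val2_vc:
  assumes "ok2 A" "ok2 A'" "dom A = cod A'"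
  shows "val2 (A \<odot> A') = val2 A \<bullet> val2 A'"
  using assms by (auto simp: vc_def)

lemma cell2_eqI: "\<lbrakk>ok2 A; ok2 A'; dom A = dom A'; cod A = cod A'; val2 A = val2 A'\<rbrakk> \<Longrightarrow> A = A'"
  by (cases A; cases A') auto

lemma vc_Null: "\<not> ok2 (A \<odot> A') \<Longrightarrow> A \<odot> A' = Null"
  unfolding ok2_vc by (auto simp: vc_def)

lemma vc_assoc: "(A \<odot> A') \<odot> A'' = A \<odot> A' \<odot> A''"
proof (cases "ok2 A \<and> ok2 A' \<and> ok2 A'' \<and> dom A = cod A' \<and> dom A' = cod A''")
  case True
  then have z: "src (dom A'') \<in> zero_cells B" "trg (dom A'') \<in> zero_cells B"
    by simp_all
  show ?thesis
    apply (rule cell2_eqI)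
    using True category.Comp_assoc[OF hom_category[OF z], of "val1 (dom A'')" "val1 (dom A')"
        "val1 (dom A)" "val1 (cod A)" "val2 A''" "val2 A'" "val2 A"]
    by (auto simp: val2_vc)
next
  case False
  then have "\<not> ok2 ((A \<odot> A') \<odot> A'')" "\<not> ok2 (A \<odot> A' \<odot> A'')"
    by auto
  then show ?thesis by (metis vc_Null)
qed

text \<open>Composites are kept nested to the right, where the left-hand side of an equation between two-fold
composites usually has a further factor behind it. This rule provides the variant of the equation
that applies in that position.\<close>

lemma vc_eq_extend: "A \<odot> A' = C \<Longrightarrow> A \<odot> A' \<odot> D = C \<odot> D"
  by (simp flip: vc_assoc)

lemma idt_simps [simp]: "ok2 (idt F) \<longleftrightarrow> ok1 F"
  and dom_idt [simp]: "ok1 F \<Longrightarrow> dom (idt F) = F"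
  and cod_idt [simp]: "ok1 F \<Longrightarrow> cod (idt F) = F"
  using category.Id_Hom[OF hom_category[of "src F" "trg F"], of "val1 F"]
  by (auto simp: idt_def ok2_Two)

lemma val2_idt: "ok1 F \<Longrightarrow> val2 (idt F) = id2 B (val1 F)"
  by (simp add: idt_def)

lemma vc_idt [simp]:
  assumes "ok2 A" "dom A = F" shows "A \<odot> idt F = A"
  apply (rule cell2_eqI)
  using assms category.Comp_Id[OF hom_category[of "src F" "trg F"], of "val1 F" "val1 (cod A)" "val2 A"]
  by (auto simp: val2_vc val2_idt)

lemma idt_vc [simp]:
  assumes "ok2 A" "cod A = F" shows "idt F \<odot> A = A"
  apply (rule cell2_eqI)
  using assms category.Id_Comp[OF hom_category[of "src F" "trg F"], of "val1 (dom A)" "val1 F" "val2 A"]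
  by (auto simp: val2_vc val2_idt)

lemma ok2_hc2 [simp]: "ok2 (A \<star> A') \<longleftrightarrow> ok2 A \<and> ok2 A' \<and> src (dom A) = trg (dom A')"
proof
  assume "ok2 (A \<star> A')"
  then show "ok2 A \<and> ok2 A' \<and> src (dom A) = trg (dom A')"
    unfolding hc2_def by (simp only: not_ok2_Null split: if_split_asm)
next
  assume A: "ok2 A \<and> ok2 A' \<and> src (dom A) = trg (dom A')"
  then have "val2 A \<otimes>\<^sub>2 val2 A' \<in> two_cells B (val1 (dom A \<bowtie> dom A')) (val1 (cod A \<bowtie> cod A'))"
    using hcomp2_cell[of "src (dom A')" "trg (dom A')" "trg (dom A)" "val1 (dom A')" "val1 (cod A')"
        "val1 (dom A)" "val1 (cod A)" "val2 A'" "val2 A"]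
    by (simp add: hc1_def)
  with A show "ok2 (A \<star> A')"
    by (auto simp: hc2_def ok2_Two)
qed

lemma dom_cod_hc2 [simp]:
  assumes "ok2 A" "ok2 A'" "src (dom A) = trg (dom A')"
  shows "dom (A \<star> A') = dom A \<bowtie> dom A'" "cod (A \<star> A') = cod A \<bowtie> cod A'"
  using assms by (auto simp: hc2_def)

lemma val2_hc2:
  assumes "ok2 A" "ok2 A'" "src (dom A) = trg (dom A')"
  shows "val2 (A \<star> A') = val2 A \<otimes>\<^sub>2 val2 A'"
  using assms by (auto simp: hc2_def)

lemma hc2_idt [simp]:
  assumes "ok1 F" "ok1 G" "src F = trg G"
  shows "idt F \<star> idt G = idt (F \<bowtie> G)"
  apply (rule cell2_eqI)
  using assms hcomp2_id[of "src G" "trg G" "trg F" "val1 G" "val1 F"]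
  by (auto simp: val2_hc2 val2_idt) (auto simp: hc1_def)

lemma hc2_vc:
  assumes "ok2 A" "ok2 A'" "dom A = cod A'" "ok2 C" "ok2 C'" "dom C = cod C'" "src (dom A) = trg (dom C)"
  shows "(A \<odot> A') \<star> (C \<odot> C') = (A \<star> C) \<odot> (A' \<star> C')"
proof (rule cell2_eqI)
  have "src (cod A') = trg (cod C')"
    using assms by metis
  then have *: "src (dom A') = trg (dom C')"
    using assms(2,5) by simp
  then show "ok2 ((A \<odot> A') \<star> (C \<odot> C'))" "ok2 ((A \<star> C) \<odot> (A' \<star> C'))"
    "dom ((A \<odot> A') \<star> (C \<odot> C')) = dom ((A \<star> C) \<odot> (A' \<star> C'))"
    "cod ((A \<odot> A') \<star> (C \<odot> C')) = cod ((A \<star> C) \<odot> (A' \<star> C'))"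
    using assms by simp_all
  show "val2 ((A \<odot> A') \<star> (C \<odot> C')) = val2 ((A \<star> C) \<odot> (A' \<star> C'))"
    using * assms interchange[of "src (dom C')" "trg (dom C')" "trg (dom A')"
        "val1 (dom C')" "val1 (dom C)" "val1 (cod C)" "val1 (dom A')" "val1 (dom A)" "val1 (cod A)"
        "val2 C'" "val2 C" "val2 A'" "val2 A"]
    by (simp add: val2_vc val2_hc2)
qed

lemma whisker_left: "\<lbrakk>ok1 F; ok2 C; ok2 C'; dom C = cod C'; src F = trg (dom C')\<rbrakk>
    \<Longrightarrow> idt F \<star> (C \<odot> C') = (idt F \<star> C) \<odot> (idt F \<star> C')"
  using hc2_vc[of "idt F" "idt F" C C'] by simp

lemma whisker_right: "\<lbrakk>ok1 F; ok2 C; ok2 C'; dom C = cod C'; src (dom C') = trg F\<rbrakk>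
    \<Longrightarrow> (C \<odot> C') \<star> idt F = (C \<star> idt F) \<odot> (C' \<star> idt F)"
  using hc2_vc[of C C' "idt F" "idt F"] by simp

lemma whisker_hc2: "\<lbrakk>ok2 A; ok2 C; src (dom A) = trg (dom C); F = cod A; G = dom C\<rbrakk>
    \<Longrightarrow> (idt F \<star> C) \<odot> (A \<star> idt G) = A \<star> C"
  by (simp add: hc2_vc[symmetric])

lemma hc2_whisker: "\<lbrakk>ok2 A; ok2 C; src (dom A) = trg (dom C); F = dom A; G = cod C\<rbrakk>
    \<Longrightarrow> (A \<star> idt G) \<odot> (idt F \<star> C) = A \<star> C"
  by (simp add: hc2_vc[symmetric])

lemma inv2_eq:
  assumes "x \<in> zero_cells B" "y \<in> zero_cells B" "f \<in> one_cells B x y" "g \<in> one_cells B x y"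
    and "inverse_arrows (hom_cat B x y) f g \<alpha> \<beta>"
  shows "inv2 B f g \<alpha> = \<beta>"
  unfolding inv2_def
proof (rule the_equality)
  show "\<beta> \<in> two_cells B g f \<and> \<beta> \<bullet> \<alpha> = \<iota> f \<and> \<alpha> \<bullet> \<beta> = \<iota> g"
    using assms(5) by (simp add: inverse_arrows_def)
  fix \<gamma> assume c: "\<gamma> \<in> two_cells B g f \<and> \<gamma> \<bullet> \<alpha> = \<iota> f \<and> \<alpha> \<bullet> \<gamma> = \<iota> g"
  interpret H: category "hom_cat B x y" using hom_category assms by blast
  have "(\<gamma> \<bullet> \<alpha>) \<bullet> \<beta> = \<gamma> \<bullet> (\<alpha> \<bullet> \<beta>)"
    using H.Comp_assoc[of g f g f \<beta> \<alpha> \<gamma>] assms c by (simp add: inverse_arrows_def)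
  then show "\<gamma> = \<beta>"
    using H.Comp_Id[of g f \<gamma>] H.Id_Comp[of g f \<beta>] assms c by (simp add: inverse_arrows_def)
qed

lemma inv2_inverse:
  assumes "x \<in> zero_cells B" "y \<in> zero_cells B" "f \<in> one_cells B x y" "g \<in> one_cells B x y"
    and "iso_arrow (hom_cat B x y) f g \<alpha>"
  shows "inverse_arrows (hom_cat B x y) f g \<alpha> (inv2 B f g \<alpha>)"
  using assms inv2_eq by (metis iso_arrow_def)

definition inv_pair :: "('o, 'm, 'c) cell2 \<Rightarrow> ('o, 'm, 'c) cell2 \<Rightarrow> bool" where
  "inv_pair A A' \<longleftrightarrow> ok2 A \<and> ok2 A' \<and> dom A' = cod A \<and> cod A' = dom A \<and>
     A' \<odot> A = idt (dom A) \<and> A \<odot> A' = idt (cod A)"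

lemma inv_pair_Two:
  assumes "x \<in> zero_cells B" "y \<in> zero_cells B" "f \<in> one_cells B x y" "g \<in> one_cells B x y"
  shows "inv_pair (Two (One x y f) (One x y g) \<alpha>) (Two (One x y g) (One x y f) \<beta>) \<longleftrightarrow>
     inverse_arrows (hom_cat B x y) f g \<alpha> \<beta>"
  using assms
  by (auto simp: inv_pair_def inverse_arrows_def ok2_Two vc_def idt_def)

lemma inv_pair_inv2:
  assumes "x \<in> zero_cells B" "y \<in> zero_cells B" "f \<in> one_cells B x y" "g \<in> one_cells B x y"
    and "iso_arrow (hom_cat B x y) f g \<alpha>"
  shows "inv_pair (Two (One x y f) (One x y g) \<alpha>) (Two (One x y g) (One x y f) (inv2 B f g \<alpha>))"
  using inv2_inverse inv_pair_Two assms by blast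

lemma inv_pair_asc:
  assumes "ok1 F" "ok1 G" "ok1 H" "src H = trg G" "src G = trg F"
  shows "inv_pair (asc H G F) (asci H G F)"
  using inv_pair_inv2[OF _ _ _ _ assoc_iso[of "src F" "trg F" "trg G" "trg H" "val1 F" "val1 G" "val1 H"]]
    assms hcomp1_cell
  by (auto simp: asc_def asci_def assoc_inv_def hc1_def)

lemma inv_pair_lu:
  assumes "ok1 F" shows "inv_pair (lu F) (lui F)"
  using inv_pair_inv2[OF _ _ _ _ lunit_iso[of "src F" "trg F" "val1 F"]] assms hcomp1_cell id1_cell
  by (cases F) (auto simp: lu_def lui_def hc1_def unit1_def)

lemma inv_pair_ru:
  assumes "ok1 F" shows "inv_pair (ru F) (rui F)"
  using inv_pair_inv2[OF _ _ _ _ runit_iso[of "src F" "trg F" "val1 F"]] assms hcomp1_cell id1_cell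
  by (cases F) (auto simp: ru_def rui_def hc1_def unit1_def)

lemma constraint_simps [simp]:
  "\<lbrakk>ok1 F; ok1 G; ok1 H; src H = trg G; src G = trg F\<rbrakk> \<Longrightarrow> ok2 (asc H G F)"
  "\<lbrakk>ok1 F; ok1 G; ok1 H; src H = trg G; src G = trg F\<rbrakk> \<Longrightarrow> ok2 (asci H G F)"
  "\<lbrakk>ok1 F; ok1 G; ok1 H; src H = trg G; src G = trg F\<rbrakk> \<Longrightarrow> dom (asc H G F) = (H \<bowtie> G) \<bowtie> F"
  "\<lbrakk>ok1 F; ok1 G; ok1 H; src H = trg G; src G = trg F\<rbrakk> \<Longrightarrow> cod (asc H G F) = H \<bowtie> G \<bowtie> F"
  "\<lbrakk>ok1 F; ok1 G; ok1 H; src H = trg G; src G = trg F\<rbrakk> \<Longrightarrow> dom (asci H G F) = H \<bowtie> G \<bowtie> F"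
  "\<lbrakk>ok1 F; ok1 G; ok1 H; src H = trg G; src G = trg F\<rbrakk> \<Longrightarrow> cod (asci H G F) = (H \<bowtie> G) \<bowtie> F"
  "ok1 F \<Longrightarrow> ok2 (lu F)" "ok1 F \<Longrightarrow> ok2 (lui F)" "ok1 F \<Longrightarrow> ok2 (ru F)" "ok1 F \<Longrightarrow> ok2 (rui F)"
  "ok1 F \<Longrightarrow> dom (lu F) = unit1 (trg F) \<bowtie> F" "ok1 F \<Longrightarrow> cod (lu F) = F"
  "ok1 F \<Longrightarrow> cod (lui F) = unit1 (trg F) \<bowtie> F" "ok1 F \<Longrightarrow> dom (lui F) = F"
  "ok1 F \<Longrightarrow> dom (ru F) = F \<bowtie> unit1 (src F)" "ok1 F \<Longrightarrow> cod (ru F) = F"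
  "ok1 F \<Longrightarrow> cod (rui F) = F \<bowtie> unit1 (src F)" "ok1 F \<Longrightarrow> dom (rui F) = F"
  using inv_pair_asc[of F G H] inv_pair_lu[of F] inv_pair_ru[of F]
  by (auto simp: inv_pair_def) (auto simp: asc_def asci_def lu_def lui_def ru_def rui_def)

lemma val2_constraint:
  "val1 (F \<bowtie> G) = val1 F \<otimes>\<^sub>1 val1 G" "val1 (unit1 x) = id1 B x"
  "\<lbrakk>ok1 F; ok1 G; ok1 H; src H = trg G; src G = trg F\<rbrakk>
    \<Longrightarrow> val2 (asc H G F) = assoc B (val1 H) (val1 G) (val1 F)"
  "\<lbrakk>ok1 F; ok1 G; ok1 H; src H = trg G; src G = trg F\<rbrakk>
    \<Longrightarrow> val2 (asci H G F) = assoc_inv B (val1 H) (val1 G) (val1 F)"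
  "ok1 F \<Longrightarrow> val2 (lu F) = lunit B (val1 F)"
  "ok1 F \<Longrightarrow> val2 (ru F) = runit B (val1 F)"
  "ok1 F \<Longrightarrow> val2 (lui F) = inv2 B (id1 B (trg F) \<otimes>\<^sub>1 val1 F) (val1 F) (lunit B (val1 F))"
  "ok1 F \<Longrightarrow> val2 (rui F) = inv2 B (val1 F \<otimes>\<^sub>1 id1 B (src F)) (val1 F) (runit B (val1 F))"
  by (auto simp: hc1_def unit1_def asc_def asci_def lu_def lui_def ru_def rui_def)

lemmas val2_simps = val2_vc val2_hc2 val2_idt val2_constraint

lemma constraint_inverse [simp]:
  "\<lbrakk>ok1 F; ok1 G; ok1 H; src H = trg G; src G = trg F\<rbrakk> \<Longrightarrow> asci H G F \<odot> asc H G F = idt ((H \<bowtie> G) \<bowtie> F)"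
  "\<lbrakk>ok1 F; ok1 G; ok1 H; src H = trg G; src G = trg F\<rbrakk> \<Longrightarrow> asc H G F \<odot> asci H G F = idt (H \<bowtie> G \<bowtie> F)"
  "ok1 F \<Longrightarrow> lui F \<odot> lu F = idt (unit1 (trg F) \<bowtie> F)" "ok1 F \<Longrightarrow> lu F \<odot> lui F = idt F"
  "ok1 F \<Longrightarrow> rui F \<odot> ru F = idt (F \<bowtie> unit1 (src F))" "ok1 F \<Longrightarrow> ru F \<odot> rui F = idt F"
  using inv_pair_asc[of F G H] inv_pair_lu[of F] inv_pair_ru[of F]
  by (auto simp: inv_pair_def)

lemma inv_pair_sym: "inv_pair A A' \<Longrightarrow> inv_pair A' A"
  by (auto simp: inv_pair_def)

lemma inv_pair_wl:
  "\<lbrakk>inv_pair A A'; ok1 F; src F = trg (dom A)\<rbrakk> \<Longrightarrow> inv_pair (idt F \<star> A) (idt F \<star> A')"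
  unfolding inv_pair_def by (auto simp flip: whisker_left)

lemma inv_pair_wr:
  "\<lbrakk>inv_pair A A'; ok1 F; src (dom A) = trg F\<rbrakk> \<Longrightarrow> inv_pair (A \<star> idt F) (A' \<star> idt F)"
  unfolding inv_pair_def by (auto simp flip: whisker_right)

lemma inv_pair_vc:
  "\<lbrakk>inv_pair A A'; inv_pair C C'; dom A = cod C\<rbrakk> \<Longrightarrow> inv_pair (A \<odot> C) (C' \<odot> A')"
  unfolding inv_pair_def
  by (auto simp: vc_assoc vc_eq_extend)

lemma inv_pair_D:
  assumes "inv_pair A A'"
  shows "ok2 A" "ok2 A'" "dom A' = cod A" "cod A' = dom A" "A' \<odot> A = idt (dom A)" "A \<odot> A' = idt (cod A)"
  using assms by (auto simp: inv_pair_def)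

lemma inv_pair_unique:
  assumes "inv_pair A X" "inv_pair A Y" shows "X = Y"
proof -
  have "(X \<odot> A) \<odot> Y = X \<odot> A \<odot> Y"
    by (rule vc_assoc)
  then show ?thesis
    using inv_pair_D[OF assms(1)] inv_pair_D[OF assms(2)] by simp
qed

lemma move_right:
  assumes "inv_pair A A'" "X \<odot> A = Y" "ok2 X" "dom X = cod A" shows "X = Y \<odot> A'"
  using assms by (auto simp: inv_pair_def vc_assoc)

lemma move_left:
  assumes "inv_pair A A'" "A \<odot> X = Y" "ok2 X" "cod X = dom A" shows "X = A' \<odot> Y"
  using assms by (auto simp: inv_pair_def simp flip: vc_assoc)

lemma cancel_right:
  assumes "inv_pair A A'" "X \<odot> A = Y \<odot> A" "ok2 X" "dom X = cod A"  "ok2 Y" "dom Y = cod A" shows "X = Y"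
  using assms by (metis move_right)

lemma cancel_left:
  assumes "inv_pair A A'" "A \<odot> X = A \<odot> Y" "ok2 X" "cod X = dom A"  "ok2 Y" "cod Y = dom A" shows "X = Y"
  using assms by (metis move_left)

lemma inv_pair_collapse:
  assumes "inv_pair (Two H H' \<alpha>) x"
  shows "x = Two H' H (val2 x)"
  using inv_pair_D[OF assms] by (cases x) auto

lemma cell2_collapse: "ok2 A \<Longrightarrow> A = Two (dom A) (cod A) (val2 A)"
  by (cases A) auto

lemma iso_arrow_iff:
  assumes "x \<in> zero_cells B" "y \<in> zero_cells B" "f \<in> one_cells B x y" "g \<in> one_cells B x y"
  shows "iso_arrow (hom_cat B x y) f g \<alpha> \<longleftrightarrow> (\<exists>w. inv_pair (Two (One x y f) (One x y g) \<alpha>) w)"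
  using inv_pair_collapse inv_pair_Two[OF assms] unfolding iso_arrow_def by metis

lemma asc_nat:
  assumes "ok2 A" "ok2 C" "ok2 D" "src (dom A) = trg (dom C)" "src (dom C) = trg (dom D)"
    "dom A = F" "dom C = G" "dom D = H" "cod A = F'" "cod C = G'" "cod D = H'"
  shows "asc F' G' H' \<odot> ((A \<star> C) \<star> D) = (A \<star> C \<star> D) \<odot> asc F G H"
proof (rule cell2_eqI)
  have ok: "ok1 F" "ok1 G" "ok1 H" "ok1 F'" "ok1 G'" "ok1 H'"
    "src F = trg G" "src F' = src F" "trg F' = trg F" "src G' = src G" "trg G' = trg G"
    "src H' = src H" "trg H' = trg H" "src G = trg H"
    using assms by auto
  then show "ok2 (asc F' G' H' \<odot> ((A \<star> C) \<star> D))" "ok2 ((A \<star> C \<star> D) \<odot> asc F G H)"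
    "dom (asc F' G' H' \<odot> ((A \<star> C) \<star> D)) = dom ((A \<star> C \<star> D) \<odot> asc F G H)"
    "cod (asc F' G' H' \<odot> ((A \<star> C) \<star> D)) = cod ((A \<star> C \<star> D) \<odot> asc F G H)"
    using assms by (simp_all)
  show "val2 (asc F' G' H' \<odot> ((A \<star> C) \<star> D)) = val2 ((A \<star> C \<star> D) \<odot> asc F G H)"
    using assms ok assoc_natural[of "src H" "trg H" "trg G" "trg F" "val1 H" "val1 H'" "val1 G" "val1 G'"
        "val1 F" "val1 F'" "val2 D" "val2 C" "val2 A"]
    by (simp add: val2_simps)
qed

lemma lu_nat:
  assumes "ok2 A" "dom A = F" "cod A = F'" "x = trg F"
  shows "lu F' \<odot> (idt (unit1 x) \<star> A) = A \<odot> lu F"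
proof (rule cell2_eqI)
  have ok: "ok1 F" "ok1 F'" "src F' = src F" "trg F' = trg F"
    using assms by auto
  then show "ok2 (lu F' \<odot> (idt (unit1 x) \<star> A))" "ok2 (A \<odot> lu F)"
    "dom (lu F' \<odot> (idt (unit1 x) \<star> A)) = dom (A \<odot> lu F)"
    "cod (lu F' \<odot> (idt (unit1 x) \<star> A)) = cod (A \<odot> lu F)"
    using assms by (simp_all)
  show "val2 (lu F' \<odot> (idt (unit1 x) \<star> A)) = val2 (A \<odot> lu F)"
    using assms ok lunit_natural[of "src F" "trg F" "val1 F" "val1 F'" "val2 A"]
    by (simp add: val2_simps)
qed

lemma ru_nat:
  assumes "ok2 A" "dom A = F" "cod A = F'" "x = src F"
  shows "ru F' \<odot> (A \<star> idt (unit1 x)) = A \<odot> ru F"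
proof (rule cell2_eqI)
  have ok: "ok1 F" "ok1 F'" "src F' = src F" "trg F' = trg F"
    using assms by auto
  then show "ok2 (ru F' \<odot> (A \<star> idt (unit1 x)))" "ok2 (A \<odot> ru F)"
    "dom (ru F' \<odot> (A \<star> idt (unit1 x))) = dom (A \<odot> ru F)"
    "cod (ru F' \<odot> (A \<star> idt (unit1 x))) = cod (A \<odot> ru F)"
    using assms by (simp_all)
  show "val2 (ru F' \<odot> (A \<star> idt (unit1 x))) = val2 (A \<odot> ru F)"
    using assms ok runit_natural[of "src F" "trg F" "val1 F" "val1 F'" "val2 A"]
    by (simp add: val2_simps)
qed

lemma pentagon_cells:
  assumes "ok1 F" "ok1 G" "ok1 H" "ok1 K" "src K = trg H" "src H = trg G" "src G = trg F"
  shows "(idt K \<star> asc H G F) \<odot> asc K (H \<bowtie> G) F \<odot> (asc K H G \<star> idt F)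
    = asc K H (G \<bowtie> F) \<odot> asc (K \<bowtie> H) G F"
proof (rule cell2_eqI)
  show "val2 ((idt K \<star> asc H G F) \<odot> asc K (H \<bowtie> G) F \<odot> (asc K H G \<star> idt F)) =
    val2 (asc K H (G \<bowtie> F) \<odot> asc (K \<bowtie> H) G F)"
    using assms pentagon[of "src F" "trg F" "trg G" "trg H" "trg K" "val1 F" "val1 G" "val1 H" "val1 K"]
    by (simp add: val2_simps)
qed (use assms in simp_all)

lemma triangle_cells:
  assumes "ok1 F" "ok1 G" "x = trg F" "src G = x"
  shows "(idt G \<star> lu F) \<odot> asc G (unit1 x) F = ru G \<star> idt F"
proof (rule cell2_eqI)
  show "val2 ((idt G \<star> lu F) \<odot> asc G (unit1 x) F) = val2 (ru G \<star> idt F)"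
    using assms triangle[of "src F" "trg F" "trg G" "val1 F" "val1 G"]
    by (simp add: val2_simps)
qed (use assms in simp_all)

text \<open>The two ways of composing whiskered 2-cells that act on different factors; the units, the
counits and the retraction below are natural because \<open>eta\<close>, \<open>eps\<close> and \<open>ret\<close> slide past other 2-cells.\<close>

lemma slide:
  assumes "ok2 A" "ok2 C" "src F = trg H" "dom A = F" "cod A = F'" "dom C = H" "cod C = H'"
  shows "(idt F' \<star> C) \<odot> (A \<star> idt H) = (A \<star> idt H') \<odot> (idt F \<star> C)"
  using assms by (simp add: whisker_hc2 hc2_whisker)

lemma inv_pair_shift:
  assumes "inv_pair (A \<odot> P) W" "inv_pair P P'"
  shows "inv_pair A (P \<odot> W)"
proof -
  have ok: "ok2 A" "ok2 P" "dom A = cod P" "dom P' = cod P"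
    using assms by (auto simp: inv_pair_def)
  have "inv_pair ((A \<odot> P) \<odot> P') (P \<odot> W)"
    using assms inv_pair_sym by (intro inv_pair_vc) (auto simp: inv_pair_def)
  moreover have "(A \<odot> P) \<odot> P' = A"
    using assms(2) ok by (simp add: vc_assoc inv_pair_def)
  ultimately show ?thesis by simp
qed

lemma asc_whisker1:
  assumes "ok2 A" "dom A = F" "cod A = F'" "ok1 G" "ok1 H" "src F = trg G" "src G = trg H"
  shows "asc F' G H \<odot> ((A \<star> idt G) \<star> idt H) = (A \<star> idt (G \<bowtie> H)) \<odot> asc F G H"
  using asc_nat[of A "idt G" "idt H" F G H F' G H] assms by auto

lemma asc_whisker2:
  assumes "ok2 A" "dom A = G" "cod A = G'" "ok1 F" "ok1 H" "src F = trg G" "src G = trg H"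
  shows "asc F G' H \<odot> ((idt F \<star> A) \<star> idt H) = (idt F \<star> A \<star> idt H) \<odot> asc F G H"
  using asc_nat[of "idt F" A "idt H" F G H F G' H] assms by auto

lemma asc_whisker3:
  assumes "ok2 A" "dom A = H" "cod A = H'" "ok1 F" "ok1 G" "src F = trg G" "src G = trg H"
  shows "asc F G H' \<odot> (idt (F \<bowtie> G) \<star> A) = (idt F \<star> idt G \<star> A) \<odot> asc F G H"
  using asc_nat[of "idt F" "idt G" A F G H F G H'] assms by auto

text \<open>Passes from the naturality of a constraint to the naturality of its inverse.\<close>

lemma conj_swap:
  assumes "inv_pair P P'" "inv_pair Q Q'" "P \<odot> X = Y \<odot> Q" "ok2 X" "ok2 Y" "cod X = dom P" "dom Y = cod Q"
  shows "P' \<odot> Y = X \<odot> Q'"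
proof -
  have "P' \<odot> Y = P' \<odot> (Y \<odot> Q) \<odot> Q'"
    using assms by (auto simp: inv_pair_def vc_assoc)
  also have "\<dots> = (P' \<odot> P) \<odot> X \<odot> Q'"
    by (simp add: assms(3)[symmetric] vc_assoc)
  also have "\<dots> = X \<odot> Q'"
    using assms by (simp add: inv_pair_def flip: vc_assoc)
  finally show ?thesis .
qed

lemma asci_nat:
  assumes "ok2 A" "ok2 C" "ok2 D" "src (dom A) = trg (dom C)" "src (dom C) = trg (dom D)"
    "dom A = F" "dom C = G" "dom D = H" "cod A = F'" "cod C = G'" "cod D = H'"
  shows "asci F' G' H' \<odot> (A \<star> C \<star> D) = ((A \<star> C) \<star> D) \<odot> asci F G H"
proof -
  have "ok1 F" "ok1 G" "ok1 H" "ok1 F'" "ok1 G'" "ok1 H'"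
    "src F = trg G" "src F' = src F" "trg F' = trg F" "src G' = src G" "trg G' = trg G"
    "src H' = src H" "trg H' = trg H" "src G = trg H"
    using assms by auto
  then show ?thesis
    using assms by (intro conj_swap[OF inv_pair_asc inv_pair_asc asc_nat]) simp_all
qed

lemma asci_whisker1:
  assumes "ok2 A" "dom A = F" "cod A = F'" "ok1 G" "ok1 H" "src F = trg G" "src G = trg H"
  shows "asci F' G H \<odot> (A \<star> idt (G \<bowtie> H)) = ((A \<star> idt G) \<star> idt H) \<odot> asci F G H"
  by (rule conj_swap[OF inv_pair_asc inv_pair_asc asc_whisker1]) (use assms in auto)

lemma asci_whisker2:
  assumes "ok2 A" "dom A = G" "cod A = G'" "ok1 F" "ok1 H" "src F = trg G" "src G = trg H"
  shows "asci F G' H \<odot> (idt F \<star> A \<star> idt H) = ((idt F \<star> A) \<star> idt H) \<odot> asci F G H"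
  by (rule conj_swap[OF inv_pair_asc inv_pair_asc asc_whisker2]) (use assms in auto)

lemma asci_whisker3:
  assumes "ok2 A" "dom A = H" "cod A = H'" "ok1 F" "ok1 G" "src F = trg G" "src G = trg H"
  shows "asci F G H' \<odot> (idt F \<star> idt G \<star> A) = (idt (F \<bowtie> G) \<star> A) \<odot> asci F G H"
  by (rule conj_swap[OF inv_pair_asc inv_pair_asc asc_whisker3]) (use assms in auto)

lemma lui_nat:
  assumes "ok2 A" "dom A = F" "cod A = F'" "x = trg F"
  shows "lui F' \<odot> A = (idt (unit1 x) \<star> A) \<odot> lui F"
  by (rule conj_swap[OF inv_pair_lu inv_pair_lu lu_nat]) (use assms in auto)

lemma rui_nat:
  assumes "ok2 A" "dom A = F" "cod A = F'" "x = src F"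
  shows "rui F' \<odot> A = (A \<star> idt (unit1 x)) \<odot> rui F"
  by (rule conj_swap[OF inv_pair_ru inv_pair_ru ru_nat]) (use assms in auto)

section \<open>Coherence of the constraints\<close>

lemma unit1_faithful_left:
  assumes "idt (unit1 x) \<star> A = idt (unit1 x) \<star> A'" "ok2 A" "ok2 A'" "dom A = dom A'" "cod A = cod A'"
    "x = trg (dom A)"
  shows "A = A'"
proof (rule cancel_right[OF inv_pair_lu[of "dom A"]])
  show "A \<odot> lu (dom A) = A' \<odot> lu (dom A)"
    using lu_nat[of A "dom A" "cod A" x] lu_nat[of A' "dom A" "cod A" x] assms by simp
qed (use assms in auto)

lemma unit1_faithful_right:
  assumes "A \<star> idt (unit1 x) = A' \<star> idt (unit1 x)" "ok2 A" "ok2 A'" "dom A = dom A'" "cod A = cod A'"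
    "x = src (dom A)"
  shows "A = A'"
proof (rule cancel_right[OF inv_pair_ru[of "dom A"]])
  show "A \<odot> ru (dom A) = A' \<odot> ru (dom A)"
    using ru_nat[of A "dom A" "cod A" x] ru_nat[of A' "dom A" "cod A" x] assms by simp
qed (use assms in auto)

lemmas pentagon_cells_extend = pentagon_cells[THEN vc_eq_extend, unfolded vc_assoc]
lemmas triangle_cells_extend = triangle_cells[THEN vc_eq_extend]

lemma pentagon_inverse:
  assumes "ok1 F" "ok1 G" "ok1 H" "ok1 K" "src K = trg H" "src H = trg G" "src G = trg F"
  shows "(asci K H G \<star> idt F) \<odot> asci K (H \<bowtie> G) F \<odot> (idt K \<star> asci H G F)
    = asci (K \<bowtie> H) G F \<odot> asci K H (G \<bowtie> F)"
proof (rule inv_pair_unique)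
  have "inv_pair ((idt K \<star> asc H G F) \<odot> asc K (H \<bowtie> G) F \<odot> (asc K H G \<star> idt F))
      (((asci K H G \<star> idt F) \<odot> asci K (H \<bowtie> G) F) \<odot> (idt K \<star> asci H G F))"
    by (intro inv_pair_vc inv_pair_wl inv_pair_wr inv_pair_asc) (use assms in simp_all)
  then show "inv_pair (asc K H (G \<bowtie> F) \<odot> asc (K \<bowtie> H) G F)
      ((asci K H G \<star> idt F) \<odot> asci K (H \<bowtie> G) F \<odot> (idt K \<star> asci H G F))"
    using assms by (simp add: pentagon_cells vc_assoc)
  show "inv_pair (asc K H (G \<bowtie> F) \<odot> asc (K \<bowtie> H) G F) (asci (K \<bowtie> H) G F \<odot> asci K H (G \<bowtie> F))"
    by (intro inv_pair_vc inv_pair_asc) (use assms in simp_all)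
qed

text \<open>Kelly's observation that this compatibility of the left unit constraint follows from the pentagon and
the triangle. Whiskering with a unit 1-cell is faithful because the unit constraint is natural and
invertible, so the equation may be checked after whiskering on the left with the unit; there the
pentagon for two units, \<open>G\<close> and \<open>X\<close> reduces both sides to the same composite.\<close>

lemma lu_hc1:
  assumes "ok1 G" "ok1 X" "src G = trg X"
  shows "lu (G \<bowtie> X) \<odot> asc (unit1 (trg G)) G X = lu G \<star> idt X"
proof -
  let ?o = "unit1 (trg G)"
  let ?P = "idt ?o \<star> (lu (G \<bowtie> X) \<odot> asc ?o G X)" and ?Q = "idt ?o \<star> (lu G \<star> idt X)"
  let ?Z = "asc ?o (?o \<bowtie> G) X \<odot> (asc ?o ?o G \<star> idt X)"
  have Z: "inv_pair ?Z ((asci ?o ?o G \<star> idt X) \<odot> asci ?o (?o \<bowtie> G) X)"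
    by (intro inv_pair_vc inv_pair_wr inv_pair_asc) (use assms in auto)
  have "?P \<odot> ?Z = (idt ?o \<star> lu (G \<bowtie> X)) \<odot> asc ?o ?o (G \<bowtie> X) \<odot> asc (?o \<bowtie> ?o) G X"
    using assms by (simp add: whisker_left vc_assoc pentagon_cells)
  also have "\<dots> = (ru ?o \<star> idt (G \<bowtie> X)) \<odot> asc (?o \<bowtie> ?o) G X"
    using assms by (simp add: triangle_cells_extend)
  also have "\<dots> = asc ?o G X \<odot> ((ru ?o \<star> idt G) \<star> idt X)"
    using assms by (simp add: asc_whisker1[where F = "?o \<bowtie> ?o"])
  also have "\<dots> = asc ?o G X \<odot> (((idt ?o \<star> lu G) \<star> idt X) \<odot> (asc ?o ?o G \<star> idt X))"
    using assms by (simp flip: whisker_right add: triangle_cells)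
  also have "\<dots> = ?Q \<odot> ?Z"
    using assms asc_whisker2[of "lu G" "?o \<bowtie> G" G ?o X] by (simp add: vc_assoc[symmetric])
  finally have "?P = ?Q"
    by (rule cancel_right[OF Z]) (use assms in auto)
  then show ?thesis
    by (rule unit1_faithful_left) (use assms in auto)
qed

text \<open>The mirror image: here the equation is checked after whiskering on the right with the unit.\<close>

lemma ru_hc1:
  assumes "ok1 C" "ok1 Y" "src C = trg Y"
  shows "(idt C \<star> ru Y) \<odot> asc C Y (unit1 (src Y)) = ru (C \<bowtie> Y)"
proof -
  let ?o = "unit1 (src Y)"
  let ?P = "((idt C \<star> ru Y) \<odot> asc C Y ?o) \<star> idt ?o" and ?Q = "ru (C \<bowtie> Y) \<star> idt ?o"
  have "asc C Y ?o \<odot> ?P = asc C Y ?o \<odot> ((idt C \<star> ru Y) \<star> idt ?o) \<odot> (asc C Y ?o \<star> idt ?o)"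
    using assms by (simp add: whisker_right)
  also have "\<dots> = (idt C \<star> ru Y \<star> idt ?o) \<odot> asc C (Y \<bowtie> ?o) ?o \<odot> (asc C Y ?o \<star> idt ?o)"
    using assms asc_whisker2[of "ru Y" "Y \<bowtie> ?o" Y C ?o] by (simp add: vc_assoc[symmetric])
  also have "\<dots> = (idt C \<star> idt Y \<star> lu ?o) \<odot> (idt C \<star> asc Y ?o ?o) \<odot> asc C (Y \<bowtie> ?o) ?o \<odot> (asc C Y ?o \<star> idt ?o)"
    using assms triangle_cells[of ?o Y "src Y"] by (simp flip: whisker_left vc_assoc)
  also have "\<dots> = (idt C \<star> idt Y \<star> lu ?o) \<odot> asc C Y (?o \<bowtie> ?o) \<odot> asc (C \<bowtie> Y) ?o ?o"
    using assms by (simp add: pentagon_cells)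
  also have "\<dots> = asc C Y ?o \<odot> (idt (C \<bowtie> Y) \<star> lu ?o) \<odot> asc (C \<bowtie> Y) ?o ?o"
    using assms asc_whisker3[of "lu ?o" "?o \<bowtie> ?o" ?o C Y] by (simp add: vc_assoc[symmetric] del: hc2_idt)
  also have "\<dots> = asc C Y ?o \<odot> ?Q"
    using assms triangle_cells[of ?o "C \<bowtie> Y" "src Y"] by simp
  finally have "?P = ?Q"
    by (rule cancel_left[OF inv_pair_asc, rotated 5]) (use assms in auto)
  then show ?thesis
    by (rule unit1_faithful_right) (use assms in auto)
qed

lemma lui_hc1:
  assumes "ok1 G" "ok1 X" "src G = trg X" "x = trg G"
  shows "asc (unit1 x) G X \<odot> (lui G \<star> idt X) = lui (G \<bowtie> X)"
proof (rule cancel_left[OF inv_pair_lu[of "G \<bowtie> X"]])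
  show "lu (G \<bowtie> X) \<odot> asc (unit1 x) G X \<odot> (lui G \<star> idt X) = lu (G \<bowtie> X) \<odot> lui (G \<bowtie> X)"
    using assms lu_hc1[of G X, THEN vc_eq_extend] by (simp add: vc_assoc flip: whisker_right)
qed (use assms in auto)

lemma rui_hc1:
  assumes "ok1 C" "ok1 Y" "src C = trg Y" "x = src Y"
  shows "asc C Y (unit1 x) \<odot> rui (C \<bowtie> Y) = idt C \<star> rui Y"
proof (rule cancel_left[OF inv_pair_wl[OF inv_pair_ru[of Y], of C]])
  show "(idt C \<star> ru Y) \<odot> asc C Y (unit1 x) \<odot> rui (C \<bowtie> Y) = (idt C \<star> ru Y) \<odot> (idt C \<star> rui Y)"
    using assms ru_hc1[of C Y, THEN vc_eq_extend] by (simp add: vc_assoc flip: whisker_left)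
qed (use assms in auto)

lemma ru_asci:
  assumes "ok1 C" "ok1 Y" "src C = trg Y" "x = src Y"
  shows "ru (C \<bowtie> Y) \<odot> asci C Y (unit1 x) = idt C \<star> ru Y"
  unfolding assms(4)
  by (rule move_right[OF inv_pair_asc ru_hc1, symmetric]) (use assms in auto)

lemma triangle_inverse:
  assumes "ok1 F" "ok1 G" "x = trg F" "src G = x"
  shows "asc G (unit1 x) F \<odot> (rui G \<star> idt F) = idt G \<star> lui F"
proof (rule cancel_left[OF inv_pair_wl[OF inv_pair_lu[of F], of G]])
  show "(idt G \<star> lu F) \<odot> asc G (unit1 x) F \<odot> (rui G \<star> idt F) = (idt G \<star> lu F) \<odot> (idt G \<star> lui F)"
    using assms triangle_cells_extend[of F G x] by (simp add: vc_assoc flip: whisker_left whisker_right)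
qed (use assms in auto)

lemma triangle_asci:
  assumes "ok1 F" "ok1 G" "x = trg F" "src G = x"
  shows "(ru G \<star> idt F) \<odot> asci G (unit1 x) F = idt G \<star> lu F"
  by (rule move_right[OF inv_pair_asc triangle_cells, symmetric]) (use assms in auto)

text \<open>The pentagon solved for two other sides, in the shapes in which it occurs when an associator and an
inverse associator meet.\<close>

lemma pentagon_right:
  assumes "ok1 F" "ok1 G" "ok1 H" "ok1 K" "src K = trg H" "src H = trg G" "src G = trg F"
  shows "asc K H (G \<bowtie> F) \<odot> asc (K \<bowtie> H) G F \<odot> (asci K H G \<star> idt F)
    = (idt K \<star> asc H G F) \<odot> asc K (H \<bowtie> G) F"
proof (rule cancel_right[OF inv_pair_wr[OF inv_pair_asc, of G H K F]])
  show "(asc K H (G \<bowtie> F) \<odot> asc (K \<bowtie> H) G F \<odot> (asci K H G \<star> idt F)) \<odot> (asc K H G \<star> idt F) =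
      ((idt K \<star> asc H G F) \<odot> asc K (H \<bowtie> G) F) \<odot> (asc K H G \<star> idt F)"
    using assms by (simp add: vc_assoc pentagon_cells flip: whisker_right)
qed (use assms in auto)

lemma pentagon_left:
  assumes "ok1 F" "ok1 G" "ok1 H" "ok1 K" "src K = trg H" "src H = trg G" "src G = trg F"
  shows "asc K (H \<bowtie> G) F \<odot> (asc K H G \<star> idt F) \<odot> asci (K \<bowtie> H) G F
    = (idt K \<star> asci H G F) \<odot> asc K H (G \<bowtie> F)"
proof (rule cancel_left[OF inv_pair_wl[OF inv_pair_asc, of F G H K]])
  show "(idt K \<star> asc H G F) \<odot> asc K (H \<bowtie> G) F \<odot> (asc K H G \<star> idt F) \<odot> asci (K \<bowtie> H) G F =
      (idt K \<star> asc H G F) \<odot> (idt K \<star> asci H G F) \<odot> asc K H (G \<bowtie> F)"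
    using assms by (simp add: vc_assoc pentagon_cells_extend
        flip: whisker_left) (simp flip: vc_assoc whisker_left)
qed (use assms in auto)

end

section \<open>The adjunctions given by composition\<close>

locale adjoint_cells = bicategory B
  for B :: "('o, 'm, 'c, 'z) bicat_data_scheme" (structure) +
  fixes a b :: 'o and F G :: "('o, 'm) cell1" and eta eps :: "('o, 'm, 'c) cell2"
  assumes F [simp]: "ok1 F" "src F = a" "trg F = b"
    and G [simp]: "ok1 G" "src G = b" "trg G = a"
    and eta [simp]: "ok2 eta" "dom eta = unit1 a" "cod eta = G \<bowtie> F"
    and eps [simp]: "ok2 eps" "dom eps = F \<bowtie> G" "cod eps = unit1 b"
    and zigzag_F: "lu F \<odot> (eps \<star> idt F) \<odot> asci F G F \<odot> (idt F \<star> eta) \<odot> rui F = idt F"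
    and zigzag_G: "ru G \<odot> (idt G \<star> eps) \<odot> asc G F G \<odot> (eta \<star> idt G) \<odot> lui G = idt G"
begin

text \<open>Here \<open>F\<close> and \<open>G\<close> are \<open>f\<close> and its right adjoint, and \<open>C\<close> and \<open>S\<close> are the objects underlying the comonoid
\<open>\<CC>\<^sub>f\<close> and the monoid \<open>S\<^sub>f\<close>.\<close>

abbreviation "C \<equiv> F \<bowtie> G"
abbreviation "S \<equiv> G \<bowtie> F"

text \<open>Composing with \<open>F\<close> and \<open>G\<close> on the left makes \<open>F \<bowtie> _\<close> left adjoint to \<open>G \<bowtie> _\<close>, with unit \<open>unitL\<close> and counit
\<open>counitL\<close>. Composing on the right makes \<open>_ \<bowtie> G\<close> left adjoint to \<open>_ \<bowtie> F\<close>, with unit \<open>unitR\<close> and counit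
\<open>counitR\<close>.\<close>

definition unitL where "unitL X = asc G F X \<odot> (eta \<star> idt X) \<odot> lui X"
definition counitL where "counitL Q = lu Q \<odot> (eps \<star> idt Q) \<odot> asci F G Q"
definition unitR where "unitR Y = asci Y G F \<odot> (idt Y \<star> eta) \<odot> rui Y"
definition counitR where "counitR Z = ru Z \<odot> (idt Z \<star> eps) \<odot> asc Z F G"

lemma zero_ab [simp]: "a \<in> zero_cells B" "b \<in> zero_cells B"
  using ok1_src_trg[OF F(1)] by simp_all

lemma unit_simps [simp]:
  "\<lbrakk>ok1 X; trg X = a\<rbrakk> \<Longrightarrow> ok2 (unitL X)" "\<lbrakk>ok1 X; trg X = a\<rbrakk> \<Longrightarrow> dom (unitL X) = X"
  "\<lbrakk>ok1 X; trg X = a\<rbrakk> \<Longrightarrow> cod (unitL X) = G \<bowtie> F \<bowtie> X"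
  "\<lbrakk>ok1 X; trg X = b\<rbrakk> \<Longrightarrow> ok2 (counitL X)" "\<lbrakk>ok1 X; trg X = b\<rbrakk> \<Longrightarrow> dom (counitL X) = F \<bowtie> G \<bowtie> X"
  "\<lbrakk>ok1 X; trg X = b\<rbrakk> \<Longrightarrow> cod (counitL X) = X"
  "\<lbrakk>ok1 X; src X = a\<rbrakk> \<Longrightarrow> ok2 (unitR X)" "\<lbrakk>ok1 X; src X = a\<rbrakk> \<Longrightarrow> dom (unitR X) = X"
  "\<lbrakk>ok1 X; src X = a\<rbrakk> \<Longrightarrow> cod (unitR X) = (X \<bowtie> G) \<bowtie> F"
  "\<lbrakk>ok1 X; src X = b\<rbrakk> \<Longrightarrow> ok2 (counitR X)" "\<lbrakk>ok1 X; src X = b\<rbrakk> \<Longrightarrow> dom (counitR X) = (X \<bowtie> F) \<bowtie> G"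
  "\<lbrakk>ok1 X; src X = b\<rbrakk> \<Longrightarrow> cod (counitR X) = X"
  by (simp_all add: unitL_def counitL_def unitR_def counitR_def)

lemma unitL_nat:
  assumes "ok2 A" "dom A = X" "cod A = X'" "trg X = a"
  shows "unitL X' \<odot> A = (idt G \<star> idt F \<star> A) \<odot> unitL X"
proof -
  have "unitL X' \<odot> A = asc G F X' \<odot> (eta \<star> idt X') \<odot> (idt (unit1 a) \<star> A) \<odot> lui X"
    using assms lui_nat[of A X X' a] by (simp add: unitL_def vc_assoc)
  also have "\<dots> = asc G F X' \<odot> (idt S \<star> A) \<odot> (eta \<star> idt X) \<odot> lui X"
    using assms slide[of eta A "unit1 a" X "G \<bowtie> F" X', symmetric, THEN vc_eq_extend]
    by (simp add: vc_assoc)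
  also have "\<dots> = (idt G \<star> idt F \<star> A) \<odot> unitL X"
    using assms asc_whisker3[of A X X' G F, THEN vc_eq_extend]
    by (simp add: unitL_def vc_assoc)
  finally show ?thesis .
qed

lemma unitR_nat:
  assumes "ok2 A" "dom A = X" "cod A = X'" "src X = a"
  shows "unitR X' \<odot> A = ((A \<star> idt G) \<star> idt F) \<odot> unitR X"
proof -
  have "unitR X' \<odot> A = asci X' G F \<odot> (idt X' \<star> eta) \<odot> (A \<star> idt (unit1 a)) \<odot> rui X"
    using assms rui_nat[of A X X' a] by (simp add: unitR_def vc_assoc)
  also have "\<dots> = asci X' G F \<odot> (A \<star> idt S) \<odot> (idt X \<star> eta) \<odot> rui X"
    using assms slide[of A eta X "unit1 a" X' "G \<bowtie> F", THEN vc_eq_extend]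
    by (simp add: vc_assoc)
  also have "\<dots> = ((A \<star> idt G) \<star> idt F) \<odot> unitR X"
    using assms asci_whisker1[of A X X' G F, THEN vc_eq_extend]
    by (simp add: unitR_def vc_assoc)
  finally show ?thesis .
qed

lemma counitL_nat:
  assumes "ok2 A" "dom A = X" "cod A = X'" "trg X = b"
  shows "counitL X' \<odot> (idt F \<star> idt G \<star> A) = A \<odot> counitL X"
proof -
  have "counitL X' \<odot> (idt F \<star> idt G \<star> A) = lu X' \<odot> (eps \<star> idt X') \<odot> (idt C \<star> A) \<odot> asci F G X"
    using assms asci_whisker3[of A X X' F G] by (simp add: counitL_def vc_assoc)
  also have "\<dots> = lu X' \<odot> (idt (unit1 b) \<star> A) \<odot> (eps \<star> idt X) \<odot> asci F G X"
    using assms slide[of eps A "F \<bowtie> G" X "unit1 b" X', symmetric, THEN vc_eq_extend]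
    by (simp add: vc_assoc)
  also have "\<dots> = A \<odot> counitL X"
    using assms lu_nat[of A X X' b, THEN vc_eq_extend]
    by (simp add: counitL_def vc_assoc)
  finally show ?thesis .
qed

lemma counitR_nat:
  assumes "ok2 A" "dom A = X" "cod A = X'" "src X = b"
  shows "counitR X' \<odot> ((A \<star> idt F) \<star> idt G) = A \<odot> counitR X"
proof -
  have "counitR X' \<odot> ((A \<star> idt F) \<star> idt G) = ru X' \<odot> (idt X' \<star> eps) \<odot> (A \<star> idt C) \<odot> asc X F G"
    using assms asc_whisker1[of A X X' F G] by (simp add: counitR_def vc_assoc)
  also have "\<dots> = ru X' \<odot> (A \<star> idt (unit1 b)) \<odot> (idt X \<star> eps) \<odot> asc X F G"
    using assms slide[of A eps X "F \<bowtie> G" X' "unit1 b", THEN vc_eq_extend]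
    by (simp add: vc_assoc)
  also have "\<dots> = A \<odot> counitR X"
    using assms ru_nat[of A X X' b, THEN vc_eq_extend]
    by (simp add: counitR_def vc_assoc)
  finally show ?thesis .
qed

text \<open>Both cells are \<open>eta\<close> inserted between \<open>F\<close> and \<open>X\<close>; they differ only in the bracketing. This identity is
the bridge between the two adjunctions, and most of the coherence needed later passes through it.\<close>

lemma unitR_unitL:
  assumes "ok1 X" "trg X = a"
  shows "asc F G (F \<bowtie> X) \<odot> asc C F X \<odot> (unitR F \<star> idt X) = idt F \<star> unitL X"
proof -
  have "asc F G (F \<bowtie> X) \<odot> asc C F X \<odot> (unitR F \<star> idt X)
     = (asc F G (F \<bowtie> X) \<odot> asc C F X \<odot> (asci F G F \<star> idt X)) \<odot> ((idt F \<star> eta) \<star> idt X) \<odot> (rui F \<star> idt X)"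
    using assms by (simp add: unitR_def whisker_right vc_assoc)
  also have "\<dots> = (idt F \<star> asc G F X) \<odot> (asc F S X \<odot> ((idt F \<star> eta) \<star> idt X)) \<odot> (rui F \<star> idt X)"
    using assms by (simp add: pentagon_right vc_assoc)
  also have "\<dots> = (idt F \<star> asc G F X) \<odot> (idt F \<star> eta \<star> idt X) \<odot> (asc F (unit1 a) X \<odot> (rui F \<star> idt X))"
    using assms asc_whisker2[of eta "unit1 a" "G \<bowtie> F" F X] by (simp add: vc_assoc)
  also have "\<dots> = idt F \<star> unitL X"
    using assms by (simp add: triangle_inverse unitL_def whisker_left)
  finally show ?thesis .
qed

lemma zigzag_F_unitR: "lu F \<odot> (eps \<star> idt F) \<odot> unitR F = idt F"
  using zigzag_F by (simp add: unitR_def)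

text \<open>By \<open>unitR_unitL\<close> this is the zigzag identity for \<open>F\<close> whiskered with \<open>X\<close>.\<close>

lemma counitL_unitL:
  assumes "ok1 X" "trg X = a"
  shows "counitL (F \<bowtie> X) \<odot> (idt F \<star> unitL X) = idt (F \<bowtie> X)"
proof -
  have "counitL (F \<bowtie> X) \<odot> (idt F \<star> unitL X) = lu (F \<bowtie> X) \<odot> (eps \<star> idt (F \<bowtie> X)) \<odot>
     (asci F G (F \<bowtie> X) \<odot> asc F G (F \<bowtie> X)) \<odot> asc C F X \<odot> (unitR F \<star> idt X)"
    using assms by (simp add: unitR_unitL[symmetric] counitL_def vc_assoc del: constraint_inverse)
  also have "\<dots> = lu (F \<bowtie> X) \<odot> ((eps \<star> idt (F \<bowtie> X)) \<odot> asc C F X) \<odot> (unitR F \<star> idt X)"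
    using assms by (simp add: vc_assoc)
  also have "\<dots> = (lu (F \<bowtie> X) \<odot> asc (unit1 b) F X) \<odot> ((eps \<star> idt F) \<star> idt X) \<odot> (unitR F \<star> idt X)"
    using assms asc_whisker1[of eps "F \<bowtie> G" "unit1 b" F X, THEN vc_eq_extend] by (simp add: vc_assoc)
  also have "\<dots> = (lu F \<odot> (eps \<star> idt F) \<odot> unitR F) \<star> idt X"
    using assms lu_hc1[of F X] by (simp add: whisker_right)
  also have "\<dots> = idt (F \<bowtie> X)"
    using assms by (simp add: zigzag_F_unitR)
  finally show ?thesis .
qed

text \<open>This is the zigzag identity for \<open>G\<close> whiskered with \<open>Q\<close>; the associators are collected by the pentagon.\<close>

lemma whisker_counitL_unitL:
  assumes "ok1 Q" "trg Q = b"
  shows "(idt G \<star> counitL Q) \<odot> unitL (G \<bowtie> Q) = idt (G \<bowtie> Q)"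
proof -
  have "(idt G \<star> counitL Q) \<odot> unitL (G \<bowtie> Q) = (idt G \<star> lu Q) \<odot> (idt G \<star> eps \<star> idt Q) \<odot> (idt G \<star> asci F G Q) \<odot>
      asc G F (G \<bowtie> Q) \<odot> (eta \<star> idt (G \<bowtie> Q)) \<odot> lui (G \<bowtie> Q)"
    using assms by (simp add: counitL_def unitL_def whisker_left vc_assoc)
  also have "\<dots> = (idt G \<star> lu Q) \<odot> (idt G \<star> eps \<star> idt Q) \<odot> (idt G \<star> asci F G Q) \<odot>
      asc G F (G \<bowtie> Q) \<odot> ((eta \<star> idt (G \<bowtie> Q)) \<odot> asc (unit1 a) G Q) \<odot> (lui G \<star> idt Q)"
    using assms by (simp add: vc_assoc lui_hc1)
  also have "\<dots> = (idt G \<star> lu Q) \<odot> (idt G \<star> eps \<star> idt Q) \<odot> (idt G \<star> asci F G Q) \<odot>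
      (asc G F (G \<bowtie> Q) \<odot> asc S G Q) \<odot> ((eta \<star> idt G) \<star> idt Q) \<odot> (lui G \<star> idt Q)"
    using assms asc_whisker1[of eta "unit1 a" "G \<bowtie> F" G Q, THEN vc_eq_extend] by (simp add: vc_assoc)
  also have "\<dots> = (idt G \<star> lu Q) \<odot> (idt G \<star> eps \<star> idt Q) \<odot> ((idt G \<star> asci F G Q) \<odot> (idt G \<star> asc F G Q)) \<odot>
      asc G C Q \<odot> (asc G F G \<star> idt Q) \<odot> ((eta \<star> idt G) \<star> idt Q) \<odot> (lui G \<star> idt Q)"
    using assms pentagon_cells_extend[of Q G F G] by (simp add: vc_assoc)
  also have "\<dots> = (idt G \<star> lu Q) \<odot> ((idt G \<star> eps \<star> idt Q) \<odot>
      asc G C Q) \<odot> (asc G F G \<star> idt Q) \<odot> ((eta \<star> idt G) \<star> idt Q) \<odot> (lui G \<star> idt Q)"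
    using assms by (simp add: vc_assoc flip: whisker_left)
  also have "\<dots> = ((idt G \<star> lu Q) \<odot> asc G (unit1 b) Q) \<odot> ((idt G \<star> eps) \<star> idt Q) \<odot>
      (asc G F G \<star> idt Q) \<odot> ((eta \<star> idt G) \<star> idt Q) \<odot> (lui G \<star> idt Q)"
    using assms asc_whisker2[of eps "F \<bowtie> G" "unit1 b" G Q, THEN vc_eq_extend] by (simp add: vc_assoc)
  also have "\<dots> = (ru G \<odot> (idt G \<star> eps) \<odot> asc G F G \<odot> (eta \<star> idt G) \<odot> lui G) \<star> idt Q"
    using assms by (simp add: triangle_cells whisker_right)
  also have "\<dots> = idt (G \<bowtie> Q)"
    using assms by (simp add: zigzag_G)
  finally show ?thesis .
qed

text \<open>The counit at \<open>F \<bowtie> X\<close> is the counit at \<open>F\<close> whiskered with \<open>X\<close>, and \<open>unitR_hc1\<close> is the analogue for the unit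
of the other adjunction.\<close>

lemma counitL_hc1:
  assumes "ok1 X" "trg X = a"
  shows "counitL (F \<bowtie> X) \<odot> (idt F \<star> asc G F X) \<odot> asc F S X = counitL F \<star> idt X"
proof -
  have "counitL (F \<bowtie> X) \<odot> (idt F \<star> asc G F X) \<odot> asc F S X =
      lu (F \<bowtie> X) \<odot> (eps \<star> idt (F \<bowtie> X)) \<odot> (asci F G (F \<bowtie> X) \<odot>
      asc F G (F \<bowtie> X)) \<odot> asc C F X \<odot> (asci F G F \<star> idt X)"
    using assms by (simp add: pentagon_right[symmetric] counitL_def vc_assoc del: constraint_inverse)
  also have "\<dots> = lu (F \<bowtie> X) \<odot> ((eps \<star> idt (F \<bowtie> X)) \<odot> asc C F X) \<odot> (asci F G F \<star> idt X)"
    using assms by (simp add: vc_assoc)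
  also have "\<dots> = (lu (F \<bowtie> X) \<odot> asc (unit1 b) F X) \<odot> ((eps \<star> idt F) \<star> idt X) \<odot> (asci F G F \<star> idt X)"
    using assms asc_whisker1[of eps "F \<bowtie> G" "unit1 b" F X, THEN vc_eq_extend] by (simp add: vc_assoc)
  also have "\<dots> = counitL F \<star> idt X"
    using assms lu_hc1[of F X] by (simp add: whisker_right counitL_def)
  finally show ?thesis .
qed

lemma unitR_hc1:
  assumes "ok1 D" "ok1 Y" "src D = trg Y" "src Y = a"
  shows "asc D (Y \<bowtie> G) F \<odot> (asc D Y G \<star> idt F) \<odot> unitR (D \<bowtie> Y) = idt D \<star> unitR Y"
proof -
  have "asc D (Y \<bowtie> G) F \<odot> (asc D Y G \<star> idt F) \<odot> unitR (D \<bowtie> Y) =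
      (asc D (Y \<bowtie> G) F \<odot> (asc D Y G \<star> idt F) \<odot> asci (D \<bowtie> Y) G F) \<odot> (idt (D \<bowtie> Y) \<star> eta) \<odot> rui (D \<bowtie> Y)"
    using assms by (simp add: unitR_def vc_assoc)
  also have "\<dots> = (idt D \<star> asci Y G F) \<odot> (asc D Y S \<odot> (idt (D \<bowtie> Y) \<star> eta)) \<odot> rui (D \<bowtie> Y)"
    using assms by (simp add: pentagon_left vc_assoc)
  also have "\<dots> = (idt D \<star> asci Y G F) \<odot> (idt D \<star> idt Y \<star> eta) \<odot> (asc D Y (unit1 a) \<odot> rui (D \<bowtie> Y))"
    using assms asc_whisker3[of eta "unit1 a" "G \<bowtie> F" D Y] by (simp add: vc_assoc)
  also have "\<dots> = idt D \<star> unitR Y"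
    using assms by (simp add: rui_hc1 unitR_def whisker_left)
  finally show ?thesis .
qed

lemma counitR_unitR_FG: "counitR C \<odot> (unitR F \<star> idt G) = idt C"
proof -
  have m: "asc C F G \<odot> (unitR F \<star> idt G) = asci F G C \<odot> (idt F \<star> unitL G)"
    by (rule move_left[OF inv_pair_asc]) (simp_all add: unitR_unitL)
  have "counitR C \<odot> (unitR F \<star> idt G) =
     ru C \<odot> ((idt C \<star> eps) \<odot> asci F G C) \<odot> (idt F \<star> unitL G)"
    by (simp add: counitR_def vc_assoc m)
  also have "\<dots> = (ru C \<odot> asci F G (unit1 b)) \<odot> (idt F \<star> idt G \<star> eps) \<odot> (idt F \<star> unitL G)"
    using asci_whisker3[of eps "F \<bowtie> G" "unit1 b" F G, THEN vc_eq_extend] by (simp add: vc_assoc)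
  also have "\<dots> = idt F \<star> (ru G \<odot> (idt G \<star> eps) \<odot> unitL G)"
    by (simp add: ru_asci whisker_left)
  also have "\<dots> = idt C"
    using zigzag_G by (simp add: unitL_def)
  finally show ?thesis .
qed

lemma counitR_unitR:
  assumes "ok1 Z" "src Z = b"
  shows "(counitR Z \<star> idt F) \<odot> unitR (Z \<bowtie> F) = idt (Z \<bowtie> F)"
proof -
  have m: "(asc Z F G \<star> idt F) \<odot> unitR (Z \<bowtie> F) = asci Z C F \<odot> (idt Z \<star> unitR F)"
    by (rule move_left[OF inv_pair_asc]) (use assms in \<open>simp_all add: unitR_hc1\<close>)
  have "(counitR Z \<star> idt F) \<odot> unitR (Z \<bowtie> F) =
      (ru Z \<star> idt F) \<odot> (((idt Z \<star> eps) \<star> idt F) \<odot> asci Z C F) \<odot> (idt Z \<star> unitR F)"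
    using assms by (simp add: counitR_def whisker_right vc_assoc m)
  also have "\<dots> = ((ru Z \<star> idt F) \<odot> asci Z (unit1 b) F) \<odot> (idt Z \<star> eps \<star> idt F) \<odot> (idt Z \<star> unitR F)"
    using assms asci_whisker2[of eps "F \<bowtie> G" "unit1 b" Z F, THEN vc_eq_extend] by (simp add: vc_assoc)
  also have "\<dots> = idt Z \<star> (lu F \<odot> (eps \<star> idt F) \<odot> unitR F)"
    using assms by (simp add: triangle_asci whisker_left)
  also have "\<dots> = idt (Z \<bowtie> F)"
    using assms by (simp add: zigzag_F_unitR)
  finally show ?thesis .
qed

definition "comult = asc C F G \<odot> (unitR F \<star> idt G)"

lemma comult_simps [simp]: "ok2 comult" "dom comult = F \<bowtie> G" "cod comult = C \<bowtie> F \<bowtie> G"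
  by (simp_all add: comult_def)

lemma comult_unitL_G: "comult = asci F G C \<odot> (idt F \<star> unitL G)"
  unfolding comult_def by (rule move_left[OF inv_pair_asc]) (simp_all add: unitR_unitL)

text \<open>Up to associators, \<open>C \<bowtie> _\<close> is the comonad \<open>F \<bowtie> G \<bowtie> _\<close> of the adjunction with unit \<open>unitL\<close>. The lemma
identifies the comultiplication that \<open>C \<bowtie> _\<close> inherits from the comonoid with that of the comonad, at
the object \<open>F\<close>.\<close>

lemma comult_unitL:
  "asc F G (F \<bowtie> G \<bowtie> F) \<odot> (idt C \<star> asc F G F) \<odot> asc C C F \<odot> (comult \<star> idt F)
    = (idt F \<star> unitL S) \<odot> asc F G F"
proof -
  have "asc F G (F \<bowtie> G \<bowtie> F) \<odot> (idt C \<star> asc F G F) \<odot> asc C C F \<odot> (comult \<star> idt F)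
    = asc F G (F \<bowtie> G \<bowtie> F) \<odot> asc C F S \<odot> (asc (C \<bowtie> F) G F \<odot> ((unitR F \<star> idt G) \<star> idt F))"
    by (simp add: comult_def whisker_right pentagon_cells_extend vc_assoc del: hc2_idt)
  also have "\<dots> = (asc F G (F \<bowtie> G \<bowtie> F) \<odot> asc C F S \<odot> (unitR F \<star> idt S)) \<odot> asc F G F"
    using asc_whisker1[of "unitR F" F "C \<bowtie> F" G F] by (simp add: vc_assoc)
  also have "\<dots> = (idt F \<star> unitL S) \<odot> asc F G F"
    by (simp add: unitR_unitL)
  finally show ?thesis .
qed

section \<open>Subobjects and coactions\<close>

text \<open>The transpose of \<open>i : H \<rightarrow> G \<bowtie> F\<close>; \<open>transpose_xi\<close> recovers \<open>i\<close> from it.\<close>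

definition xi where "xi i = counitL F \<odot> (idt F \<star> i)"

definition over :: "('o, 'm) cell1 \<Rightarrow> ('o, 'm, 'c) cell2 \<Rightarrow> bool" where
  "over H i \<longleftrightarrow> ok1 H \<and> src H = a \<and> trg H = a \<and> ok2 i \<and> dom i = H \<and> cod i = S"

lemma overD:
  assumes "over H i"
  shows "ok1 H" "src H = a" "trg H = a" "ok2 i" "dom i = H" "cod i = S"
  using assms by (auto simp: over_def)

lemma xi_simps [simp]:
  assumes "over H i" shows "ok2 (xi i)" "dom (xi i) = F \<bowtie> H" "cod (xi i) = F"
  using overD[OF assms] by (simp_all add: xi_def)

lemma transpose_xi:
  assumes "over H i" shows "(idt G \<star> xi i) \<odot> unitL H = i"
proof -
  have "(idt G \<star> xi i) \<odot> unitL H = (idt G \<star> counitL F) \<odot> unitL S \<odot> i"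
    using overD[OF assms] by (simp add: xi_def whisker_left vc_assoc unitL_nat[of i H S])
  also have "\<dots> = i"
    using overD[OF assms] whisker_counitL_unitL[of F] by (simp flip: vc_assoc)
  finally show ?thesis .
qed

lemma transposeL:
  assumes "ok1 H" "trg H = a" "ok2 A" "dom A = F \<bowtie> H" "cod A = Q" "trg Q = b"
  shows "counitL Q \<odot> (idt F \<star> ((idt G \<star> A) \<odot> unitL H)) = A"
  using assms counitL_nat[of A "F \<bowtie> H" Q, THEN vc_eq_extend]
  by (simp add: whisker_left vc_assoc counitL_unitL)

definition "mult_cell = (idt G \<star> counitL F) \<odot> asc G F S"

lemma mult_cell_simps [simp]: "ok2 mult_cell" "dom mult_cell = S \<bowtie> S" "cod mult_cell = S"
  by (simp_all add: mult_cell_def)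

lemma mult_cell_over:
  assumes "over H i"
  shows "mult_cell \<odot> (idt S \<star> i) = (idt G \<star> xi i) \<odot> asc G F H"
  using overD[OF assms] by (simp add: mult_cell_def vc_assoc asc_whisker3[of i H S G F] xi_def whisker_left del: hc2_idt)

text \<open>The multiplication bracketed from the other side. This makes it symmetric under the reversal of
1-cells, which interchanges \<open>F\<close> with \<open>G\<close> and the two bracketings.\<close>

lemma mult_cell_counitR: "mult_cell = (counitR G \<star> idt F) \<odot> asci S G F"
proof -
  have "mult_cell = (idt G \<star> lu F) \<odot> (idt G \<star> eps \<star> idt F) \<odot> (idt G \<star> asci F G F) \<odot> asc G F S"
    by (simp add: mult_cell_def counitL_def whisker_left vc_assoc)
  also have "\<dots> = (idt G \<star> lu F) \<odot> ((idt G \<star> eps \<star> idt F) \<odot> asc G C F) \<odot> (asc G F G \<star> idt F) \<odot> asci S G F"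
    by (simp add: pentagon_left[symmetric] vc_assoc)
  also have "\<dots> = ((idt G \<star> lu F) \<odot> asc G (unit1 b) F) \<odot> ((idt G \<star> eps) \<star> idt F) \<odot>
      (asc G F G \<star> idt F) \<odot> asci S G F"
    using asc_whisker2[of eps C "unit1 b" G F, THEN vc_eq_extend] by (simp add: vc_assoc)
  also have "\<dots> = (counitR G \<star> idt F) \<odot> asci S G F"
    by (simp add: triangle_cells counitR_def whisker_right vc_assoc)
  finally show ?thesis .
qed

text \<open>The coaction of the comonad on \<open>F\<close> that corresponds to the identity of \<open>C\<close>.\<close>

definition "theta0 = asc F G F \<odot> unitR F"

lemma theta0_simps [simp]: "ok2 theta0" "dom theta0 = F" "cod theta0 = F \<bowtie> S"
  by (simp_all add: theta0_def)

lemma counitL_asc: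
  "counitL F \<odot> asc F G F = lu F \<odot> (eps \<star> idt F)"
  by (simp add: counitL_def vc_assoc)

lemma counitL_theta0: "counitL F \<odot> theta0 = idt F"
  using zigzag_F_unitR by (simp add: theta0_def counitL_asc[THEN vc_eq_extend] vc_assoc)

text \<open>The functor \<open>G \<bowtie> _\<close> reflects the invertibility of \<open>xi i\<close>, although it need not be conservative. The source and
the target of \<open>xi i\<close> are in the image of \<open>F \<bowtie> _\<close>, up to \<open>F \<bowtie> 1 \<cong> F\<close>, and the arrows between such objects are
the Kleisli arrows of the monad \<open>G \<bowtie> F \<bowtie> _\<close>; the inverse arises by transposing \<open>v\<close>.\<close>

lemma inv_pair_reflect:
  assumes "over H i" "inv_pair (idt G \<star> xi i) v"
  shows "inv_pair (xi i) (counitL (F \<bowtie> H) \<odot> (idt F \<star> v) \<odot> theta0)"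
proof -
  note H [simp] = overD[OF assms(1)] xi_simps[OF assms(1)]
  have v [simp]: "ok2 v" "dom v = S" "cod v = G \<bowtie> F \<bowtie> H"
    and v1: "(idt G \<star> xi i) \<odot> v = idt S" and v2: "v \<odot> (idt G \<star> xi i) = idt (G \<bowtie> F \<bowtie> H)"
    using inv_pair_D[OF assms(2)] by simp_all
  define k where "k = counitL (F \<bowtie> H) \<odot> (idt F \<star> v) \<odot> theta0"
  have k [simp]: "ok2 k" "dom k = F" "cod k = F \<bowtie> H"
    by (simp_all add: k_def)
  have 1: "xi i \<odot> k = idt F"
  proof -
    have "xi i \<odot> k = counitL F \<odot> (idt F \<star> ((idt G \<star> xi i) \<odot> v)) \<odot> theta0"
      by (simp add: k_def whisker_left vc_assoc counitL_nat[of "xi i" "F \<bowtie> H" F, THEN vc_eq_extend, unfolded vc_assoc, symmetric])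
    then show ?thesis
      by (simp add: v1 counitL_theta0)
  qed
  \<comment> \<open>\<open>G \<bowtie> k\<close> is a right inverse of the invertible \<open>G \<bowtie> xi i\<close>.\<close>
  have Rk: "idt G \<star> k = v"
  proof -
    have "(idt G \<star> xi i) \<odot> (idt G \<star> k) = idt S"
      by (simp add: 1 flip: whisker_left)
    then have "idt G \<star> k = v \<odot> idt S"
      by (intro move_left[OF assms(2)]) simp_all
    then show ?thesis by simp
  qed
  \<comment> \<open>Two arrows out of \<open>F \<bowtie> H\<close> agree when their transposes do.\<close>
  have "(idt G \<star> (k \<odot> xi i)) \<odot> unitL H = (idt G \<star> idt (F \<bowtie> H)) \<odot> unitL H"
    by (simp add: whisker_left Rk v2)
  then have "k \<odot> xi i = idt (F \<bowtie> H)"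
    using transposeL[of H "k \<odot> xi i" "F \<bowtie> H"] transposeL[of H "idt (F \<bowtie> H)" "F \<bowtie> H"]
    by simp
  with 1 show ?thesis
    unfolding k_def[symmetric] by (simp add: inv_pair_def)
qed

text \<open>By \<open>mult_cell_over\<close> the action map on \<open>H\<close> is \<open>G \<bowtie> xi i\<close> preceded by an associator. Hence the defining
condition of \<open>I\<^sup>l\<close> says that \<open>xi i\<close> is an isomorphism from \<open>F \<bowtie> H\<close> to \<open>F\<close>.\<close>

lemma mult_cell_iso_iff:
  assumes "over H i"
  shows "(\<exists>w. inv_pair (mult_cell \<odot> (idt S \<star> i)) w) \<longleftrightarrow> (\<exists>x. inv_pair (xi i) x)"
proof
  note H [simp] = overD[OF assms(1)] xi_simps[OF assms(1)]
  assume "\<exists>w. inv_pair (mult_cell \<odot> (idt S \<star> i)) w"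
  then obtain w where "inv_pair ((idt G \<star> xi i) \<odot> asc G F H) w"
    unfolding mult_cell_over[OF assms] by auto
  from inv_pair_shift[OF this inv_pair_asc] inv_pair_reflect[OF assms]
  show "\<exists>x. inv_pair (xi i) x" by auto
next
  note H [simp] = overD[OF assms(1)] xi_simps[OF assms(1)]
  assume "\<exists>x. inv_pair (xi i) x"
  then obtain x where "inv_pair (xi i) x" ..
  then have "inv_pair ((idt G \<star> xi i) \<odot> asc G F H) (asci G F H \<odot> (idt G \<star> x))"
    by (intro inv_pair_vc inv_pair_wl inv_pair_asc) simp_all
  then show "\<exists>w. inv_pair (mult_cell \<odot> (idt S \<star> i)) w"
    unfolding mult_cell_over[OF assms] by auto
qed

text \<open>The transpose of \<open>g : C \<rightarrow> Z\<close> for the adjunction between \<open>_ \<bowtie> G\<close> and \<open>_ \<bowtie> F\<close>. For \<open>Z = C\<close> it is the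
canonical coaction of \<open>C\<close> on \<open>F\<close>, twisted by \<open>g\<close>.\<close>

definition "twist g = (g \<star> idt F) \<odot> unitR F"

lemma twist_simps [simp]:
  assumes "ok2 g" "dom g = C"
  shows "ok2 (twist g)" "dom (twist g) = F" "cod (twist g) = cod g \<bowtie> F"
  using assms by (simp_all add: twist_def)

lemma counitR_twist:
  assumes "ok2 g" "dom g = C" "cod g = Z"
  shows "counitR Z \<odot> (twist g \<star> idt G) = g"
proof -
  have Z: "ok1 Z" "src Z = b"
    using assms by (metis ok1_cod, metis src_cod hc1_simps(1) G(2))
  then show ?thesis
  using assms counitR_nat[of g C Z, THEN vc_eq_extend]
  by (simp add: twist_def whisker_right vc_assoc counitR_unitR_FG)
qed

lemma twist_inj:
  assumes "twist g = twist g'" "ok2 g" "dom g = C" "cod g = Z" "ok2 g'" "dom g' = C" "cod g' = Z"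
  shows "g = g'"
  using assms by (metis counitR_twist)

lemma twist_counitR:
  assumes "ok2 t" "dom t = F" "cod t = Z \<bowtie> F" "ok1 Z" "src Z = b"
  shows "twist (counitR Z \<odot> (t \<star> idt G)) = t"
  using assms unitR_nat[of t F "Z \<bowtie> F", symmetric] counitR_unitR[of Z, THEN vc_eq_extend]
  by (simp add: twist_def whisker_right vc_assoc)

lemma twist_vc:
  assumes "ok2 g" "dom g = C" "cod g = D" "ok2 g'" "dom g' = D" "src D = b"
  shows "twist (g' \<odot> g) = (g' \<star> idt F) \<odot> twist g"
  using assms by (simp add: twist_def whisker_right vc_assoc)

definition comonoid_endo where
  "comonoid_endo g \<longleftrightarrow> ok2 g \<and> dom g = C \<and> cod g = C \<and>
     comult \<odot> g = (g \<star> g) \<odot> comult \<and> eps \<odot> g = eps"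

text \<open>Coalgebra structures on \<open>F\<close> for the comonad \<open>F \<bowtie> G \<bowtie> _\<close>.\<close>

definition coalgebra where
  "coalgebra t \<longleftrightarrow> ok2 t \<and> dom t = F \<and> cod t = F \<bowtie> S \<and> counitL F \<odot> t = idt F \<and>
     (idt F \<star> unitL S) \<odot> t = (idt F \<star> idt G \<star> t) \<odot> t"

lemma twist_comult: "asc C C F \<odot> twist comult = (idt C \<star> unitR F) \<odot> unitR F"
proof -
  have "asc C C F \<odot> twist comult = asc C C F \<odot> (asc C F G \<star> idt F) \<odot> ((unitR F \<star> idt G) \<star> idt F) \<odot> unitR F"
    by (simp add: twist_def comult_def whisker_right vc_assoc)
  also have "\<dots> = (asc C C F \<odot> (asc C F G \<star> idt F) \<odot> unitR (C \<bowtie> F)) \<odot> unitR F"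
    using unitR_nat[of "unitR F" F "C \<bowtie> F"] by (simp add: vc_assoc)
  also have "\<dots> = (idt C \<star> unitR F) \<odot> unitR F"
    by (simp add: unitR_hc1)
  finally show ?thesis .
qed

lemma twist_hc2_comult:
  assumes [simp]: "ok2 g" "dom g = C" "cod g = C"
  shows "asc C C F \<odot> twist ((g \<star> g) \<odot> comult) = (idt C \<star> twist g) \<odot> twist g"
proof -
  have "asc C C F \<odot> twist ((g \<star> g) \<odot> comult) = (asc C C F \<odot> ((g \<star> g) \<star> idt F)) \<odot> twist comult"
    by (simp add: twist_vc vc_assoc)
  also have "\<dots> = (g \<star> g \<star> idt F) \<odot> asc C C F \<odot> twist comult"
    using asc_nat[of g g "idt F" C C F C C F] by (simp add: vc_assoc)
  also have "\<dots> = ((g \<star> g \<star> idt F) \<odot> (idt C \<star> unitR F)) \<odot> unitR F"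
    by (simp add: twist_comult vc_assoc)
  also have "\<dots> = (g \<star> twist g) \<odot> unitR F"
    using hc2_vc[of g "idt C" "g \<star> idt F" "unitR F"] by (simp add: twist_def)
  also have "\<dots> = ((idt C \<star> twist g) \<odot> (g \<star> idt F)) \<odot> unitR F"
    by (simp add: whisker_hc2)
  also have "\<dots> = (idt C \<star> twist g) \<odot> twist g"
    by (simp add: vc_assoc twist_def[of g, symmetric])
  finally show ?thesis .
qed

text \<open>Coassociativity for the comonoid \<open>C\<close> and for the comonad \<open>F \<bowtie> G \<bowtie> _\<close> are the same condition, since
both sides of the first are carried to both sides of the second by the same invertible 2-cell.\<close>

lemma coassoc_iff:
  assumes [simp]: "ok2 t" "dom t = F" "cod t = C \<bowtie> F"
  shows "asc C C F \<odot> (comult \<star> idt F) \<odot> t = (idt C \<star> t) \<odot> t \<longleftrightarrow>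
    (idt F \<star> unitL S) \<odot> asc F G F \<odot> t = (idt F \<star> idt G \<star> (asc F G F \<odot> t)) \<odot> asc F G F \<odot> t"
    (is "?l = ?r \<longleftrightarrow> ?l' = ?r'")
proof -
  let ?Z = "asc F G (F \<bowtie> S) \<odot> (idt C \<star> asc F G F)"
  have Z: "inv_pair ?Z ((idt C \<star> asci F G F) \<odot> asci F G (F \<bowtie> S))"
    by (intro inv_pair_vc inv_pair_wl inv_pair_asc) simp_all
  have l: "?Z \<odot> ?l = ?l'"
    using comult_unitL[THEN vc_eq_extend] by (simp add: vc_assoc)
  have "?Z \<odot> ?r = asc F G (F \<bowtie> S) \<odot> (idt C \<star> (asc F G F \<odot> t)) \<odot> t"
    by (simp add: whisker_left vc_assoc del: hc2_idt)
  also have "\<dots> = ?r'"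
    using asc_whisker3[of "asc F G F \<odot> t" F "F \<bowtie> S" F G, THEN vc_eq_extend] by (simp add: vc_assoc)
  finally have r: "?Z \<odot> ?r = ?r'" .
  show ?thesis
    unfolding l[symmetric] r[symmetric]
    using cancel_left[OF Z, of ?l ?r] by auto
qed

text \<open>Transposition turns the two conditions on an endomorphism of the comonoid into the counit law and the
coassociative law of the twisted coaction.\<close>

lemma comonoid_endo_iff:
  assumes [simp]: "ok2 g" "dom g = C" "cod g = C"
  shows "comonoid_endo g \<longleftrightarrow> coalgebra (asc F G F \<odot> twist g)"
proof -
  have "eps \<odot> g = eps \<longleftrightarrow> twist (eps \<odot> g) = twist eps"
    using twist_inj[of "eps \<odot> g" eps "unit1 b"] by auto
  also have "\<dots> \<longleftrightarrow> lu F \<odot> twist (eps \<odot> g) = lu F \<odot> twist eps"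
    using cancel_left[OF inv_pair_lu[of F], of "twist (eps \<odot> g)" "twist eps"] by auto
  also have "lu F \<odot> twist eps = idt F"
    using zigzag_F_unitR by (simp add: twist_def)
  also have "lu F \<odot> twist (eps \<odot> g) = counitL F \<odot> asc F G F \<odot> twist g"
    by (simp add: twist_vc vc_assoc counitL_asc[THEN vc_eq_extend])
  finally have 1: "eps \<odot> g = eps \<longleftrightarrow> counitL F \<odot> asc F G F \<odot> twist g = idt F" .
  have "comult \<odot> g = (g \<star> g) \<odot> comult \<longleftrightarrow> twist (comult \<odot> g) = twist ((g \<star> g) \<odot> comult)"
    using twist_inj[of "comult \<odot> g" "(g \<star> g) \<odot> comult" "C \<bowtie> C"] by auto
  also have "\<dots> \<longleftrightarrow> asc C C F \<odot> twist (comult \<odot> g) = asc C C F \<odot> twist ((g \<star> g) \<odot> comult)"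
    using cancel_left[OF inv_pair_asc[of F C C], of "twist (comult \<odot> g)" "twist ((g \<star> g) \<odot> comult)"] by auto
  also have "\<dots> \<longleftrightarrow> asc C C F \<odot> (comult \<star> idt F) \<odot> twist g = (idt C \<star> twist g) \<odot> twist g"
    by (simp add: twist_hc2_comult twist_vc[of g C comult])
  finally have 2: "comult \<odot> g = (g \<star> g) \<odot> comult \<longleftrightarrow>
     asc C C F \<odot> (comult \<star> idt F) \<odot> twist g = (idt C \<star> twist g) \<odot> twist g" .
  show ?thesis
    unfolding comonoid_endo_def coalgebra_def 1 2 by (simp add: coassoc_iff conj_commute)
qed

text \<open>With \<open>x\<close> the inverse of \<open>xi i\<close>, \<open>theta i x\<close> is the coaction that \<open>F\<close> receives from the canonical coaction on
\<open>F \<bowtie> H\<close> along the isomorphism \<open>xi i\<close>, and \<open>Gamma_cell i x\<close> is the endomorphism of \<open>C\<close> whose twisted coaction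
it is.\<close>

definition "theta i x = (idt F \<star> i) \<odot> x"
definition "Gamma_cell i x = counitR C \<odot> ((asci F G F \<odot> theta i x) \<star> idt G)"

lemma theta_simps [simp]:
  assumes "over H i" "inv_pair (xi i) x"
  shows "ok2 (theta i x)" "dom (theta i x) = F" "cod (theta i x) = F \<bowtie> S"
  using overD[OF assms(1)] inv_pair_D[OF assms(2)] assms(1) by (simp_all add: theta_def)

lemma Gamma_cell_simps [simp]:
  assumes "over H i" "inv_pair (xi i) x"
  shows "ok2 (Gamma_cell i x)" "dom (Gamma_cell i x) = C" "cod (Gamma_cell i x) = C"
  using theta_simps[OF assms] by (simp_all add: Gamma_cell_def)

lemma twist_Gamma_cell:
  assumes "over H i" "inv_pair (xi i) x"
  shows "twist (Gamma_cell i x) = asci F G F \<odot> theta i x"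
  unfolding Gamma_cell_def using theta_simps[OF assms] by (intro twist_counitR) simp_all

lemma inverse_xi_over:
  assumes "over H i" "inv_pair (xi i) x"
  shows "(idt G \<star> x) \<odot> i = unitL H"
proof -
  note H [simp] = overD[OF assms(1)] xi_simps[OF assms(1)]
  have x [simp]: "ok2 x" "dom x = F" "cod x = F \<bowtie> H" and x2: "x \<odot> xi i = idt (F \<bowtie> H)"
    using inv_pair_D[OF assms(2)] by simp_all
  have "(idt G \<star> x) \<odot> i = (idt G \<star> x) \<odot> (idt G \<star> xi i) \<odot> unitL H"
    by (simp add: transpose_xi[OF assms(1)])
  also have "\<dots> = (idt G \<star> (x \<odot> xi i)) \<odot> unitL H"
    by (simp add: whisker_left vc_assoc)
  finally show ?thesis by (simp add: x2)
qed

text \<open>Transport of structure: by \<open>inverse_xi_over\<close> the composite of \<open>i\<close> with \<open>G \<bowtie> x\<close> is the unit at \<open>H\<close>, and with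
this coassociativity becomes the naturality of the unit at \<open>i\<close>.\<close>

lemma coalgebra_theta:
  assumes "over H i" "inv_pair (xi i) x"
  shows "coalgebra (theta i x)"
proof -
  note H [simp] = overD[OF assms(1)] xi_simps[OF assms(1)]
  have x [simp]: "ok2 x" "dom x = F" "cod x = F \<bowtie> H" and x1: "xi i \<odot> x = idt F"
    and x2: "x \<odot> xi i = idt (F \<bowtie> H)"
    using inv_pair_D[OF assms(2)] by simp_all
  have "(idt F \<star> unitL S) \<odot> theta i x = (idt F \<star> ((idt G \<star> idt F \<star> i) \<odot> unitL H)) \<odot> x"
    by (simp add: theta_def whisker_left[symmetric] vc_assoc[symmetric] unitL_nat[of i H S])
  also have "\<dots> = (idt F \<star> ((idt G \<star> idt F \<star> i) \<odot> (idt G \<star> x) \<odot> i)) \<odot> x"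
    by (simp add: inverse_xi_over[OF assms])
  also have "\<dots> = (idt F \<star> idt G \<star> theta i x) \<odot> theta i x"
    by (simp add: theta_def whisker_left vc_assoc)
  finally show ?thesis
    using assms x1 by (simp add: coalgebra_def) (simp add: theta_def xi_def vc_assoc)
qed

lemma comonoid_endo_Gamma_cell:
  assumes "over H i" "inv_pair (xi i) x"
  shows "comonoid_endo (Gamma_cell i x)"
proof -
  note [simp] = Gamma_cell_simps[OF assms] theta_simps[OF assms]
  have "asc F G F \<odot> twist (Gamma_cell i x) = theta i x"
    by (simp add: twist_Gamma_cell[OF assms] flip: vc_assoc)
  then show ?thesis
    using coalgebra_theta[OF assms] by (subst comonoid_endo_iff) simp_all
qed

lemma Gamma_cell_eq_iff:
  assumes "over H i" "inv_pair (xi i) x" "over J j" "inv_pair (xi j) y"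
  shows "Gamma_cell i x = Gamma_cell j y \<longleftrightarrow> theta i x = theta j y"
proof
  note [simp] = theta_simps[OF assms(1,2)] theta_simps[OF assms(3,4)]
  assume "Gamma_cell i x = Gamma_cell j y"
  then have "asci F G F \<odot> theta i x = asci F G F \<odot> theta j y"
    by (simp flip: twist_Gamma_cell[OF assms(1,2)] twist_Gamma_cell[OF assms(3,4)])
  then show "theta i x = theta j y"
    by (rule cancel_left[OF inv_pair_sym[OF inv_pair_asc], rotated 5]) simp_all
qed (simp add: Gamma_cell_def)

text \<open>The transpose of \<open>eta\<close> is the right unit constraint.\<close>

lemma over_unit: "over (unit1 a) eta" "inv_pair (xi eta) (rui F)" "Gamma_cell eta (rui F) = idt C"
proof -
  show o: "over (unit1 a) eta" by (simp add: over_def)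
  have "xi eta \<odot> rui F = idt F"
    using zigzag_F by (simp add: xi_def counitL_def vc_assoc)
  then have "xi eta = ru F"
    using o move_right[OF inv_pair_sym[OF inv_pair_ru[OF F(1)]], of "xi eta" "idt F"] by simp
  then show "inv_pair (xi eta) (rui F)"
    using inv_pair_ru[OF F(1)] by simp
  show "Gamma_cell eta (rui F) = idt C"
    using counitR_unitR_FG by (simp add: Gamma_cell_def theta_def unitR_def)
qed

text \<open>Composing \<open>i\<close> with an isomorphism changes neither the invertibility of the transpose nor the coaction.\<close>

lemma over_vc:
  assumes "over H i" "inv_pair (xi i) x" "inv_pair \<phi> \<phi>'" "dom \<phi> = J" "cod \<phi> = H"
  shows "over J (i \<odot> \<phi>)" "inv_pair (xi (i \<odot> \<phi>)) ((idt F \<star> \<phi>') \<odot> x)"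
    "theta (i \<odot> \<phi>) ((idt F \<star> \<phi>') \<odot> x) = theta i x"
proof -
  note H [simp] = overD[OF assms(1)] xi_simps[OF assms(1)]
  have f [simp]: "ok2 \<phi>" "ok2 \<phi>'" "cod \<phi>' = J" "dom \<phi>' = H" and f1: "\<phi> \<odot> \<phi>' = idt H"
    using inv_pair_D[OF assms(3)] assms(4,5) by simp_all
  have J [simp]: "ok1 J" "src J = a" "trg J = a"
    using ok1_dom[OF f(1)] src_cod[OF f(1)] trg_cod[OF f(1)] assms(4,5) by simp_all
  have x [simp]: "ok2 x" "dom x = F" "cod x = F \<bowtie> H"
    using inv_pair_D[OF assms(2)] by simp_all
  note [simp] = assms(4,5)
  show "over J (i \<odot> \<phi>)"
    by (simp add: over_def)
  have "xi (i \<odot> \<phi>) = xi i \<odot> (idt F \<star> \<phi>)"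
    by (simp add: xi_def whisker_left vc_assoc)
  then show "inv_pair (xi (i \<odot> \<phi>)) ((idt F \<star> \<phi>') \<odot> x)"
    by (auto intro!: inv_pair_vc inv_pair_wl assms(2,3))
  have "theta (i \<odot> \<phi>) ((idt F \<star> \<phi>') \<odot> x) = (idt F \<star> i) \<odot> (idt F \<star> (\<phi> \<odot> \<phi>')) \<odot> x"
    by (simp add: theta_def whisker_left vc_assoc)
  then show "theta (i \<odot> \<phi>) ((idt F \<star> \<phi>') \<odot> x) = theta i x"
    by (simp add: f1 theta_def)
qed

definition "product_cell i j = mult_cell \<odot> (i \<star> j)"

context
  fixes H\<^sub>1 H\<^sub>2 i\<^sub>1 i\<^sub>2 x\<^sub>1 x\<^sub>2
  assumes o1: "over H\<^sub>1 i\<^sub>1" "inv_pair (xi i\<^sub>1) x\<^sub>1" and o2: "over H\<^sub>2 i\<^sub>2" "inv_pair (xi i\<^sub>2) x\<^sub>2"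
begin

lemma factor_simps [simp]:
  "ok1 H\<^sub>1" "src H\<^sub>1 = a" "trg H\<^sub>1 = a" "ok2 i\<^sub>1" "dom i\<^sub>1 = H\<^sub>1" "cod i\<^sub>1 = S"
  "ok2 (xi i\<^sub>1)" "dom (xi i\<^sub>1) = F \<bowtie> H\<^sub>1" "cod (xi i\<^sub>1) = F" "ok2 x\<^sub>1" "dom x\<^sub>1 = F" "cod x\<^sub>1 = F \<bowtie> H\<^sub>1"
  "x\<^sub>1 \<odot> xi i\<^sub>1 = idt (F \<bowtie> H\<^sub>1)" "xi i\<^sub>1 \<odot> x\<^sub>1 = idt F"
  "ok1 H\<^sub>2" "src H\<^sub>2 = a" "trg H\<^sub>2 = a" "ok2 i\<^sub>2" "dom i\<^sub>2 = H\<^sub>2" "cod i\<^sub>2 = S"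
  "ok2 (xi i\<^sub>2)" "dom (xi i\<^sub>2) = F \<bowtie> H\<^sub>2" "cod (xi i\<^sub>2) = F" "ok2 x\<^sub>2" "dom x\<^sub>2 = F" "cod x\<^sub>2 = F \<bowtie> H\<^sub>2"
  "x\<^sub>2 \<odot> xi i\<^sub>2 = idt (F \<bowtie> H\<^sub>2)" "xi i\<^sub>2 \<odot> x\<^sub>2 = idt F"
  using overD[OF o1(1)] overD[OF o2(1)] xi_simps[OF o1(1)] xi_simps[OF o2(1)] inv_pair_D[OF o1(2)]
    inv_pair_D[OF o2(2)] by simp_all

lemma product_cell_eq: "product_cell i\<^sub>1 i\<^sub>2 = (idt G \<star> xi i\<^sub>2) \<odot> asc G F H\<^sub>2 \<odot> (i\<^sub>1 \<star> idt H\<^sub>2)"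
proof -
  have "product_cell i\<^sub>1 i\<^sub>2 = (mult_cell \<odot> (idt S \<star> i\<^sub>2)) \<odot> (i\<^sub>1 \<star> idt H\<^sub>2)"
    by (simp add: product_cell_def vc_assoc whisker_hc2)
  then show ?thesis
    by (simp add: mult_cell_over[OF o2(1)] vc_assoc)
qed

lemma over_product: "over (H\<^sub>1 \<bowtie> H\<^sub>2) (product_cell i\<^sub>1 i\<^sub>2)"
  by (simp add: over_def product_cell_def)

text \<open>Under the identification of elements of \<open>I\<^sup>l\<close> with isomorphisms from \<open>F \<bowtie> H\<close> to \<open>F\<close>, the product is
\<open>F \<bowtie> H\<^sub>1 \<bowtie> H\<^sub>2 \<cong> F \<bowtie> H\<^sub>2 \<cong> F\<close>.\<close>

lemma xi_product: "xi (product_cell i\<^sub>1 i\<^sub>2) \<odot> asc F H\<^sub>1 H\<^sub>2 = xi i\<^sub>2 \<odot> (xi i\<^sub>1 \<star> idt H\<^sub>2)"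
proof -
  have "xi (product_cell i\<^sub>1 i\<^sub>2) \<odot> asc F H\<^sub>1 H\<^sub>2 = (counitL F \<odot> (idt F \<star> idt G \<star> xi i\<^sub>2)) \<odot>
      (idt F \<star> asc G F H\<^sub>2) \<odot> (idt F \<star> i\<^sub>1 \<star> idt H\<^sub>2) \<odot> asc F H\<^sub>1 H\<^sub>2"
    by (simp add: product_cell_eq xi_def[of "_ \<odot> _"] whisker_left vc_assoc)
  also have "\<dots> = xi i\<^sub>2 \<odot> counitL (F \<bowtie> H\<^sub>2) \<odot>
      (idt F \<star> asc G F H\<^sub>2) \<odot> (idt F \<star> i\<^sub>1 \<star> idt H\<^sub>2) \<odot> asc F H\<^sub>1 H\<^sub>2"
    by (simp add: counitL_nat[of "xi i\<^sub>2" "F \<bowtie> H\<^sub>2" F] vc_assoc)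
  also have "\<dots> = xi i\<^sub>2 \<odot> (counitL (F \<bowtie> H\<^sub>2) \<odot>
      (idt F \<star> asc G F H\<^sub>2) \<odot> asc F S H\<^sub>2) \<odot> ((idt F \<star> i\<^sub>1) \<star> idt H\<^sub>2)"
    using asc_whisker2[of i\<^sub>1 H\<^sub>1 S F H\<^sub>2] by (simp add: vc_assoc)
  also have "\<dots> = xi i\<^sub>2 \<odot> (xi i\<^sub>1 \<star> idt H\<^sub>2)"
    by (simp add: counitL_hc1 xi_def[of i\<^sub>1] whisker_right)
  finally show ?thesis .
qed

definition "xi_product_inverse = asc F H\<^sub>1 H\<^sub>2 \<odot> (x\<^sub>1 \<star> idt H\<^sub>2) \<odot> x\<^sub>2"

lemma inv_pair_xi_product: "inv_pair (xi (product_cell i\<^sub>1 i\<^sub>2)) xi_product_inverse"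
  unfolding xi_product_inverse_def
proof (rule inv_pair_shift[OF _ inv_pair_asc])
  show "inv_pair (xi (product_cell i\<^sub>1 i\<^sub>2) \<odot> asc F H\<^sub>1 H\<^sub>2) ((x\<^sub>1 \<star> idt H\<^sub>2) \<odot> x\<^sub>2)"
    unfolding xi_product by (intro inv_pair_vc inv_pair_wr o1 o2) simp_all
qed simp_all

text \<open>After composition with the inverse of \<open>x\<^sub>2\<close>, both sides become the coaction of \<open>i\<^sub>1\<close> whiskered with \<open>H\<^sub>2\<close> and
followed by \<open>C \<bowtie> xi i\<^sub>2\<close>. On the left this is \<open>product_cell_eq\<close> and the pentagon. On the right, \<open>i\<^sub>2\<close> is the
transpose of \<open>xi i\<^sub>2\<close>, so \<open>unitR_unitL\<close> exposes \<open>unitR F\<close>, which together with \<open>Gamma_cell i\<^sub>1 x\<^sub>1\<close> forms the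
coaction.\<close>

lemma theta_product: "asci F G F \<odot> theta (product_cell i\<^sub>1 i\<^sub>2) xi_product_inverse
    = (Gamma_cell i\<^sub>1 x\<^sub>1 \<star> idt F) \<odot> asci F G F \<odot> theta i\<^sub>2 x\<^sub>2"
proof -
  define g where "g = Gamma_cell i\<^sub>1 x\<^sub>1"
  have g [simp]: "ok2 g" "dom g = C" "cod g = C"
    using Gamma_cell_simps[OF o1] by (simp_all add: g_def)
  note t1 [simp] = theta_simps[OF o1]
  have L: "asci F G F \<odot> (idt F \<star> product_cell i\<^sub>1 i\<^sub>2) \<odot> asc F H\<^sub>1 H\<^sub>2 =
      (idt C \<star> xi i\<^sub>2) \<odot> asc C F H\<^sub>2 \<odot> ((asci F G F \<odot> (idt F \<star> i\<^sub>1)) \<star> idt H\<^sub>2)"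
  proof -
    have "asci F G F \<odot> (idt F \<star> product_cell i\<^sub>1 i\<^sub>2) \<odot> asc F H\<^sub>1 H\<^sub>2 =
       (asci F G F \<odot> (idt F \<star> idt G \<star> xi i\<^sub>2)) \<odot> (idt F \<star> asc G F H\<^sub>2) \<odot>
       (idt F \<star> i\<^sub>1 \<star> idt H\<^sub>2) \<odot> asc F H\<^sub>1 H\<^sub>2"
      by (simp add: product_cell_eq whisker_left vc_assoc)
    also have "\<dots> = (idt C \<star> xi i\<^sub>2) \<odot> asci F G (F \<bowtie> H\<^sub>2) \<odot> ((idt F \<star> asc G F H\<^sub>2) \<odot>
       asc F S H\<^sub>2) \<odot> ((idt F \<star> i\<^sub>1) \<star> idt H\<^sub>2)"
      using asc_whisker2[of i\<^sub>1 H\<^sub>1 S F H\<^sub>2] asci_whisker3[of "xi i\<^sub>2" "F \<bowtie> H\<^sub>2" F F G]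
      by (simp add: vc_assoc)
    also have "\<dots> = (idt C \<star> xi i\<^sub>2) \<odot> (asci F G (F \<bowtie> H\<^sub>2) \<odot> asc F G (F \<bowtie> H\<^sub>2)) \<odot>
       asc C F H\<^sub>2 \<odot> (asci F G F \<star> idt H\<^sub>2) \<odot> ((idt F \<star> i\<^sub>1) \<star> idt H\<^sub>2)"
      by (simp add: pentagon_right[symmetric] vc_assoc del: constraint_inverse)
    finally show ?thesis by (simp add: whisker_right)
  qed
  have R: "(g \<star> idt F) \<odot> asci F G F \<odot> (idt F \<star> i\<^sub>2) = (idt C \<star> xi i\<^sub>2) \<odot> asc C F H\<^sub>2 \<odot> (twist g \<star> idt H\<^sub>2)"
  proof -
    have "(g \<star> idt F) \<odot> asci F G F \<odot> (idt F \<star> i\<^sub>2) =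
        (g \<star> idt F) \<odot> (asci F G F \<odot> (idt F \<star> idt G \<star> xi i\<^sub>2)) \<odot> (idt F \<star> unitL H\<^sub>2)"
      by (subst transpose_xi[OF o2(1), symmetric]) (simp add: whisker_left vc_assoc)
    also have "\<dots> = ((g \<star> idt F) \<odot> (idt C \<star> xi i\<^sub>2)) \<odot> (asci F G (F \<bowtie> H\<^sub>2) \<odot> asc F G (F \<bowtie> H\<^sub>2)) \<odot>
        asc C F H\<^sub>2 \<odot> (unitR F \<star> idt H\<^sub>2)"
      using asci_whisker3[of "xi i\<^sub>2" "F \<bowtie> H\<^sub>2" F F G]
      by (simp add: vc_assoc unitR_unitL[symmetric] del: constraint_inverse)
    also have "\<dots> = (idt C \<star> xi i\<^sub>2) \<odot> ((g \<star> idt (F \<bowtie> H\<^sub>2)) \<odot> asc C F H\<^sub>2) \<odot> (unitR F \<star> idt H\<^sub>2)"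
      using slide[of g "xi i\<^sub>2" C "F \<bowtie> H\<^sub>2" C F, THEN vc_eq_extend] by (simp add: vc_assoc)
    also have "\<dots> = (idt C \<star> xi i\<^sub>2) \<odot> asc C F H\<^sub>2 \<odot> ((g \<star> idt F) \<star> idt H\<^sub>2) \<odot> (unitR F \<star> idt H\<^sub>2)"
      using asc_whisker1[of g C C F H\<^sub>2, THEN vc_eq_extend] by (simp add: vc_assoc)
    finally show ?thesis
      by (simp add: twist_def whisker_right)
  qed
  have "asci F G F \<odot> theta (product_cell i\<^sub>1 i\<^sub>2) xi_product_inverse =
      (asci F G F \<odot> (idt F \<star> product_cell i\<^sub>1 i\<^sub>2) \<odot> asc F H\<^sub>1 H\<^sub>2) \<odot> (x\<^sub>1 \<star> idt H\<^sub>2) \<odot> x\<^sub>2"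
    by (simp add: theta_def xi_product_inverse_def vc_assoc)
  also have "\<dots> = (idt C \<star> xi i\<^sub>2) \<odot> asc C F H\<^sub>2 \<odot> (twist g \<star> idt H\<^sub>2) \<odot> x\<^sub>2"
    unfolding L by (simp add: g_def twist_Gamma_cell[OF o1] theta_def whisker_right vc_assoc)
  also have "\<dots> = ((g \<star> idt F) \<odot> asci F G F \<odot> (idt F \<star> i\<^sub>2)) \<odot> x\<^sub>2"
    unfolding R by (simp add: vc_assoc)
  finally show ?thesis
    by (simp add: g_def theta_def vc_assoc)
qed

lemma Gamma_product: "Gamma_cell (product_cell i\<^sub>1 i\<^sub>2) xi_product_inverse
    = Gamma_cell i\<^sub>1 x\<^sub>1 \<odot> Gamma_cell i\<^sub>2 x\<^sub>2"
proof (rule twist_inj[of _ _ C])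
  note [simp] = Gamma_cell_simps[OF o1] Gamma_cell_simps[OF o2]
      Gamma_cell_simps[OF over_product inv_pair_xi_product]
  show "twist (Gamma_cell (product_cell i\<^sub>1 i\<^sub>2) xi_product_inverse) =
      twist (Gamma_cell i\<^sub>1 x\<^sub>1 \<odot> Gamma_cell i\<^sub>2 x\<^sub>2)"
    by (simp add: twist_vc twist_Gamma_cell[OF o2] twist_Gamma_cell[OF over_product
        inv_pair_xi_product] theta_product)
qed (simp_all add: Gamma_cell_simps[OF o1] Gamma_cell_simps[OF o2]
    Gamma_cell_simps[OF over_product inv_pair_xi_product])

end

end

section \<open>Consequences of separability\<close>

locale separable_cells = adjoint_cells +
  fixes ret
  assumes ret [simp]: "ok2 ret" "dom ret = S" "cod ret = unit1 a"
    and ret_eta: "ret \<odot> eta = idt (unit1 a)"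
begin

text \<open>A retraction of \<open>eta\<close> induces a retraction of \<open>unitL\<close> that is natural in \<open>X\<close>.\<close>

definition "retL X = lu X \<odot> (ret \<star> idt X) \<odot> asci G F X"

lemma retL_simps [simp]:
  "\<lbrakk>ok1 X; trg X = a\<rbrakk> \<Longrightarrow> ok2 (retL X)" "\<lbrakk>ok1 X; trg X = a\<rbrakk> \<Longrightarrow> dom (retL X) = G \<bowtie> F \<bowtie> X"
  "\<lbrakk>ok1 X; trg X = a\<rbrakk> \<Longrightarrow> cod (retL X) = X"
  by (simp_all add: retL_def)

lemma retL_unitL [simp]:
  assumes "ok1 X" "trg X = a" shows "retL X \<odot> unitL X = idt X"
proof -
  have "retL X \<odot> unitL X = lu X \<odot> (ret \<star> idt X) \<odot> (asci G F X \<odot> asc G F X) \<odot> (eta \<star> idt X) \<odot> lui X"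
    by (simp add: retL_def unitL_def vc_assoc)
  also have "\<dots> = lu X \<odot> ((ret \<odot> eta) \<star> idt X) \<odot> lui X"
    using assms by (simp add: whisker_right vc_assoc)
  finally show ?thesis
    using assms by (simp add: ret_eta)
qed

lemma retL_nat:
  assumes "ok2 A" "dom A = X" "cod A = X'" "trg X = a"
  shows "retL X' \<odot> (idt G \<star> idt F \<star> A) = A \<odot> retL X"
proof -
  have "retL X' \<odot> (idt G \<star> idt F \<star> A) = lu X' \<odot> (ret \<star> idt X') \<odot> (idt S \<star> A) \<odot> asci G F X"
    using assms asci_whisker3[of A X X' G F] by (simp add: retL_def vc_assoc)
  also have "\<dots> = lu X' \<odot> (idt (unit1 a) \<star> A) \<odot> (ret \<star> idt X) \<odot> asci G F X"
    using assms slide[of ret A S X "unit1 a" X', symmetric, THEN vc_eq_extend]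
    by (simp add: vc_assoc)
  also have "\<dots> = A \<odot> retL X"
    using assms lu_nat[of A X X' a, THEN vc_eq_extend]
    by (simp add: retL_def vc_assoc)
  finally show ?thesis .
qed

text \<open>By \<open>inverse_xi_over\<close>, \<open>i\<close> followed by \<open>G \<bowtie> x\<close> is the unit at \<open>H\<close>, which the retraction splits.\<close>

lemma over_split:
  assumes "over H i" "inv_pair (xi i) x"
  shows "(retL H \<odot> (idt G \<star> x)) \<odot> i = idt H"
  using overD[OF assms(1)] by (simp add: vc_assoc inverse_xi_over[OF assms])

lemma over_mono:
  assumes "over H i" "inv_pair (xi i) x" "i \<odot> u = i \<odot> v" "ok2 u" "ok2 v" "cod u = H" "cod v = H"
  shows "u = v"
proof -
  have "((retL H \<odot> (idt G \<star> x)) \<odot> i) \<odot> u = ((retL H \<odot> (idt G \<star> x)) \<odot> i) \<odot> v"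
    by (simp only: vc_assoc assms(3))
  then show ?thesis
    using assms(4-7) by (simp add: over_split[OF assms(1,2)])
qed

text \<open>If the coactions agree, \<open>y \<odot> xi i\<close> from \<open>F \<bowtie> H\<close> to \<open>F \<bowtie> J\<close> is compatible with \<open>F \<bowtie> i\<close> and \<open>F \<bowtie> j\<close>. The retraction
turns an arrow \<open>F \<bowtie> H \<rightarrow> F \<bowtie> J\<close> into an arrow \<open>H \<rightarrow> J\<close>, and by naturality the result is compatible with
\<open>i\<close> and \<open>j\<close>.\<close>

lemma theta_eq_factor:
  assumes "over H i" "inv_pair (xi i) x" "over J j" "inv_pair (xi j) y" "theta i x = theta j y"
  obtains \<phi> where "ok2 \<phi>" "dom \<phi> = H" "cod \<phi> = J" "j \<odot> \<phi> = i"
proof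
  note [simp] = overD[OF assms(1)] xi_simps[OF assms(1)] overD[OF assms(3)] xi_simps[OF assms(3)]
  have [simp]: "ok2 y" "dom y = F" "cod y = F \<bowtie> J" "ok2 x" "dom x = F" "cod x = F \<bowtie> H"
     and x: "x \<odot> xi i = idt (F \<bowtie> H)"
    using inv_pair_D[OF assms(2)] inv_pair_D[OF assms(4)] by simp_all
  have fj: "(idt F \<star> j) \<odot> y \<odot> xi i = idt F \<star> i"
  proof -
    have "(idt F \<star> j) \<odot> y \<odot> xi i = theta i x \<odot> xi i"
      by (simp only: assms(5)) (simp add: theta_def vc_assoc)
    then show ?thesis by (simp add: theta_def vc_assoc x)
  qed
  let ?f = "retL J \<odot> (idt G \<star> (y \<odot> xi i)) \<odot> unitL H"
  show "ok2 ?f" "dom ?f = H" "cod ?f = J"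
    by simp_all
  have "j \<odot> ?f = retL S \<odot> (idt G \<star> idt F \<star> j) \<odot> (idt G \<star> (y \<odot> xi i)) \<odot> unitL H"
    using retL_nat[of j J S, THEN vc_eq_extend] by (simp add: vc_assoc)
  also have "\<dots> = retL S \<odot> (idt G \<star> idt F \<star> i) \<odot> unitL H"
    by (simp add: fj flip: vc_assoc[of "idt G \<star> idt F \<star> j"] whisker_left)
  also have "\<dots> = i"
    using retL_nat[of i H S, THEN vc_eq_extend] by (simp add: vc_assoc)
  finally show "j \<odot> ?f = i" .
qed

lemma theta_eq_iso:
  assumes "over H i" "inv_pair (xi i) x" "over J j" "inv_pair (xi j) y" "theta i x = theta j y"
  obtains \<phi> \<phi>' where "inv_pair \<phi> \<phi>'" "dom \<phi> = H" "cod \<phi> = J" "i = j \<odot> \<phi>"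
proof -
  note [simp] = overD[OF assms(1)] overD[OF assms(3)]
  obtain f where f: "ok2 f" "dom f = H" "cod f = J" "j \<odot> f = i"
    using theta_eq_factor[OF assms] .
  obtain g where g: "ok2 g" "dom g = J" "cod g = H" "i \<odot> g = j"
    using theta_eq_factor[OF assms(3,4,1,2) assms(5)[symmetric]] .
  have "i \<odot> g \<odot> f = i \<odot> idt H" "j \<odot> f \<odot> g = j \<odot> idt J"
    using f g by (simp_all flip: vc_assoc)
  then have "g \<odot> f = idt H" "f \<odot> g = idt J"
    using over_mono[OF assms(1,2), of "g \<odot> f" "idt H"] over_mono[OF assms(3,4), of "f \<odot> g" "idt J"] f g
    by simp_all
  then have "inv_pair f g"
    using f g by (simp add: inv_pair_def)
  then show ?thesis
    using that f by auto
qed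

context
  fixes t assumes t: "coalgebra t"
begin

text \<open>The 1-cell belonging to a coalgebra structure \<open>t\<close> is the equaliser of \<open>unitL S\<close> and \<open>G \<bowtie> t\<close>. The retraction
makes this a split equaliser, namely the splitting of \<open>idem\<close>; by \<open>coalgebra_idem\<close> the arrow \<open>idem\<close> equalises
the two.\<close>

definition "idem = retL S \<odot> (idt G \<star> t)"

lemma coalgebra_simps [simp]:
  "ok2 t" "dom t = F" "cod t = F \<bowtie> S" "counitL F \<odot> t = idt F"
  and coalgebra_coassoc: "(idt F \<star> idt G \<star> t) \<odot> t = (idt F \<star> unitL S) \<odot> t"
  using t by (auto simp: coalgebra_def)

lemma idem_simps [simp]: "ok2 idem" "dom idem = S" "cod idem = S"
  by (simp_all add: idem_def)

lemma coalgebra_idem: "(idt G \<star> t) \<odot> idem = unitL S \<odot> idem"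
proof -
  have "(idt G \<star> t) \<odot> idem = retL (G \<bowtie> F \<bowtie> S) \<odot> (idt G \<star> ((idt F \<star> idt G \<star> t) \<odot> t))"
    using retL_nat[of "idt G \<star> t" S "G \<bowtie> F \<bowtie> S", THEN vc_eq_extend]
    by (simp add: idem_def vc_assoc whisker_left)
  also have "\<dots> = unitL S \<odot> idem"
    using retL_nat[of "unitL S" S "G \<bowtie> F \<bowtie> S", THEN vc_eq_extend]
    by (simp add: coalgebra_coassoc idem_def whisker_left vc_assoc)
  finally show ?thesis .
qed

lemma idem_idem: "idem \<odot> idem = idem"
proof -
  have "idem \<odot> idem = retL S \<odot> (idt G \<star> t) \<odot> idem"
    by (subst idem_def) (simp add: vc_assoc)
  also have "\<dots> = (retL S \<odot> unitL S) \<odot> idem"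
    by (simp only: coalgebra_idem vc_assoc)
  finally show ?thesis by simp
qed

text \<open>Every functor preserves split equalisers. After whiskering with \<open>F\<close> the equaliser diagram is the one that
exhibits the coalgebra \<open>F\<close> as the equaliser of its cofree resolution, so \<open>F \<bowtie> H\<close> is isomorphic to \<open>F\<close>.\<close>

lemma split_idem:
  assumes H [simp]: "ok1 H" "src H = a" "trg H = a" and r [simp]: "ok2 r" "dom r = S" "cod r = H"
    and s [simp]: "ok2 s" "dom s = H" "cod s = S" and sr: "s \<odot> r = idem" and rs: "r \<odot> s = idt H"
  shows "over H s" "inv_pair (xi s) ((idt F \<star> r) \<odot> t)" "theta s ((idt F \<star> r) \<odot> t) = t"
proof -
  show o: "over H s" by (simp add: over_def)
  \<comment> \<open>The coaction factors through the splitting.\<close>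
  have et: "(idt F \<star> idem) \<odot> t = t"
  proof -
    have "(idt F \<star> idem) \<odot> t = (idt F \<star> (retL S \<odot> unitL S)) \<odot> t"
      by (simp add: idem_def whisker_left vc_assoc coalgebra_coassoc del: retL_unitL)
    then show ?thesis by simp
  qed
  show th: "theta s ((idt F \<star> r) \<odot> t) = t"
    by (simp add: theta_def et sr flip: vc_assoc whisker_left)
  have s_eq: "idem \<odot> s = s"
    by (simp add: sr[symmetric] vc_assoc rs)
  have ts: "(idt G \<star> t) \<odot> s = unitL S \<odot> s"
    using coalgebra_idem by (metis s_eq vc_assoc)
  have "xi s \<odot> (idt F \<star> r) \<odot> t = counitL F \<odot> theta s ((idt F \<star> r) \<odot> t)"
    by (simp add: xi_def theta_def vc_assoc)
  then have 1: "xi s \<odot> (idt F \<star> r) \<odot> t = idt F"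
    by (simp add: th)
  have "((idt F \<star> r) \<odot> t) \<odot> xi s = (idt F \<star> r) \<odot> (t \<odot> counitL F) \<odot> (idt F \<star> s)"
    by (simp add: xi_def vc_assoc)
  also have "\<dots> = (idt F \<star> r) \<odot> counitL (F \<bowtie> S) \<odot> (idt F \<star> ((idt G \<star> t) \<odot> s))"
    using counitL_nat[of t F "F \<bowtie> S", THEN vc_eq_extend] by (simp add: vc_assoc whisker_left)
  also have "\<dots> = (idt F \<star> r) \<odot> (counitL (F \<bowtie> S) \<odot> (idt F \<star> unitL S)) \<odot> (idt F \<star> s)"
    by (simp add: ts whisker_left vc_assoc)
  also have "\<dots> = idt (F \<bowtie> H)"
    by (simp add: counitL_unitL rs flip: whisker_left)
  finally show "inv_pair (xi s) ((idt F \<star> r) \<odot> t)"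
    unfolding inv_pair_def using 1 xi_simps[OF o] by simp
qed

end

end

section \<open>The isomorphism for the left-hand condition\<close>

text \<open>If the elements of \<open>M\<close> are the fibres of a surjective \<open>\<gamma>\<close> onto a monoid \<open>E\<close>, and \<open>M\<close> multiplies fibres as \<open>E\<close>
multiplies values, the monoid laws hold in \<open>M\<close> because they hold in \<open>E\<close>. For the monoid \<open>I\<^sup>l\<close> this shows in
particular that products of classes are well defined and associative.\<close>

lemma monoid_isomorphism_fibres:
  fixes E :: "'e monoid" and M :: "'p set monoid" and \<gamma> :: "'p \<Rightarrow> 'e" and R :: "'p set"
  defines "fib \<equiv> \<lambda>c. {p \<in> R. \<gamma> p = c}"
  assumes E: "monoid E" and im: "\<gamma> ` R = carrier E"
    and M: "carrier M = {fib (\<gamma> p) | p. p \<in> R}" "\<one>\<^bsub>M\<^esub> = fib \<one>\<^bsub>E\<^esub>"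
    and mult: "\<And>X Y. mult M X Y = (\<Union>p\<in>X. \<Union>q\<in>Y. K p q)"
    and K: "\<And>p q. \<lbrakk>p \<in> R; q \<in> R\<rbrakk> \<Longrightarrow> K p q = fib (\<gamma> p \<otimes>\<^bsub>E\<^esub> \<gamma> q)"
  shows "\<forall>X \<in> carrier M. \<forall>p \<in> X. the_elem (\<gamma> ` X) = \<gamma> p"
    "monoid_isomorphism M E (\<lambda>X. the_elem (\<gamma> ` X))"
proof -
  interpret E: monoid E by fact
  have carrier: "carrier M = fib ` carrier E"
    unfolding M(1) im[symmetric] by auto
  have ne: "\<exists>p \<in> R. \<gamma> p = c" if "c \<in> carrier E" for c
    using that im by (metis imageE)
  have img: "\<gamma> ` fib c = {c}" if "c \<in> carrier E" for c
    using ne[OF that] by (auto simp: fib_def)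
  then have val: "the_elem (\<gamma> ` fib c) = c" if "c \<in> carrier E" for c
    using that by simp
  have prod: "fib c \<otimes>\<^bsub>M\<^esub> fib d = fib (c \<otimes>\<^bsub>E\<^esub> d)" if "c \<in> carrier E" "d \<in> carrier E" for c d
  proof -
    have "fib c \<otimes>\<^bsub>M\<^esub> fib d = (\<Union>p\<in>fib c. \<Union>q\<in>fib d. fib (c \<otimes>\<^bsub>E\<^esub> d))"
      unfolding mult by (intro SUP_cong refl) (auto simp: fib_def K)
    then show ?thesis
      using ne[OF that(1)] ne[OF that(2)] by (auto simp: fib_def)
  qed
  show "\<forall>X \<in> carrier M. \<forall>p \<in> X. the_elem (\<gamma> ` X) = \<gamma> p"
    unfolding carrier using val by (auto simp: fib_def)
  have "monoid M"
    by (rule monoidI) (auto simp: carrier M(2) prod E.m_assoc)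
  moreover have "(\<lambda>X. the_elem (\<gamma> ` X)) \<in> hom M E"
    by (auto simp: hom_def carrier prod val)
  moreover have "bij_betw (\<lambda>X. the_elem (\<gamma> ` X)) (carrier M) (carrier E)"
    by (rule bij_betwI[where g = fib]) (auto simp: carrier val)
  ultimately show "monoid_isomorphism M E (\<lambda>X. the_elem (\<gamma> ` X))"
    using E by (simp add: monoid_isomorphism_def iso_def M(2) val)
qed

lemma endo_cat_simps [simp]:
  "Ob (endo_cat B x) = one_cells B x x" "Hom (endo_cat B x) = two_cells B"
  "Id (endo_cat B x) = id2 B" "Comp (endo_cat B x) = vcomp B" "Tensor (endo_cat B x) = hcomp1 B"
  "Tensor_arr (endo_cat B x) = hcomp2 B" "Unit (endo_cat B x) = id1 B x"
  by (simp_all add: endo_cat_def)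

context adjoint_cells
begin

lemma comonoid_endo_idt: "comonoid_endo (idt C)"
  by (simp add: comonoid_endo_def)

lemma comonoid_endo_vc:
  assumes "comonoid_endo g" "comonoid_endo g'"
  shows "comonoid_endo (g \<odot> g')"
proof -
  have g [simp]: "ok2 g" "dom g = C" "cod g = C" "ok2 g'" "dom g' = C" "cod g' = C"
    and e: "eps \<odot> g = eps" "eps \<odot> g' = eps"
    and c: "comult \<odot> g = (g \<star> g) \<odot> comult" "comult \<odot> g' = (g' \<star> g') \<odot> comult"
    using assms by (auto simp: comonoid_endo_def)
  have "eps \<odot> g \<odot> g' = eps"
    by (simp add: e flip: vc_assoc)
  moreover have "comult \<odot> g \<odot> g' = ((g \<star> g) \<odot> (g' \<star> g')) \<odot> comult"
    by (simp add: c vc_assoc c(1)[THEN vc_eq_extend])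
  ultimately show ?thesis
    by (simp add: comonoid_endo_def hc2_vc)
qed

end

locale bicategorical_adjunction = bicategory B
  for B :: "('o, 'm, 'c, 'z) bicat_data_scheme" (structure) +
  fixes a b :: 'o and f fs :: 'm and \<eta> \<epsilon> :: 'c
  assumes adj: "adjunction B a b f fs \<eta> \<epsilon>"
begin

lemma adjunction_cells [simp]:
  "a \<in> zero_cells B" "b \<in> zero_cells B" "f \<in> one_cells B a b" "fs \<in> one_cells B b a"
  "\<eta> \<in> two_cells B (id1 B a) (fs \<otimes>\<^sub>1 f)" "\<epsilon> \<in> two_cells B (f \<otimes>\<^sub>1 fs) (id1 B b)"
  "f \<otimes>\<^sub>1 fs \<in> one_cells B b b"
      "fs \<otimes>\<^sub>1 f \<in> one_cells B a a" "id1 B a \<in> one_cells B a a" "id1 B b \<in> one_cells B b b"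
  using adj hcomp1_cell[of a b a f fs] hcomp1_cell[of b a b fs f] id1_cell by (auto simp: adjunction_def)

sublocale adjoint_cells B a b "One a b f" "One b a fs"
  "Two (unit1 a) (One b a fs \<bowtie> One a b f) \<eta>" "Two (One a b f \<bowtie> One b a fs) (unit1 b) \<epsilon>"
proof unfold_locales
  let ?F = "One a b f" and ?G = "One b a fs"
  let ?e = "Two (unit1 a) (?G \<bowtie> ?F) \<eta>" and ?c = "Two (?F \<bowtie> ?G) (unit1 b) \<epsilon>"
  have e: "ok2 ?e" and c: "ok2 ?c"
    by (simp_all add: ok2_Two val2_constraint)
  show "ok2 ?e" "ok2 ?c" using e c .
  show "lu ?F \<odot> (?c \<star> idt ?F) \<odot> asci ?F ?G ?F \<odot> (idt ?F \<star> ?e) \<odot> rui ?F = idt ?F"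
    by (rule cell2_eqI) (use adj e c in \<open>simp_all add: val2_simps adjunction_def\<close>)
  show "ru ?G \<odot> (idt ?G \<star> ?c) \<odot> asc ?G ?F ?G \<odot> (?e \<star> idt ?G) \<odot> lui ?G = idt ?G"
    by (rule cell2_eqI) (use adj e c in \<open>simp_all add: val2_simps adjunction_def\<close>)
qed simp_all

abbreviation "FF \<equiv> One a b f"
abbreviation "GG \<equiv> One b a fs"
abbreviation "M \<equiv> adj_monoid B f fs \<eta> \<epsilon>"
abbreviation "K \<equiv> adj_comonoid B a f fs \<eta> \<epsilon>"

definition "cell = (\<lambda>(h, i). Two (One a a h) (GG \<bowtie> FF) i)"

lemma over_cell: "over (One a a h) (cell (h, i)) \<longleftrightarrow> h \<in> one_cells B a a \<and> i \<in> two_cells B h (fs \<otimes>\<^sub>1 f)"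
  by (auto simp: over_def cell_def ok2_Two hc1_def)

lemma val2_mult_cell: "val2 mult_cell = mon_mult M"
  by (simp add: mult_cell_def counitL_def whisker_left adj_monoid_def vc_assoc val2_simps)

lemma val2_comult: "val2 comult = comon_comult K"
  by (simp add: comult_def unitR_def whisker_right adj_comonoid_def vc_assoc val2_simps)

lemma val2_xi:
  assumes "over (One a a h) (cell (h, i))"
  shows "val2 (xi (cell (h, i))) = xi_l B f fs \<epsilon> i"
  using overD[OF assms] by (simp add: xi_def counitL_def xi_l_def vc_assoc val2_simps) (simp add: cell_def)

lemma xi_cell:
  assumes "over (One a a h) (cell (h, i))"
  shows "xi (cell (h, i)) = Two (One a b (f \<otimes>\<^sub>1 h)) FF (xi_l B f fs \<epsilon> i)"
  using xi_simps[OF assms] val2_xi[OF assms] by (cases "xi (cell (h, i))") (auto simp: hc1_def)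

lemma inv2_xi:
  assumes "over (One a a h) (cell (h, i))" "inv_pair (xi (cell (h, i))) x"
  shows "inv2 B (f \<otimes>\<^sub>1 h) f (xi_l B f fs \<epsilon> i) = val2 x"
proof (rule inv2_eq[of a b])
  show 1: "f \<otimes>\<^sub>1 h \<in> one_cells B a b"
    using assms(1) over_cell hcomp1_cell[of a a b h f] by simp
  have "inv_pair (Two (One a b (f \<otimes>\<^sub>1 h)) FF (xi_l B f fs \<epsilon> i)) (Two FF (One a b (f \<otimes>\<^sub>1 h)) (val2 x))"
    using assms(2) unfolding xi_cell[OF assms(1)] by (metis inv_pair_collapse)
  then show "inverse_arrows (hom_cat B a b) (f \<otimes>\<^sub>1 h) f (xi_l B f fs \<epsilon> i) (val2 x)"
    using 1 by (subst (asm) inv_pair_Two) simp_all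
qed simp_all

lemma val2_Gamma_cell:
  assumes "over (One a a h) (cell (h, i))" "inv_pair (xi (cell (h, i))) x"
  shows "val2 (Gamma_cell (cell (h, i)) x) = Gamma_l_rep B f fs \<epsilon> (h, i)"
proof -
  have [simp]: "ok2 x" "dom x = FF" "cod x = FF \<bowtie> One a a h"
    using inv_pair_D[OF assms(2)] xi_simps[OF assms(1)] by simp_all
  show ?thesis
    using overD[OF assms(1)]
    by (simp add: Gamma_cell_def theta_def counitR_def Gamma_l_rep_def
        whisker_right vc_assoc val2_simps inv2_xi[OF assms])
      (simp add: cell_def)
qed

lemma Gamma_cell_eq:
  assumes "over (One a a h) (cell (h, i))" "inv_pair (xi (cell (h, i))) x"
  shows "Gamma_cell (cell (h, i)) x = Two (FF \<bowtie> GG) (FF \<bowtie> GG) (Gamma_l_rep B f fs \<epsilon> (h, i))"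
  using Gamma_cell_simps[OF assms] val2_Gamma_cell[OF assms] by (cases "Gamma_cell (cell (h, i)) x") auto

lemma comonoid_endos_iff:
  "c \<in> comonoid_endos (endo_cat B b) K \<longleftrightarrow> comonoid_endo (Two (FF \<bowtie> GG) (FF \<bowtie> GG) c)" (is "_ \<longleftrightarrow> comonoid_endo ?g")
proof -
  have "c \<in> two_cells B (f \<otimes>\<^sub>1 fs) (f \<otimes>\<^sub>1 fs) \<longleftrightarrow> ok2 ?g"
    by (simp add: ok2_Two hc1_def)
  moreover have "comult \<odot> ?g = (?g \<star> ?g) \<odot> comult \<longleftrightarrow> comon_comult K \<bullet> c = (c \<otimes>\<^sub>2 c) \<bullet> comon_comult K"
    if "ok2 ?g"
  proof -
    have "comult \<odot> ?g = (?g \<star> ?g) \<odot> comult \<longleftrightarrow> val2 (comult \<odot> ?g) = val2 ((?g \<star> ?g) \<odot> comult)"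
      using cell2_eqI[of "comult \<odot> ?g" "(?g \<star> ?g) \<odot> comult"] that by auto
    then show ?thesis
      using that by (simp add: val2_simps val2_comult)
  qed
  moreover have "eps \<odot> ?g = eps \<longleftrightarrow> comon_counit K \<bullet> c = comon_counit K"
    if "ok2 ?g" "eps = Two (FF \<bowtie> GG) (unit1 b) \<epsilon>" for eps
  proof -
    have "eps \<odot> ?g = eps \<longleftrightarrow> val2 (eps \<odot> ?g) = val2 eps"
      using cell2_eqI[of "eps \<odot> ?g" eps] that eps by auto
    then show ?thesis
      using that eps by (simp add: val2_simps adj_comonoid_def)
  qed
  ultimately show ?thesis
    by (auto simp: comonoid_endos_def comonoid_endo_def adj_comonoid_def)
qed

lemma monoid_End: "monoid (End_monoid (endo_cat B b) K)"
proof (rule monoidI)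
  let ?E = "End_monoid (endo_cat B b) K"
  interpret H: category "hom_cat B b b" by (rule hom_category) simp_all
  have k: "comon_obj K = f \<otimes>\<^sub>1 fs" by (simp add: adj_comonoid_def)
  have t: "c \<in> two_cells B (f \<otimes>\<^sub>1 fs) (f \<otimes>\<^sub>1 fs)" if "c \<in> carrier ?E" for c
    using that by (simp add: End_monoid_def comonoid_endos_def k)
  show "c \<otimes>\<^bsub>?E\<^esub> d \<in> carrier ?E" if "c \<in> carrier ?E" "d \<in> carrier ?E" for c d
  proof -
    have "comonoid_endo (Two (FF \<bowtie> GG) (FF \<bowtie> GG) c \<odot> Two (FF \<bowtie> GG) (FF \<bowtie> GG) d)"
      using that by (intro comonoid_endo_vc) (simp_all add: End_monoid_def comonoid_endos_iff)
    then show ?thesis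
      using t[OF that(1)] t[OF that(2)]
      by (simp add: vc_def ok2_Two val2_constraint End_monoid_def comonoid_endos_iff)
  qed
  show "\<one>\<^bsub>?E\<^esub> \<in> carrier ?E"
    using comonoid_endo_idt by (simp add: End_monoid_def comonoid_endos_iff k idt_def val2_constraint)
  show "c \<otimes>\<^bsub>?E\<^esub> d \<otimes>\<^bsub>?E\<^esub> e = c \<otimes>\<^bsub>?E\<^esub> (d \<otimes>\<^bsub>?E\<^esub> e)"
    if "c \<in> carrier ?E" "d \<in> carrier ?E" "e \<in> carrier ?E" for c d e
    using H.Comp_assoc[of "f \<otimes>\<^sub>1 fs" "f \<otimes>\<^sub>1 fs" "f \<otimes>\<^sub>1 fs" "f \<otimes>\<^sub>1 fs" e d c] t that
    by (simp add: End_monoid_def)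
  show "\<one>\<^bsub>?E\<^esub> \<otimes>\<^bsub>?E\<^esub> c = c" "c \<otimes>\<^bsub>?E\<^esub> \<one>\<^bsub>?E\<^esub> = c" if "c \<in> carrier ?E" for c
    using H.Comp_Id[of "f \<otimes>\<^sub>1 fs" "f \<otimes>\<^sub>1 fs" c] H.Id_Comp[of "f \<otimes>\<^sub>1 fs" "f \<otimes>\<^sub>1 fs" c] t that
    by (simp_all add: End_monoid_def k)
qed

end

locale separable_adjunction = bicategorical_adjunction +
  fixes \<rho>
  assumes \<rho>: "\<rho> \<in> two_cells B (fs \<otimes>\<^sub>1 f) (id1 B a)" "\<rho> \<bullet> \<eta> = \<iota> (id1 B a)"
begin

sublocale separable_cells B a b "One a b f" "One b a fs"
  "Two (unit1 a) (One b a fs \<bowtie> One a b f) \<eta>" "Two (One a b f \<bowtie> One b a fs) (unit1 b) \<epsilon>"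
  "Two (One b a fs \<bowtie> One a b f) (unit1 a) \<rho>"
proof unfold_locales
  let ?r = "Two (GG \<bowtie> FF) (unit1 a) \<rho>"
  show r: "ok2 ?r"
    using \<rho> by (simp add: ok2_Two val2_constraint)
  show "?r \<odot> Two (unit1 a) (GG \<bowtie> FF) \<eta> = idt (unit1 a)"
    using r \<rho> eta by (simp add: vc_def idt_def val2_constraint)
qed simp_all

text \<open>The isomorphism condition is translated by \<open>mult_cell_iso_iff\<close>; that \<open>i\<close> is a monomorphism comes from
\<open>over_mono\<close>.\<close>

lemma Il_rep_iff:
  "Il_rep (endo_cat B a) M h i \<longleftrightarrow> over (One a a h) (cell (h, i)) \<and> (\<exists>x. inv_pair (xi (cell (h, i))) x)"
proof (cases "over (One a a h) (cell (h, i))")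
  case True
  have c: "h \<in> one_cells B a a" "i \<in> two_cells B h (fs \<otimes>\<^sub>1 f)" and o: "mon_obj M = fs \<otimes>\<^sub>1 f"
    using True over_cell by (auto simp: adj_monoid_def)
  have "mult_cell \<odot> (idt (GG \<bowtie> FF) \<star> cell (h, i))
      = Two (One a a ((fs \<otimes>\<^sub>1 f) \<otimes>\<^sub>1 h)) (One a a (fs \<otimes>\<^sub>1 f)) (mon_mult M \<bullet> (\<iota> (fs \<otimes>\<^sub>1 f) \<otimes>\<^sub>2 i))"
    by (rule trans[OF cell2_collapse]) (use overD[OF True] in \<open>simp_all
        add: val2_simps val2_mult_cell\<close>, simp add: hc1_def cell_def)
  then have iso: "iso_arrow (endo_cat B a) (mon_obj M \<otimes>\<^sub>1 h) (mon_obj M) (mon_mult M \<bullet> (\<iota> (mon_obj M) \<otimes>\<^sub>2 i))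
     \<longleftrightarrow> (\<exists>x. inv_pair (xi (cell (h, i))) x)"
    unfolding endo_cat_iso_arrow mult_cell_iso_iff[OF True, symmetric] o using c
      hcomp1_cell[of a a a h "fs \<otimes>\<^sub>1 f"]
    by (subst iso_arrow_iff) simp_all
  have "mono_arrow (endo_cat B a) h (mon_obj M) i" if "inv_pair (xi (cell (h, i))) x" for x
    unfolding mono_arrow_def
  proof (intro conjI ballI impI)
    fix k u v assume k: "k \<in> Ob (endo_cat B a)" "u \<in> Hom (endo_cat B a) k h" "v \<in> Hom (endo_cat B a) k h"
      and eq: "Comp (endo_cat B a) i u = Comp (endo_cat B a) i v"
    have "cell (h, i) \<odot> Two (One a a k) (One a a h) u = cell (h, i) \<odot> Two (One a a k) (One a a h) v"
      using k c eq by (simp add: vc_def cell_def ok2_Two)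
    then have "Two (One a a k) (One a a h) u = Two (One a a k) (One a a h) v"
      by (rule over_mono[OF True that]) (use k c in \<open>simp_all add: ok2_Two\<close>)
    then show "u = v" by simp
  qed (use c o in simp_all)
  then show ?thesis
    unfolding Il_rep_def using iso True by auto
next
  case False
  then show ?thesis
    unfolding over_cell by (auto simp: Il_rep_def mono_arrow_def adj_monoid_def)
qed

abbreviation "Gl \<equiv> Gamma_l_rep B f fs \<epsilon>"

text \<open>The classes of subobjects are the fibres of \<open>\<Gamma>\<^sub>f\<close>: the coaction is invariant under isomorphisms over \<open>S\<^sub>f\<close>
(\<open>over_vc\<close>), and representatives with the same coaction are isomorphic (\<open>theta_eq_iso\<close>).\<close>

lemma subobject_class_eq:
  assumes "Il_rep (endo_cat B a) M h i"
  shows "subobject_class (endo_cat B a) (mon_obj M) (h, i) =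
    {p. (case p of (h', i') \<Rightarrow> Il_rep (endo_cat B a) M h' i') \<and> Gl p = Gl (h, i)}"
proof -
  obtain x where o: "over (One a a h) (cell (h, i))" and x: "inv_pair (xi (cell (h, i))) x"
    using assms Il_rep_iff by auto
  have c: "h \<in> one_cells B a a" "i \<in> two_cells B h (fs \<otimes>\<^sub>1 f)" and obj: "mon_obj M = fs \<otimes>\<^sub>1 f"
    using o over_cell by (auto simp: adj_monoid_def)
  have "(k, j) \<in> subobject_class (endo_cat B a) (mon_obj M) (h, i) \<longleftrightarrow>
      Il_rep (endo_cat B a) M k j \<and> Gl (k, j) = Gl (h, i)"
    (is "?l \<longleftrightarrow> ?r") for k j
  proof
    assume ?l
    then obtain \<phi> where k: "k \<in> one_cells B a a" "j \<in> two_cells B k (fs \<otimes>\<^sub>1 f)"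
      and iso: "iso_arrow (hom_cat B a a) k h \<phi>" and j: "j = i \<bullet> \<phi>"
      by (auto simp: subobject_class_def obj endo_cat_iso_arrow)
    obtain p where p: "inv_pair (Two (One a a k) (One a a h) \<phi>) p"
      using iso iso_arrow_iff[of a a k h \<phi>] k c by auto
    have "cell (k, j) = cell (h, i) \<odot> Two (One a a k) (One a a h) \<phi>"
      using inv_pair_D(1)[OF p] overD(4)[OF o] by (simp add: vc_def cell_def j)
    then obtain y where oj: "over (One a a k) (cell (k, j))" and y: "inv_pair (xi (cell (k, j))) y"
      and "theta (cell (k, j)) y = theta (cell (h, i)) x"
      using over_vc[OF o x p] by auto
    then have "Gamma_cell (cell (k, j)) y = Gamma_cell (cell (h, i)) x"
      using Gamma_cell_eq_iff[OF oj y o x] by simp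
    then show ?r
      using Il_rep_iff oj y val2_Gamma_cell[OF oj y] val2_Gamma_cell[OF o x] by auto
  next
    assume ?r
    then obtain y where oj: "over (One a a k) (cell (k, j))" and y: "inv_pair (xi (cell (k, j))) y"
      and "Gl (k, j) = Gl (h, i)"
      using Il_rep_iff by auto
    then have "theta (cell (k, j)) y = theta (cell (h, i)) x"
      using Gamma_cell_eq_iff[OF oj y o x] Gamma_cell_eq[OF oj y] Gamma_cell_eq[OF o x] by simp
    then obtain p p' where p: "inv_pair p p'" "dom p = One a a k" "cod p = One a a h"
      and eq: "cell (k, j) = cell (h, i) \<odot> p"
      by (rule theta_eq_iso[OF oj y o x])
    have pc: "p = Two (One a a k) (One a a h) (val2 p)"
      using inv_pair_D(1)[OF p(1)] p by (cases p) auto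
    have k: "k \<in> one_cells B a a" "j \<in> two_cells B k (fs \<otimes>\<^sub>1 f)"
      using oj over_cell by auto
    have "iso_arrow (hom_cat B a a) k h (val2 p)"
      using iso_arrow_iff[of a a k h "val2 p"] p(1) pc k c by auto
    moreover have "j = i \<bullet> val2 p"
      using arg_cong[OF eq, of val2] inv_pair_D(1)[OF p(1)] overD(4)[OF o] p by (simp add: val2_vc cell_def)
    ultimately show ?l
      using k by (auto simp: subobject_class_def obj endo_cat_iso_arrow)
  qed
  then show ?thesis by auto
qed

lemma Gamma_mult:
  assumes "Il_rep (endo_cat B a) M h i" "Il_rep (endo_cat B a) M k j"
  shows "Il_rep (endo_cat B a) M (h \<otimes>\<^sub>1 k) (mon_mult M \<bullet> (i \<otimes>\<^sub>2 j))"
    "Gl (h \<otimes>\<^sub>1 k, mon_mult M \<bullet> (i \<otimes>\<^sub>2 j)) = Gl (h, i) \<bullet> Gl (k, j)"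
proof -
  obtain x y where o1: "over (One a a h) (cell (h, i))" "inv_pair (xi (cell (h, i))) x"
    and o2: "over (One a a k) (cell (k, j))" "inv_pair (xi (cell (k, j))) y"
    using assms Il_rep_iff by auto
  have hk: "One a a h \<bowtie> One a a k = One a a (h \<otimes>\<^sub>1 k)"
    by (simp add: hc1_def)
  have c: "cell (h \<otimes>\<^sub>1 k, mon_mult M \<bullet> (i \<otimes>\<^sub>2 j)) = product_cell (cell (h, i)) (cell (k, j))"
    by (rule trans[OF _ cell2_collapse[symmetric]])
      (use overD[OF o1(1)] overD[OF o2(1)] in \<open>simp_all add: product_cell_def val2_simps val2_mult_cell\<close>,
        simp add: hc1_def cell_def)
  note o = over_product[OF o1 o2, unfolded hk c[symmetric]]
    and z = inv_pair_xi_product[OF o1 o2, unfolded c[symmetric]]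
  show "Il_rep (endo_cat B a) M (h \<otimes>\<^sub>1 k) (mon_mult M \<bullet> (i \<otimes>\<^sub>2 j))"
    unfolding Il_rep_iff using o z by blast
  show "Gl (h \<otimes>\<^sub>1 k, mon_mult M \<bullet> (i \<otimes>\<^sub>2 j)) = Gl (h, i) \<bullet> Gl (k, j)"
    using arg_cong[OF Gamma_product[OF o1 o2, folded c], of val2] Gamma_cell_simps[OF o1] Gamma_cell_simps[OF o2]
    by (simp add: val2_Gamma_cell[OF o z] val2_Gamma_cell[OF o1] val2_Gamma_cell[OF o2] val2_vc)
qed

lemma Gamma_unit:
  "Il_rep (endo_cat B a) M (id1 B a) \<eta>" "Gl (id1 B a, \<eta>) = \<iota> (f \<otimes>\<^sub>1 fs)"
proof -
  have c: "Two (unit1 a) (GG \<bowtie> FF) \<eta> = cell (id1 B a, \<eta>)" and u: "unit1 a = One a a (id1 B a)"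
    by (simp_all add: cell_def unit1_def)
  note o = over_unit(1)[unfolded c, unfolded u] and x = over_unit(2)[unfolded c]
  show "Il_rep (endo_cat B a) M (id1 B a) \<eta>"
    unfolding Il_rep_iff using o x by blast
  show "Gl (id1 B a, \<eta>) = \<iota> (f \<otimes>\<^sub>1 fs)"
    using arg_cong[OF over_unit(3)[unfolded c], of val2]
    by (simp add: val2_Gamma_cell[OF o x] val2_idt val2_constraint)
qed

text \<open>The coaction twisted by \<open>c\<close> yields an idempotent of the object of \<open>S\<^sub>f\<close>, and a splitting of this idempotent
is the subobject that \<open>\<Gamma>\<^sub>f\<close> maps to \<open>c\<close>.\<close>

lemma Gamma_surj:
  assumes split: "idempotents_split (hom_cat B a a)" and c: "c \<in> comonoid_endos (endo_cat B b) K"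
  shows "\<exists>h i. Il_rep (endo_cat B a) M h i \<and> Gl (h, i) = c"
proof -
  define g where "g = Two (FF \<bowtie> GG) (FF \<bowtie> GG) c"
  define t where "t = asc FF GG FF \<odot> twist g"
  have endo: "comonoid_endo g"
    using c comonoid_endos_iff g_def by simp
  then have g: "ok2 g" "dom g = FF \<bowtie> GG" "cod g = FF \<bowtie> GG"
    by (simp_all add: comonoid_endo_def)
  have t: "coalgebra t"
    using endo comonoid_endo_iff[OF g] t_def by simp
  let ?S = "fs \<otimes>\<^sub>1 f"
  have S: "GG \<bowtie> FF = One a a ?S" by (simp add: hc1_def)
  define e where "e = idem t"
  have e: "ok2 e" "dom e = GG \<bowtie> FF" "cod e = GG \<bowtie> FF" "e \<odot> e = e"
    unfolding e_def by (rule idem_simps[OF t] idem_idem[OF t])+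
  define p where "p = val2 e"
  have ep: "e = Two (One a a ?S) (One a a ?S) p"
    using e(1-3) S by (cases e) (auto simp: p_def)
  have "p \<in> two_cells B ?S ?S" "p \<bullet> p = p"
    using e(1) arg_cong[OF e(4), of val2] e(1-3) unfolding ep by (simp_all add: ok2_Two val2_vc)
  then obtain h r s where h: "h \<in> one_cells B a a" "r \<in> two_cells B ?S h" "s \<in> two_cells B h ?S"
     "s \<bullet> r = p" "r \<bullet> s = \<iota> h"
    using split unfolding idempotents_split_def by force
  let ?r = "Two (One a a ?S) (One a a h) r"
  have s: "cell (h, s) \<odot> ?r = e" "?r \<odot> cell (h, s) = idt (One a a h)"
    using h unfolding ep by (simp_all add: vc_def idt_def ok2_Two cell_def S)
  have sp: "over (One a a h) (cell (h, s))" "inv_pair (xi (cell (h, s))) ((idt FF \<star> ?r) \<odot> t)"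
      "theta (cell (h, s)) ((idt FF \<star> ?r) \<odot> t) = t"
    by (rule split_idem[OF t _ _ _ _ _ _ _ _ _ s[unfolded e_def]]; use h in \<open>simp add: ok2_Two cell_def S\<close>)+
  have "Gamma_cell (cell (h, s)) ((idt FF \<star> ?r) \<odot> t) = counitR (FF \<bowtie> GG) \<odot> (twist g \<star> idt GG)"
    using g twist_simps[OF g(1,2)] unfolding Gamma_cell_def sp(3) by (simp add: t_def flip: vc_assoc)
  also have "\<dots> = g"
    using g by (rule counitR_twist)
  finally have "Gl (h, s) = c"
    using val2_Gamma_cell[OF sp(1,2)] by (simp add: g_def)
  then show ?thesis
    using sp(1,2) Il_rep_iff by blast
qed

lemma Gamma_comonoid_endo:
  assumes "Il_rep (endo_cat B a) M h i"
  shows "Gl (h, i) \<in> comonoid_endos (endo_cat B b) K"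
proof -
  obtain x where o: "over (One a a h) (cell (h, i))" "inv_pair (xi (cell (h, i))) x"
    using assms Il_rep_iff by auto
  show ?thesis
    using comonoid_endo_Gamma_cell[OF o] Gamma_cell_eq[OF o] comonoid_endos_iff by simp
qed

theorem Gamma_l_isomorphism:
  assumes "idempotents_split (hom_cat B a a)"
  shows "\<forall>X \<in> carrier (Il_monoid (endo_cat B a) M). \<forall>p \<in> X. Gamma_l B f fs \<epsilon> X = Gl p"
    "monoid_isomorphism (Il_monoid (endo_cat B a) M) (End_monoid (endo_cat B b) K) (Gamma_l B f fs \<epsilon>)"
proof -
  let ?V = "endo_cat B a" and ?E = "End_monoid (endo_cat B b) K"
  let ?R = "{p. case p of (h, i) \<Rightarrow> Il_rep ?V M h i}"
  let ?cl = "subobject_class ?V (mon_obj M)"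
  have cl: "?cl p = {q \<in> ?R. Gl q = Gl p}" if "p \<in> ?R" for p
    using that subobject_class_eq by (cases p) auto
  have fac: "Gl ` ?R = carrier ?E"
    using Gamma_comonoid_endo Gamma_surj[OF assms] by (auto simp: End_monoid_def image_iff split_beta) metis
  have car: "carrier (Il_monoid ?V M) = {{q \<in> ?R. Gl q = Gl p} | p. p \<in> ?R}"
    using cl by (auto simp: Il_monoid_def) blast+
  have one: "\<one>\<^bsub>Il_monoid ?V M\<^esub> = {q \<in> ?R. Gl q = \<one>\<^bsub>?E\<^esub>}"
    using cl[of "(id1 B a, \<eta>)"] Gamma_unit
        by (simp add: Il_monoid_def End_monoid_def adj_comonoid_def adj_monoid_def)
  let ?K = "\<lambda>p q. ?cl (fst p \<otimes>\<^sub>1 fst q, mon_mult M \<bullet> (snd p \<otimes>\<^sub>2 snd q))"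
  have mult: "mult (Il_monoid ?V M) X Y = (\<Union>p\<in>X. \<Union>q\<in>Y. ?K p q)" for X Y
    by (simp add: Il_monoid_def subobject_mult_def split_beta)
  have K: "?K p q = {r \<in> ?R. Gl r = Gl p \<otimes>\<^bsub>?E\<^esub> Gl q}" if "p \<in> ?R" "q \<in> ?R" for p q
    using that Gamma_mult[of "fst p" "snd p" "fst q" "snd q"]
      cl[of "(fst p \<otimes>\<^sub>1 fst q, mon_mult M \<bullet> (snd p \<otimes>\<^sub>2 snd q))"]
    by (simp add: split_beta End_monoid_def)
  note * = monoid_isomorphism_fibres[OF monoid_End fac car one mult K]
  have G: "Gamma_l B f fs \<epsilon> = (\<lambda>X. the_elem (Gl ` X))"
    by (simp add: fun_eq_iff Gamma_l_def)
  show "\<forall>X \<in> carrier (Il_monoid ?V M). \<forall>p \<in> X. Gamma_l B f fs \<epsilon> X = Gl p"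
    "monoid_isomorphism (Il_monoid ?V M) ?E (Gamma_l B f fs \<epsilon>)"
    unfolding G using * by blast+
qed

end

section \<open>The opposite bicategory\<close>

text \<open>Reversal of the 1-cells. Vertical composition keeps its direction, so that \<open>f\<^sup>*\<close> is left adjoint to \<open>f\<close> in the
opposite bicategory, with the original unit and counit.\<close>

definition op_bicat :: "('o, 'm, 'c, 'z) bicat_data_scheme \<Rightarrow> ('o, 'm, 'c) bicat_data" where
  "op_bicat B = \<lparr>zero_cells = zero_cells B, one_cells = (\<lambda>x y. one_cells B y x),
     two_cells = two_cells B, id2 = id2 B, vcomp = vcomp B, id1 = id1 B,
     hcomp1 = (\<lambda>g f. hcomp1 B f g), hcomp2 = (\<lambda>\<beta> \<alpha>. hcomp2 B \<alpha> \<beta>),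
     assoc = (\<lambda>h g f. assoc_inv B f g h), lunit = runit B, runit = lunit B\<rparr>"

lemma op_bicat_simps [simp]:
  "zero_cells (op_bicat B) = zero_cells B" "one_cells (op_bicat B) x y = one_cells B y x"
  "two_cells (op_bicat B) = two_cells B" "id2 (op_bicat B) = id2 B" "vcomp (op_bicat B) = vcomp B"
  "id1 (op_bicat B) = id1 B" "hcomp1 (op_bicat B) g f = hcomp1 B f g"
  "hcomp2 (op_bicat B) \<beta> \<alpha> = hcomp2 B \<alpha> \<beta>" "assoc (op_bicat B) h g f = assoc_inv B f g h"
  "lunit (op_bicat B) = runit B" "runit (op_bicat B) = lunit B"
  "inv2 (op_bicat B) = inv2 B" "hom_cat (op_bicat B) x y = hom_cat B y x"
  by (simp_all add: op_bicat_def inv2_def hom_cat_def fun_eq_iff)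

context bicategory
begin

lemma inverse_assoc_inv:
  assumes "w \<in> zero_cells B" "x \<in> zero_cells B" "y \<in> zero_cells B" "z \<in> zero_cells B"
    "f \<in> one_cells B w x" "g \<in> one_cells B x y" "h \<in> one_cells B y z"
  shows "inverse_arrows (hom_cat B w z) (h \<otimes>\<^sub>1 g \<otimes>\<^sub>1 f) ((h \<otimes>\<^sub>1 g) \<otimes>\<^sub>1 f) (assoc_inv B h g f) (assoc B h g f)"
proof -
  have c: "h \<otimes>\<^sub>1 g \<otimes>\<^sub>1 f \<in> one_cells B w z" "(h \<otimes>\<^sub>1 g) \<otimes>\<^sub>1 f \<in> one_cells B w z"
    using assms hcomp1_cell by metis+
  have "inv_pair (asci (One y z h) (One x y g) (One w x f)) (asc (One y z h) (One x y g) (One w x f))"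
    by (rule inv_pair_sym[OF inv_pair_asc]) (use assms in simp_all)
  moreover have
    "asci (One y z h) (One x y g) (One w x f)
        = Two (One w z (h \<otimes>\<^sub>1 g \<otimes>\<^sub>1 f)) (One w z ((h \<otimes>\<^sub>1 g) \<otimes>\<^sub>1 f)) (assoc_inv B h g f)"
    "asc (One y z h) (One x y g) (One w x f)
        = Two (One w z ((h \<otimes>\<^sub>1 g) \<otimes>\<^sub>1 f)) (One w z (h \<otimes>\<^sub>1 g \<otimes>\<^sub>1 f)) (assoc B h g f)"
    using assms by (simp_all add: asc_def asci_def hc1_def)
  ultimately show ?thesis
    using inv_pair_Two[OF assms(1,4) c] by simp
qed

lemma assoc_inv_op:
  assumes "w \<in> zero_cells B" "x \<in> zero_cells B" "y \<in> zero_cells B" "z \<in> zero_cells B"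
    "f \<in> one_cells B w x" "g \<in> one_cells B x y" "h \<in> one_cells B y z"
  shows "assoc_inv (op_bicat B) f g h = assoc B h g f"
  unfolding assoc_inv_def[of "op_bicat B"] op_bicat_simps
proof (rule inv2_eq[OF _ _ _ _ inverse_assoc_inv])
  show "h \<otimes>\<^sub>1 g \<otimes>\<^sub>1 f \<in> one_cells B w z" "(h \<otimes>\<^sub>1 g) \<otimes>\<^sub>1 f \<in> one_cells B w z"
    using assms hcomp1_cell by metis+
qed (fact assms)+

lemma bicategory_op_bicat: "bicategory (op_bicat B)"
proof (rule bicategory.intro; unfold op_bicat_simps)
  fix a b c d assume z: "a \<in> zero_cells B" "b \<in> zero_cells B" "c \<in> zero_cells B" "d \<in> zero_cells B"
  fix f g h assume o: "f \<in> one_cells B b a" "g \<in> one_cells B c b" "h \<in> one_cells B d c"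
  show "iso_arrow (hom_cat B d a) (f \<otimes>\<^sub>1 g \<otimes>\<^sub>1 h) ((f \<otimes>\<^sub>1 g) \<otimes>\<^sub>1 h) (assoc_inv B f g h)"
    using inverse_assoc_inv[of d c b a h g f] z o iso_arrow_def by metis
  fix f' g' h' \<alpha> \<beta> \<gamma> assume o': "f' \<in> one_cells B b a" "g' \<in> one_cells B c b" "h' \<in> one_cells B d c"
    and t: "\<alpha> \<in> two_cells B f f'" "\<beta> \<in> two_cells B g g'" "\<gamma> \<in> two_cells B h h'"
  show "assoc_inv B f' g' h' \<bullet> \<alpha> \<otimes>\<^sub>2 \<beta> \<otimes>\<^sub>2 \<gamma> = (\<alpha> \<otimes>\<^sub>2 \<beta>) \<otimes>\<^sub>2 \<gamma> \<bullet> assoc_inv B f g h"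
    using arg_cong[OF asci_nat[of "Two (One b a f) (One b a f') \<alpha>" "Two (One c b g) (One c b g') \<beta>"
        "Two (One d c h) (One d c h') \<gamma>", OF _ _ _ _ _ refl refl refl refl refl refl], of val2] z o o' t
    by (simp add: ok2_Two val2_simps)
next
  fix a b c d e assume z: "a \<in> zero_cells B" "b \<in> zero_cells B" "c \<in> zero_cells B" "d \<in> zero_cells B"
    "e \<in> zero_cells B"
  fix f g h k assume o: "f \<in> one_cells B b a" "g \<in> one_cells B c b" "h \<in> one_cells B d c" "k \<in> one_cells B e d"
  show "assoc_inv B f g h \<otimes>\<^sub>2 \<iota> k \<bullet> assoc_inv B f (g \<otimes>\<^sub>1 h) k \<bullet> \<iota> f \<otimes>\<^sub>2 assoc_inv B g h k =
      assoc_inv B (f \<otimes>\<^sub>1 g) h k \<bullet> assoc_inv B f g (h \<otimes>\<^sub>1 k)"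
    using arg_cong[OF pentagon_inverse[of "One e d k" "One d c h" "One c b g" "One b a f"], of val2] z o
    by (simp add: val2_simps)
next
  fix a b c assume z: "a \<in> zero_cells B" "b \<in> zero_cells B" "c \<in> zero_cells B"
  fix f g assume o: "f \<in> one_cells B b a" "g \<in> one_cells B c b"
  show "runit B f \<otimes>\<^sub>2 \<iota> g \<bullet> assoc_inv B f (id1 B b) g = \<iota> f \<otimes>\<^sub>2 lunit B g"
    using arg_cong[OF triangle_asci[of "One c b g" "One b a f" b], of val2] z o
    by (simp add: val2_simps)
next
  fix a b c assume z: "a \<in> zero_cells B" "b \<in> zero_cells B" "c \<in> zero_cells B"
  fix f f' f'' g g' g'' assume o: "f \<in> one_cells B b a" "f' \<in> one_cells B b a" "f'' \<in> one_cells B b a"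
    "g \<in> one_cells B c b" "g' \<in> one_cells B c b" "g'' \<in> one_cells B c b"
  fix \<alpha> \<alpha>' \<beta> \<beta>' assume t: "\<alpha> \<in> two_cells B f f'" "\<alpha>' \<in> two_cells B f' f''"
    "\<beta> \<in> two_cells B g g'" "\<beta>' \<in> two_cells B g' g''"
  show "(\<alpha>' \<bullet> \<alpha>) \<otimes>\<^sub>2 (\<beta>' \<bullet> \<beta>) = \<alpha>' \<otimes>\<^sub>2 \<beta>' \<bullet> \<alpha> \<otimes>\<^sub>2 \<beta>"
    using interchange[of c b a g g' g'' f f' f'' \<beta> \<beta>' \<alpha> \<alpha>'] z o t by simp
next
  fix a b c assume z: "a \<in> zero_cells B" "b \<in> zero_cells B" "c \<in> zero_cells B"
  fix f f' g g' assume o: "f \<in> one_cells B b a" "f' \<in> one_cells B b a"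
    "g \<in> one_cells B c b" "g' \<in> one_cells B c b"
  fix \<alpha> \<beta> assume t: "\<alpha> \<in> two_cells B f f'" "\<beta> \<in> two_cells B g g'"
  show "\<alpha> \<otimes>\<^sub>2 \<beta> \<in> two_cells B (f \<otimes>\<^sub>1 g) (f' \<otimes>\<^sub>1 g')"
    using hcomp2_cell[of c b a g g' f f' \<beta> \<alpha>] z o t by simp
next
  fix a b c f g assume "a \<in> zero_cells B" "b \<in> zero_cells B" "c \<in> zero_cells B"
    "f \<in> one_cells B b a" "g \<in> one_cells B c b"
  then show "f \<otimes>\<^sub>1 g \<in> one_cells B c a" "\<iota> f \<otimes>\<^sub>2 \<iota> g = \<iota> (f \<otimes>\<^sub>1 g)"
    using hcomp1_cell[of c b a g f] hcomp2_id[of c b a g f] by simp_all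
qed (simp_all add: hom_category id1_cell lunit_iso lunit_natural runit_iso runit_natural)

end

lemma endo_cat_op_simps:
  "iso_arrow (endo_cat (op_bicat B) x) = iso_arrow (endo_cat B x)"
  "mono_arrow (endo_cat (op_bicat B) x) = mono_arrow (endo_cat B x)"
  "subobject_class (endo_cat (op_bicat B) x) = subobject_class (endo_cat B x)"
  by (simp_all add: fun_eq_iff iso_arrow_def inverse_arrows_def mono_arrow_def subobject_class_def)

context bicategorical_adjunction
begin

lemma assoc_inv_op_cells [simp]:
  "assoc_inv (op_bicat B) fs f fs = assoc B fs f fs" "assoc_inv (op_bicat B) f fs f = assoc B f fs f"
  by (rule assoc_inv_op[of b a b a] assoc_inv_op[of a b a b]; simp)+

lemma adjunction_op: "adjunction (op_bicat B) a b fs f \<eta> \<epsilon>"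
  using adj by (simp add: adjunction_def)

lemma adj_monoid_op: "adj_monoid (op_bicat B) fs f \<eta> \<epsilon> = M"
proof -
  have "mon_mult M = (runit B fs \<otimes>\<^sub>2 \<iota> f) \<bullet> ((\<iota> fs \<otimes>\<^sub>2 \<epsilon>) \<otimes>\<^sub>2 \<iota> f)
      \<bullet> (assoc B fs f fs \<otimes>\<^sub>2 \<iota> f) \<bullet> assoc_inv B (fs \<otimes>\<^sub>1 f) fs f"
    using arg_cong[OF mult_cell_counitR, of val2]
        by (simp add: val2_mult_cell counitR_def whisker_right vc_assoc val2_simps)
  then show ?thesis
    by (simp add: adj_monoid_def)
qed

lemma adj_comonoid_op: "adj_comonoid (op_bicat B) a fs f \<eta> \<epsilon> = K"
proof -
  have "comon_comult K = assoc_inv B f fs (f \<otimes>\<^sub>1 fs) \<bullet> (\<iota> f \<otimes>\<^sub>2 assoc B fs f fs) \<bullet> (\<iota> f \<otimes>\<^sub>2 \<eta> \<otimes>\<^sub>2 \<iota> fs) \<bullet>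
      (\<iota> f \<otimes>\<^sub>2 inv2 B (id1 B a \<otimes>\<^sub>1 fs) fs (lunit B fs))"
    using arg_cong[OF comult_unitL_G, of val2]
        by (simp add: val2_comult unitL_def whisker_left vc_assoc val2_simps)
  then show ?thesis
    by (simp add: adj_comonoid_def)
qed

text \<open>The formula for \<open>\<Gamma>\<close> at \<open>f\<^sup>*\<close> is literally the formula at \<open>f\<close> read in the opposite bicategory.\<close>

lemma Gamma_r_op:
  "Gamma_r_rep B f fs \<epsilon> = Gamma_l_rep (op_bicat B) fs f \<epsilon>"
  "Gamma_r B f fs \<epsilon> = Gamma_l (op_bicat B) fs f \<epsilon>"
proof -
  show "Gamma_r_rep B f fs \<epsilon> = Gamma_l_rep (op_bicat B) fs f \<epsilon>"
    by (auto simp: fun_eq_iff Gamma_r_rep_def Gamma_l_rep_def xi_l_def xi_r_def)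
  then show "Gamma_r B f fs \<epsilon> = Gamma_l (op_bicat B) fs f \<epsilon>"
    by (intro ext) (simp only: Gamma_r_def Gamma_l_def)
qed

text \<open>Reversing the 1-cells exchanges the two conditions on subobjects and the order of the factors in the
product.\<close>

lemma Il_monoid_op: "Il_monoid (endo_cat (op_bicat B) a) M = opposite_monoid (Ir_monoid (endo_cat B a) M)"
proof -
  have "subobject_mult (endo_cat (op_bicat B) a) M X Y = subobject_mult (endo_cat B a) M Y X" for X Y
    by (auto simp: subobject_mult_def endo_cat_op_simps)
  then show ?thesis
    by (simp add: Il_monoid_def Ir_monoid_def opposite_monoid_def fun_eq_iff Il_rep_def Ir_rep_def
        endo_cat_op_simps)
qed

lemma End_monoid_op: "End_monoid (endo_cat (op_bicat B) b) K = End_monoid (endo_cat B b) K"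
  by (simp add: End_monoid_def comonoid_endos_def)

end

section \<open>The two isomorphisms\<close>

theorem theorem3p8:
  fixes B :: "('o, 'm, 'c) bicat_data"
    and a b :: 'o and f fs :: 'm and \<eta> \<epsilon> :: 'c
  assumes "bicategory B"
    and "adjunction B a b f fs \<eta> \<epsilon>"
    and "separable_cell B a f fs \<eta>"
    and "idempotents_split (hom_cat B a a)"
  defines "S \<equiv> adj_monoid B f fs \<eta> \<epsilon>"
    and "K \<equiv> adj_comonoid B a f fs \<eta> \<epsilon>"
  shows "(\<forall>X \<in> carrier (Il_monoid (endo_cat B a) S). \<forall>p \<in> X. Gamma_l B f fs \<epsilon> X = Gamma_l_rep B f fs \<epsilon> p) \<and>
     monoid_isomorphism (Il_monoid (endo_cat B a) S) (End_monoid (endo_cat B b) K) (Gamma_l B f fs \<epsilon>) \<and>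
     (\<forall>X \<in> carrier (Ir_monoid (endo_cat B a) S). \<forall>p \<in> X. Gamma_r B f fs \<epsilon> X = Gamma_r_rep B f fs \<epsilon> p) \<and>
     monoid_isomorphism (opposite_monoid (Ir_monoid (endo_cat B a) S)) (End_monoid (endo_cat B b) K)
       (Gamma_r B f fs \<epsilon>)"
proof -
  interpret bicategorical_adjunction B a b f fs \<eta> \<epsilon>
    using assms(1,2) by (simp add: bicategorical_adjunction_def bicategorical_adjunction_axioms_def)
  obtain \<rho> where \<rho>: "\<rho> \<in> two_cells B (hcomp1 B fs f) (id1 B a)" "vcomp B \<rho> \<eta> = id2 B (id1 B a)"
    using assms(3) by (auto simp: separable_cell_def split_mono_arrow_def)
  interpret left: separable_adjunction B a b f fs \<eta> \<epsilon> \<rho>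
    by unfold_locales (fact \<rho>)+
  interpret right: separable_adjunction "op_bicat B" a b fs f \<eta> \<epsilon> \<rho>
    using bicategory_op_bicat adjunction_op \<rho>
    by (simp add: separable_adjunction_def separable_adjunction_axioms_def
        bicategorical_adjunction_def bicategorical_adjunction_axioms_def)
  have "carrier (Ir_monoid (endo_cat B a) S) = carrier (opposite_monoid (Ir_monoid (endo_cat B a) S))"
    by (simp add: opposite_monoid_def)
  with left.Gamma_l_isomorphism[OF assms(4)]
    right.Gamma_l_isomorphism[unfolded op_bicat_simps
        adj_monoid_op adj_comonoid_op Il_monoid_op End_monoid_op Gamma_r_op[symmetric], OF assms(4)]
  show ?thesis
    unfolding S_def K_def by simp
qed

end
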